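(* Let $n\ge2$, $r=2/(n-1)$ and let $c_0$ be such that $c_0^{n-1}=-r(r+1)$. For any $\gamma>0$ there exists $\rho_0$ big enough such that for any $\rho\ge\rho_0$, the inner equations, $\Delta^2(\phi)=-\phi^n+G(\phi,\mu)$ (polynomial case) and $\Delta^2(\phi)=-e^{(n-1)\phi}+G(e^\phi,\mu)$ (trigonometric case), have two analytic solutions $\phi^{\rm u}:D^{\rm u}_{\gamma,\rho}\times B(\mu_0)\to\mathbb C$ and $\phi^{\rm s}:D^{\rm s}_{\gamma,\rho}\times B(\mu_0)\to\mathbb C$ such that $$\phi^{{\rm u},{\rm s}}(z,\mu)=\phi_0(z)+\psi^{{\rm u},{\rm s}}(z,\mu),$$ with $$\sup_{(z,\mu)\in D^{{\rm u},{\rm s}}_{\gamma,\rho}\times B(\mu_0)}|z^{r+2}\psi^{{\rm u},{\rm s}}(z,\mu)|<+\infty ,$$ where $\phi_0$ is the truncated formal solution of the corresponding equation (see context).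
   Context: $\Delta^2(\phi)(z)=\phi(z+1)-2\phi(z)+\phi(z-1)$. $B(\mu_0)$ is the open disc of radius $\mu_0$ centred at $0$ in $\mathbb C$, and $G$ is analytic in the open bidisc $\{|y|<\varrho\}\times B(\mu_0)$, with $G(y,\mu)=\sum_{k\ge n+1}G_k(\mu)y^k$ in the polynomial case and $G(e^y,\mu)=\sum_{k\ge n}G_k(\mu)e^{ky}$ in the trigonometric case. Domains: $D^{\rm s}_{\gamma,\rho}=\{z\in\mathbb C:|\mathrm{Im}\,z|>-\gamma\,\mathrm{Re}\,z+\rho\}$ and $D^{\rm u}_{\gamma,\rho}=-D^{\rm s}_{\gamma,\rho}$. On each of them $\log z$ and the powers $z^{-kr}$ denote analytic branches, agreeing for $\mathrm{Im}\,z<0$. Truncated formal solution $\phi_0$. Put $\tilde\phi_0\equiv0$ in the polynomial case and $\tilde\phi_0(z)=\frac1{n-1}\log\left(-\frac2{n-1}\frac1{z^2}\right)$ in the trigonometric case. With $\Delta^2=4\sinh^2(\frac12\partial_z)$ acting formally, the inner equation has a formal solution with coefficients analytic in $\mu\in B(\mu_0)$, of the following form ($[x]$ is the integer part of $x$): - $n$ even: $\tilde\phi_0(z)+\sum_{k\ge1}c_{k-1}(\mu)z^{-kr}$, where in the polynomial case the first coefficient is the given $c_0$; - $n=2m-1$, $m\ge2$, polynomial case: $\sum_{k\ge1}z^{-kr}\sum_{0\le j\le[(k-1)/(m-1)]}c_{k-1,j}(\mu)\log^jz$, with $c_{0,0}=c_0$; - $n=2m-1$, $m\ge2$, trigonometric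 case: $\tilde\phi_0(z)+\sum_{k\ge1}z^{-kr}\sum_{0\le j\le[k/(m-1)]}c_{k-1,j}(\mu)\log^jz$. For $n=2m-1$ the formal solution is normalized by $c_{m-1,0}=0$. $\phi_0$ is the truncation of this formal solution up to order $n$ in $z^{-r}$, i.e. $\tilde\phi_0$ plus the terms with $1\le k\le n$ in the sum over $k$; its dependence on $\mu$ is not written.
   Formalization: Adds that G is bounded on {|y|<δ}×B(μ0) for some δ>0 (false otherwise: n=2, μ0=1, G=y³/(1−μ)); in the trigonometric case with n=2m−1, c_{m−1,0}=0, which may be unattainable, is replaced by any bounded choice of the free coefficient c_{m−2,0} of 1/z. *)

theory Defs
  imports "HOL-Complex_Analysis.Complex_Analysis"
    "HOL-Computational_Algebra.Computational_Algebra"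
begin

datatype inner_case = Polynomial | Trigonometric

text \<open>Analyticity in two complex variables on an open set: complex Frechet differentiability.\<close>

definition holomorphic2_on :: "(complex \<times> complex \<Rightarrow> complex) \<Rightarrow> (complex \<times> complex) set \<Rightarrow> bool" where
  "holomorphic2_on f S \<longleftrightarrow>
     (\<forall>p\<in>S. \<exists>a b. (f has_derivative (\<lambda>h. a * fst h + b * snd h)) (at p))"

definition Dom_s :: "real \<Rightarrow> real \<Rightarrow> complex set" where
  "Dom_s \<gamma> \<rho> = {z. \<bar>Im z\<bar> > - \<gamma> * Re z + \<rho>}"

definition Dom_u :: "real \<Rightarrow> real \<Rightarrow> complex set" where
  "Dom_u \<gamma> \<rho> = uminus ` Dom_s \<gamma> \<rho>"

text \<open>
  For positive \<open>\<rho>\<close> the domains \<open>Dom_s \<gamma> \<rho>\<close> and \<open>Dom_u \<gamma> \<rho>\<close> avoid the negative and the positive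
  real half-axis, respectively, so every branch of the logarithm on one of them is the restriction
  of a branch on a slit plane. Working on the slit planes makes the choice of the branches
  independent of \<open>\<rho>\<close>.
\<close>

definition log_branches :: "(complex \<Rightarrow> complex) \<Rightarrow> (complex \<Rightarrow> complex) \<Rightarrow> bool" where
  "log_branches lu ls \<longleftrightarrow>
     ls holomorphic_on (- \<real>\<^sub>\<le>\<^sub>0) \<and> (\<forall>z\<in>- \<real>\<^sub>\<le>\<^sub>0. exp (ls z) = z) \<and>
     lu holomorphic_on (- \<real>\<^sub>\<ge>\<^sub>0) \<and> (\<forall>z\<in>- \<real>\<^sub>\<ge>\<^sub>0. exp (lu z) = z) \<and>
     (\<forall>z. Im z < 0 \<longrightarrow> lu z = ls z)"

definition branch_power :: "(complex \<Rightarrow> complex) \<Rightarrow> complex \<Rightarrow> real \<Rightarrow> complex" where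
  "branch_power lg z a = exp (of_real a * lg z)"

definition rexp :: "nat \<Rightarrow> real" where
  "rexp n = 2 / (real n - 1)"


subsection \<open>The inner equation\<close>

text \<open>
  \<open>G (y, \<mu>)\<close> is only given for \<open>norm y < \<rr>\<close>; \<open>inner_arg\<close> is the value substituted for \<open>y\<close>.
\<close>

fun inner_arg :: "inner_case \<Rightarrow> complex \<Rightarrow> complex" where
  "inner_arg Polynomial \<phi> = \<phi>"
| "inner_arg Trigonometric \<phi> = exp \<phi>"

fun inner_rhs :: "inner_case \<Rightarrow> nat \<Rightarrow> (complex \<times> complex \<Rightarrow> complex) \<Rightarrow> complex \<Rightarrow> complex \<Rightarrow> complex" where
  "inner_rhs Polynomial n G \<phi> \<mu> = - (\<phi> ^ n) + G (\<phi>, \<mu>)"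
| "inner_rhs Trigonometric n G \<phi> \<mu> = - exp (of_nat (n - 1) * \<phi>) + G (exp \<phi>, \<mu>)"

fun inner_expansion :: "inner_case \<Rightarrow> nat \<Rightarrow> real \<Rightarrow> complex set \<Rightarrow>
    (complex \<times> complex \<Rightarrow> complex) \<Rightarrow> (nat \<Rightarrow> complex \<Rightarrow> complex) \<Rightarrow> bool" where
  "inner_expansion Polynomial n \<rr> M G Gk \<longleftrightarrow>
     (\<forall>\<mu>\<in>M. (\<forall>k<n+1. Gk k \<mu> = 0) \<and>
        (\<forall>y. norm y < \<rr> \<longrightarrow> (\<lambda>k. Gk k \<mu> * y ^ k) sums G (y, \<mu>)))"
| "inner_expansion Trigonometric n \<rr> M G Gk \<longleftrightarrow>
     (\<forall>\<mu>\<in>M. (\<forall>k<n. Gk k \<mu> = 0) \<and>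
        (\<forall>y. norm (exp y) < \<rr> \<longrightarrow> (\<lambda>k. Gk k \<mu> * exp (of_nat k * y)) sums G (exp y, \<mu>)))"

definition Delta2 :: "(complex \<Rightarrow> complex) \<Rightarrow> complex \<Rightarrow> complex" where
  "Delta2 \<phi> z = \<phi> (z + 1) - 2 * \<phi> z + \<phi> (z - 1)"

text \<open>
  A function on \<open>D \<times> M\<close> can satisfy the difference equation only at the points \<open>z\<close> of \<open>D\<close> whose
  two neighbours \<open>z - 1\<close>, \<open>z + 1\<close> also lie in \<open>D\<close>.
\<close>

definition inner_solution :: "inner_case \<Rightarrow> nat \<Rightarrow> real \<Rightarrow> (complex \<times> complex \<Rightarrow> complex) \<Rightarrow>
    complex set \<Rightarrow> complex set \<Rightarrow> (complex \<times> complex \<Rightarrow> complex) \<Rightarrow> bool" where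
  "inner_solution cs n \<rr> G D M \<phi> \<longleftrightarrow>
     (\<forall>z \<mu>. z - 1 \<in> D \<and> z \<in> D \<and> z + 1 \<in> D \<and> \<mu> \<in> M \<longrightarrow>
        norm (inner_arg cs (\<phi> (z, \<mu>))) < \<rr> \<and>
        Delta2 (\<lambda>x. \<phi> (x, \<mu>)) z = inner_rhs cs n G (\<phi> (z, \<mu>)) \<mu>)"


subsection \<open>Formal solutions\<close>

text \<open>
  Formal expressions in \<open>z\<close> are elements of the ring of power series in \<open>w = z\<^sup>-\<^sup>r\<close> whose
  coefficients are polynomials in \<open>L = log z\<close>. The operator \<open>z \<partial>\<^sub>z\<close> maps \<open>w\<^sup>k P(L)\<close> to
  \<open>w\<^sup>k (P'(L) - k r P(L))\<close>, and \<open>z\<^sup>-\<^sup>2 = w\<^sup>n\<^sup>-\<^sup>1\<close> since \<open>r = 2/(n-1)\<close>; hence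
  \<open>\<partial>\<^sub>z\<^sup>2 = w\<^sup>n\<^sup>-\<^sup>1 ((z \<partial>\<^sub>z)\<^sup>2 - z \<partial>\<^sub>z)\<close> acts on this ring, also when \<open>\<partial>\<^sub>z\<close> itself does not.
\<close>

definition formal_zd :: "nat \<Rightarrow> complex poly fps \<Rightarrow> complex poly fps" where
  "formal_zd n f = Abs_fps (\<lambda>k. pderiv (fps_nth f k) - smult (of_real (real k * rexp n)) (fps_nth f k))"

definition formal_d2 :: "nat \<Rightarrow> complex poly fps \<Rightarrow> complex poly fps" where
  "formal_d2 n f = fps_X ^ (n - 1) * (formal_zd n (formal_zd n f) - formal_zd n f)"

text \<open>
  \<open>4 sinh\<^sup>2(\<partial>/2) = 2 cosh \<partial> - 2\<close> is the sum of \<open>2 \<partial>\<^sup>2\<^sup>l / (2l)!\<close> over \<open>l \<ge> 1\<close>. As \<open>\<partial>\<^sup>2\<close> raises the order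
  in \<open>w\<close> by \<open>n - 1 \<ge> 1\<close>, only the terms with \<open>l \<le> k\<close> contribute to the coefficient of \<open>w\<^sup>k\<close>.
\<close>

definition formal_Delta2 :: "nat \<Rightarrow> complex poly fps \<Rightarrow> complex poly fps" where
  "formal_Delta2 n f =
     Abs_fps (\<lambda>k. \<Sum>l=1..k. smult (2 / fact (2 * l)) (fps_nth ((formal_d2 n ^^ l) f) k))"

text \<open>
  Degree bound in \<open>log z\<close> of the coefficient of \<open>z\<^sup>-\<^sup>k\<^sup>r\<close>; for \<open>n = 2m - 1\<close>, \<open>m - 1 = (n - 1) div 2\<close>.
\<close>

fun log_deg :: "inner_case \<Rightarrow> nat \<Rightarrow> nat \<Rightarrow> nat" where
  "log_deg Polynomial n k = (if even n then 0 else (k - 1) div ((n - 1) div 2))"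
| "log_deg Trigonometric n k = (if even n then 0 else k div ((n - 1) div 2))"

text \<open>
  The coefficients are \<open>c k j \<mu>\<close>, only used for \<open>j \<le> log_deg cs n (k + 1)\<close>; for even \<open>n\<close> the
  coefficient \<open>c\<^sub>k\<close> is \<open>c k 0\<close>.
\<close>

definition formal_sum :: "inner_case \<Rightarrow> nat \<Rightarrow> (nat \<Rightarrow> nat \<Rightarrow> complex \<Rightarrow> complex) \<Rightarrow> complex \<Rightarrow>
    complex poly fps" where
  "formal_sum cs n c \<mu> =
     Abs_fps (\<lambda>k. if k = 0 then 0 else \<Sum>j\<le>log_deg cs n k. monom (c (k - 1) j \<mu>) j)"

text \<open>
  \<open>l0\<close> is a logarithm of \<open>-2/(n-1)\<close>, so that \<open>(l0 - 2 log z)/(n-1)\<close> is a branch of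
  \<open>log (-2/(n-1) z\<^sup>-\<^sup>2)/(n-1)\<close>; its exponential is \<open>exp (l0/(n-1)) w\<close>.
\<close>

fun tilde_phi0 :: "inner_case \<Rightarrow> nat \<Rightarrow> complex \<Rightarrow> (complex \<Rightarrow> complex) \<Rightarrow> complex \<Rightarrow> complex" where
  "tilde_phi0 Polynomial n l0 lg z = 0"
| "tilde_phi0 Trigonometric n l0 lg z = (l0 - 2 * lg z) / of_nat (n - 1)"

fun formal_tilde_phi0 :: "inner_case \<Rightarrow> nat \<Rightarrow> complex \<Rightarrow> complex poly fps" where
  "formal_tilde_phi0 Polynomial n l0 = 0"
| "formal_tilde_phi0 Trigonometric n l0 = fps_const [: l0 / of_nat (n - 1), - 2 / of_nat (n - 1) :]"

definition formal_exp_phi :: "nat \<Rightarrow> complex \<Rightarrow> complex poly fps \<Rightarrow> complex poly fps" where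
  "formal_exp_phi n l0 u =
     fps_const [: exp (l0 / of_nat (n - 1)) :] * fps_X * (Abs_fps (\<lambda>k. [: 1 / fact k :]) oo u)"

text \<open>
  The right-hand side at \<open>formal_tilde_phi0 cs n l0 + u\<close>, where \<open>u\<close> has no term of order \<open>0\<close> in \<open>w\<close>
  and \<open>g\<close> is the coefficient sequence of \<open>G\<close>.
\<close>

fun formal_rhs :: "inner_case \<Rightarrow> nat \<Rightarrow> complex \<Rightarrow> (nat \<Rightarrow> complex) \<Rightarrow> complex poly fps \<Rightarrow>
    complex poly fps" where
  "formal_rhs Polynomial n l0 g u = - (u ^ n) + (Abs_fps (\<lambda>k. [: g k :]) oo u)"
| "formal_rhs Trigonometric n l0 g u =
     - (formal_exp_phi n l0 u ^ (n - 1)) + (Abs_fps (\<lambda>k. [: g k :]) oo formal_exp_phi n l0 u)"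

text \<open>
  For odd \<open>n = 2m - 1\<close> one coefficient of the formal solution is free: \<open>c\<^sub>m\<^sub>-\<^sub>1\<^sub>,\<^sub>0\<close> (of \<open>z\<^sup>-\<^sup>r\<^sup>-\<^sup>1\<close>) in the
  polynomial case and \<open>c\<^sub>m\<^sub>-\<^sub>2\<^sub>,\<^sub>0\<close> (of \<open>z\<^sup>-\<^sup>1\<close>) in the trigonometric case, since \<open>z\<^sup>-\<^sup>r\<^sup>-\<^sup>1\<close> and \<open>z\<^sup>-\<^sup>1\<close>
  solve the respective linearised equations at leading order. The former is normalised to \<open>0\<close>.
  In the trigonometric case \<open>c\<^sub>m\<^sub>-\<^sub>1\<^sub>,\<^sub>0\<close> is determined by \<open>c\<^sub>m\<^sub>-\<^sub>2\<^sub>,\<^sub>0\<close> and can in general not be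
  prescribed, so there every bounded choice of the free coefficient (\<open>0\<close> in particular) is admitted,
  which includes the solutions with bounded \<open>c\<^sub>m\<^sub>-\<^sub>2\<^sub>,\<^sub>0\<close> and \<open>c\<^sub>m\<^sub>-\<^sub>1\<^sub>,\<^sub>0 = 0\<close>.
\<close>

fun normalized :: "inner_case \<Rightarrow> nat \<Rightarrow> complex set \<Rightarrow> (nat \<Rightarrow> nat \<Rightarrow> complex \<Rightarrow> complex) \<Rightarrow> bool" where
  "normalized Polynomial n M c \<longleftrightarrow> (odd n \<longrightarrow> (\<forall>\<mu>\<in>M. c ((n + 1) div 2 - 1) 0 \<mu> = 0))"
| "normalized Trigonometric n M c \<longleftrightarrow> (odd n \<longrightarrow> bounded (c ((n + 1) div 2 - 2) 0 ` M))"

definition formal_solution :: "inner_case \<Rightarrow> nat \<Rightarrow> complex \<Rightarrow> complex \<Rightarrow> complex set \<Rightarrow>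
    (nat \<Rightarrow> complex \<Rightarrow> complex) \<Rightarrow> (nat \<Rightarrow> nat \<Rightarrow> complex \<Rightarrow> complex) \<Rightarrow> bool" where
  "formal_solution cs n c0 l0 M Gk c \<longleftrightarrow>
     (\<forall>k. \<forall>j\<le>log_deg cs n (k + 1). c k j holomorphic_on M) \<and>
     (\<forall>\<mu>\<in>M. formal_Delta2 n (formal_tilde_phi0 cs n l0 + formal_sum cs n c \<mu>) =
              formal_rhs cs n l0 (\<lambda>k. Gk k \<mu>) (formal_sum cs n c \<mu>)) \<and>
     (cs = Polynomial \<longrightarrow> (\<forall>\<mu>\<in>M. c 0 0 \<mu> = c0)) \<and>
     normalized cs n M c"

definition phi0 :: "inner_case \<Rightarrow> nat \<Rightarrow> complex \<Rightarrow> (nat \<Rightarrow> nat \<Rightarrow> complex \<Rightarrow> complex) \<Rightarrow>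
    (complex \<Rightarrow> complex) \<Rightarrow> complex \<Rightarrow> complex \<Rightarrow> complex" where
  "phi0 cs n l0 c lg z \<mu> = tilde_phi0 cs n l0 lg z +
     (\<Sum>k=1..n. branch_power lg z (- (real k * rexp n)) *
        (\<Sum>j\<le>log_deg cs n k. c (k - 1) j \<mu> * lg z ^ j))"

definition asymptotic_to :: "nat \<Rightarrow> (complex \<Rightarrow> complex) \<Rightarrow> (complex \<Rightarrow> complex \<Rightarrow> complex) \<Rightarrow>
    complex set \<Rightarrow> complex set \<Rightarrow> (complex \<times> complex \<Rightarrow> complex) \<Rightarrow> bool" where
  "asymptotic_to n lg \<phi>0 D M \<phi> \<longleftrightarrow>
     (\<exists>\<psi>. (\<forall>z\<in>D. \<forall>\<mu>\<in>M. \<phi> (z, \<mu>) = \<phi>0 z \<mu> + \<psi> (z, \<mu>)) \<and>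
          bdd_above ((\<lambda>(z, \<mu>). norm (branch_power lg z (rexp n + 2) * \<psi> (z, \<mu>))) ` (D \<times> M)))"

end

theory Submission
  imports Defs "HOL-Library.Landau_Symbols"
begin

text \<open>
  Both equations are treated at once, and \<open>D\<^sup>u\<close> is reduced to \<open>D\<^sup>s\<close> by \<open>z \<mapsto> - z\<close>, which preserves
  \<open>\<Delta>\<^sup>2\<close> and turns a branch of the logarithm into \<open>Ln + \<kappa>\<close> with \<open>exp (2 \<kappa>) = 1\<close>.

  Truncate the formal solution at a large order \<open>N\<close> instead of \<open>n\<close>. Its coefficients are bounded
  uniformly in \<open>\<mu>\<close>, because they solve the recursion
  \<open>P'' - (2 k r + 1) P' + (k r (k r + 1) - s) P = Q\<close> whose only resonance is covered by the
  normalisation; hence the truncation solves the equation up to \<open>O(z\<^sup>-\<^sup>r\<^sup>N)\<close> uniformly in \<open>\<mu>\<close>.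
  The remaining correction \<open>\<psi>\<close> is a fixed point of \<open>\<psi> \<mapsto> \<Sum>k\<ge>1. k g(\<psi>)(z + k)\<close>, since this sum
  inverts \<open>\<Delta>\<^sup>2\<close>. With the weight \<open>W z = Re z + (2 / \<gamma>) |Im z|\<close>, which is comparable to \<open>|z|\<close> on
  \<open>D\<^sup>s\<close> and satisfies \<open>W (z + k) = W z + k\<close>, the linearisation is at most \<open>K W\<^sup>-\<^sup>2\<close> with \<open>K\<close> independent of
  \<open>N\<close>, and the map contracts by \<open>K / p\<close> on functions of size \<open>W\<^sup>-\<^sup>p\<close>. It remains to take first \<open>p\<close>,
  then \<open>N\<close>, then \<open>\<rho>\<^sub>0\<close> large.
\<close>

text \<open>The linearisation is of size z^-2, the same order as the second difference itself, so it
  is not a small perturbation of \<open>Delta2\<close> and no choice of \<open>\<rho>\<close> makes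
  it small. The linearised operator is never inverted: the inverse of \<open>Delta2\<close> alone is
  used, and all smallness comes from the factor 1/p. The price is an approximate solution of
  arbitrarily high precision, hence the calculus of expansions below. Its remainders carry powers of
  log z, which are always paid for with one whole power of \<open>w\<close>; this loss is harmless
  since the order is free. The exponent r + 2 comes from the return to order n: the two truncations
  differ by \<open>O(w^n)\<close>, and |w|^n = |z|^(-r-2) because n r = r + 2. Coefficients that are
  holomorphic on the open disc may still blow up at its boundary. Their uniform bounds are extracted
  from a bound of \<open>G\<close> near y = 0, by Cauchy's inequality and then by the
  recursion.\<close>

subsection \<open>Analytic functions of two variables\<close>

lemma holomorphic2_onD:
  assumes "holomorphic2_on f S" "p \<in> S"
  obtains a b where "(f has_derivative (\<lambda>h. a * fst h + b * snd h)) (at p)"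
  using assms by (auto simp: holomorphic2_on_def)

lemma holomorphic2_on_imp_continuous_on:
  assumes "holomorphic2_on f S"
  shows "continuous_on S f"
proof (rule continuous_at_imp_continuous_on, rule ballI)
  fix p assume "p \<in> S"
  then show "isCont f p"
    using assms by (elim holomorphic2_onD) (auto dest: has_derivative_continuous)
qed

lemma holomorphic2_on_imp_holomorphic_fst:
  assumes "holomorphic2_on f (A \<times> B)" "y \<in> B"
  shows "(\<lambda>x. f (x, y)) holomorphic_on A"
  unfolding holomorphic_on_def field_differentiable_def
proof
  fix x assume "x \<in> A"
  then obtain a b where d: "(f has_derivative (\<lambda>h. a * fst h + b * snd h)) (at (x, y))"
    using holomorphic2_onD[OF assms(1), of "(x, y)"] assms(2) by blast
  have "((\<lambda>x. (x, y)) has_derivative (\<lambda>h. (h, 0))) (at x)"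
    by (auto intro!: derivative_eq_intros)
  from has_derivative_compose[OF this d]
  have "((\<lambda>x. f (x, y)) has_field_derivative a) (at x)"
    by (simp add: has_field_derivative_def)
  then show "\<exists>f'. ((\<lambda>x. f (x, y)) has_field_derivative f') (at x within A)"
    using has_field_derivative_at_within by blast
qed

lemma holomorphic2_on_imp_holomorphic_snd:
  assumes "holomorphic2_on f (A \<times> B)" "x \<in> A"
  shows "(\<lambda>y. f (x, y)) holomorphic_on B"
  unfolding holomorphic_on_def field_differentiable_def
proof
  fix y assume "y \<in> B"
  then obtain a b where d: "(f has_derivative (\<lambda>h. a * fst h + b * snd h)) (at (x, y))"
    using holomorphic2_onD[OF assms(1), of "(x, y)"] assms(2) by blast
  have "((\<lambda>y. (x, y)) has_derivative (\<lambda>h. (0, h))) (at y)"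
    by (auto intro!: derivative_eq_intros)
  from has_derivative_compose[OF this d]
  have "((\<lambda>y. f (x, y)) has_field_derivative b) (at y)"
    by (simp add: has_field_derivative_def)
  then show "\<exists>f'. ((\<lambda>y. f (x, y)) has_field_derivative f') (at y within B)"
    using has_field_derivative_at_within by blast
qed

text \<open>Two partial derivatives combine to a Frechet derivative as soon as one of them is
  jointly continuous at the point. For the derivative in y this follows from Cauchy's inequality,
  applied to the difference of two slices of \<open>f\<close>, which is small by uniform continuity
  on a compact bidisc.\<close>

lemma Osgood_holomorphic2_on:
  fixes f :: "complex \<times> complex \<Rightarrow> complex"
  assumes "open A" "open B" and cont: "continuous_on (A \<times> B) f"
    and fst: "\<And>y. y \<in> B \<Longrightarrow> (\<lambda>x. f (x, y)) holomorphic_on A"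
    and snd: "\<And>x. x \<in> A \<Longrightarrow> (\<lambda>y. f (x, y)) holomorphic_on B"
  shows "holomorphic2_on f (A \<times> B)"
  unfolding holomorphic2_on_def
proof (intro ballI)
  fix p assume "p \<in> A \<times> B"
  then obtain x0 y0 where p: "p = (x0, y0)" and x0: "x0 \<in> A" and y0: "y0 \<in> B" by auto
  obtain d where d: "d > 0" "cball x0 d \<subseteq> A"
    using \<open>open A\<close> x0 open_contains_cball by blast
  \<comment> \<open>The doubled radius leaves room for a disc of radius \<open>e\<close> around
    every point of \<open>ball y0 e\<close>, as Cauchy's inequality needs.\<close>
  obtain e where e: "e > 0" "cball y0 (2 * e) \<subseteq> B"
  proof -
    obtain e' where "e' > 0" "cball y0 e' \<subseteq> B"
      using \<open>open B\<close> y0 open_contains_cball by blast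
    then show ?thesis using that[of "e' / 2"] by simp
  qed
  define K where "K = cball x0 d \<times> cball y0 (2 * e)"
  have KS: "K \<subseteq> A \<times> B" using d e by (auto simp: K_def)
  have "uniformly_continuous_on K f"
    unfolding K_def using KS[unfolded K_def] cont
    by (intro compact_uniformly_continuous compact_Times compact_cball) (auto intro: continuous_on_subset)
  define D where "D = (\<lambda>x y. deriv (\<lambda>y. f (x, y)) y)"
  define X where "X = ball x0 d"
  define Y where "Y = ball y0 e"
  have hd: "((\<lambda>y. f (x, y)) has_field_derivative D x y) (at y)" if "x \<in> X" "y \<in> Y" for x y
  proof -
    have "x \<in> A" "y \<in> B" using that d e unfolding X_def Y_def by (auto simp: subset_eq)
    then show ?thesis unfolding D_def using snd \<open>open B\<close> holomorphic_derivI by blast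
  qed
  have Dcont: "continuous (at (x0, y0) within X \<times> Y) (\<lambda>(x, y). D x y)"
    unfolding continuous_within_eps_delta
  proof (intro allI impI)
    fix \<epsilon> :: real assume "\<epsilon> > 0"
    have eps: "e * \<epsilon> / 4 > 0" using \<open>\<epsilon> > 0\<close> e by simp
    obtain \<delta>1 where \<delta>1: "\<delta>1 > 0" "\<And>p q. p \<in> K \<Longrightarrow> q \<in> K \<Longrightarrow> dist p q < \<delta>1 \<Longrightarrow> dist (f p) (f q) < e * \<epsilon> / 4"
      using \<open>uniformly_continuous_on K f\<close> eps unfolding uniformly_continuous_on_def by metis
    have "(\<lambda>y. D x0 y) holomorphic_on B"
      unfolding D_def using snd[OF x0] \<open>open B\<close> by (rule holomorphic_deriv)
    then have "isCont (D x0) y0"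
      using \<open>open B\<close> y0 continuous_on_eq_continuous_at holomorphic_on_imp_continuous_on by blast
    then obtain \<delta>2 where \<delta>2: "\<delta>2 > 0" "\<And>y. dist y y0 < \<delta>2 \<Longrightarrow> dist (D x0 y) (D x0 y0) < \<epsilon> / 2"
      using \<open>\<epsilon> > 0\<close> unfolding continuous_at_eps_delta by (meson half_gt_zero)
    have "dist (D x y) (D x0 y0) < \<epsilon>" if xy: "x \<in> X" "y \<in> Y" "dist (x, y) (x0, y0) < min \<delta>1 \<delta>2" for x y
    proof -
      have x: "dist x x0 < \<delta>1" and y: "dist y y0 < \<delta>2"
        using dist_fst_le[of "(x, y)" "(x0, y0)"] dist_snd_le[of "(x, y)" "(x0, y0)"] xy(3) by auto
      define h where "h = (\<lambda>t. f (x, t) - f (x0, t))"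
      have yB: "cball y e \<subseteq> cball y0 (2 * e)"
        using xy(2) by (intro subsetI, simp add: Y_def) (smt (verit, best) dist_triangle)
      have xA: "x \<in> A" and xK: "x \<in> cball x0 d" using xy(1) d unfolding X_def by (auto simp: subset_eq)
      have hB: "h holomorphic_on B"
        unfolding h_def using snd[OF xA] snd[OF x0] by (intro holomorphic_intros)
      have cB: "cball y e \<subseteq> B" using yB e by auto
      have hb: "norm (h t) \<le> e * \<epsilon> / 4" if "t \<in> cball y e" for t
      proof -
        have "(x, t) \<in> K" "(x0, t) \<in> K" using that yB xK d unfolding K_def by auto
        moreover have "dist (x, t) (x0, t) < \<delta>1" using x by (simp add: dist_Pair_Pair)
        ultimately show ?thesis using \<delta>1(2)[of "(x, t)" "(x0, t)"] by (simp add: h_def dist_norm)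
      qed
      have hc: "continuous_on (cball y e) h" "h holomorphic_on ball y e"
        using holomorphic_on_subset[OF hB cB] ball_subset_cball
        by (auto intro: holomorphic_on_imp_continuous_on holomorphic_on_subset)
      have "norm ((deriv ^^ 1) h y) \<le> fact 1 * (e * \<epsilon> / 4) / e ^ 1"
        using hc e hb by (intro Cauchy_inequality) (auto simp: dist_norm)
      then have "norm (deriv h y) \<le> \<epsilon> / 4" using e by simp
      moreover have "deriv h y = D x y - D x0 y"
      proof -
        have yB': "y \<in> B" using cB e by (auto simp: subset_eq)
        show ?thesis unfolding h_def D_def
          using snd[OF xA] snd[OF x0] yB' \<open>open B\<close>
          by (intro deriv_diff) (auto simp: holomorphic_on_open field_differentiable_def)
      qed
      ultimately have "dist (D x y) (D x0 y) \<le> \<epsilon> / 4" by (simp add: dist_norm)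
      moreover have "dist (D x0 y) (D x0 y0) < \<epsilon> / 2" using \<delta>2 y by blast
      ultimately show ?thesis using dist_triangle[of "D x y" "D x0 y0" "D x0 y"] \<open>\<epsilon> > 0\<close> by linarith
    qed
    then show "\<exists>\<delta>>0. \<forall>x'\<in>X \<times> Y. dist x' (x0, y0) < \<delta> \<longrightarrow>
        dist (case x' of (x, y) \<Rightarrow> D x y) (case (x0, y0) of (x, y) \<Rightarrow> D x y) < \<epsilon>"
      using \<delta>1(1) \<delta>2(1) by (intro exI[of _ "min \<delta>1 \<delta>2"]) auto
  qed
  have fx: "((\<lambda>x. f (x, y0)) has_field_derivative deriv (\<lambda>x. f (x, y0)) x0) (at x0 within X)"
    using fst[OF y0] \<open>open A\<close> x0 holomorphic_derivI by blast
  have main: "((\<lambda>(x, y). f (x, y)) has_derivative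
     (\<lambda>(tx, ty). deriv (\<lambda>x. f (x, y0)) x0 * tx + blinfun_mult_right (D x0 y0) ty)) (at (x0, y0) within X \<times> Y)"
  proof (rule has_derivative_partialsI[where f = "\<lambda>x y. f (x, y)" and fy = "\<lambda>x y. blinfun_mult_right (D x y)"])
    show "((\<lambda>x. f (x, y0)) has_derivative (*) (deriv (\<lambda>x. f (x, y0)) x0)) (at x0 within X)"
      using fx by (simp add: has_field_derivative_def)
    show "((\<lambda>y. f (x, y)) has_derivative blinfun_apply (blinfun_mult_right (D x y))) (at y within Y)"
      if "x \<in> X" "y \<in> Y" for x y
      using hd[OF that] by (simp add: has_field_derivative_def has_derivative_at_withinI)
    have "continuous (at (x0, y0) within X \<times> Y) (\<lambda>p. blinfun_mult_right (case p of (x, y) \<Rightarrow> D x y))"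
      using Dcont by (rule bounded_linear.continuous[OF bounded_linear_blinfun_mult_right])
    then show "continuous (at (x0, y0) within X \<times> Y) (\<lambda>(x, y). blinfun_mult_right (D x y))"
      by (simp add: case_prod_unfold)
  qed (use e in \<open>auto simp: Y_def\<close>)
  moreover have "at (x0, y0) within X \<times> Y = at (x0, y0)"
    using d e by (intro at_within_open) (auto simp: X_def Y_def open_Times)
  ultimately have "(f has_derivative (\<lambda>h. deriv (\<lambda>x. f (x, y0)) x0 * fst h + D x0 y0 * snd h)) (at p)"
    by (simp add: p case_prod_unfold)
  then show "\<exists>a b. (f has_derivative (\<lambda>h. a * fst h + b * snd h)) (at p)" by blast
qed

text \<open>Slices are handled by the one-variable theorem of Weierstrass and joint continuity by
  uniform convergence; \<open>Osgood_holomorphic2_on\<close> puts them together.\<close>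

lemma holomorphic2_on_uniform_limit:
  assumes "open A" "open B"
    and f: "\<And>k::nat. holomorphic2_on (f k) (A \<times> B)"
    and lim: "uniform_limit (A \<times> B) f g sequentially"
  shows "holomorphic2_on g (A \<times> B)"
proof -
  have slice: "(\<lambda>x. g (h x)) holomorphic_on S"
    if S: "open S" and hol: "\<And>k. (\<lambda>x. f k (h x)) holomorphic_on S" and h: "h ` S \<subseteq> A \<times> B"
    for S :: "complex set" and h :: "complex \<Rightarrow> complex \<times> complex"
  proof (rule holomorphic_uniform_sequence[OF S hol])
    fix x assume "x \<in> S"
    then obtain d where d: "d > 0" "cball x d \<subseteq> S"
      using S open_contains_cball by blast
    have "uniform_limit (cball x d) (\<lambda>k x. f k (h x)) (\<lambda>x. g (h x)) sequentially"
      unfolding uniform_limit_iff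
    proof (intro allI impI)
      fix \<epsilon> :: real assume "\<epsilon> > 0"
      with lim have "\<forall>\<^sub>F k in sequentially. \<forall>p\<in>A \<times> B. dist (f k p) (g p) < \<epsilon>"
        unfolding uniform_limit_iff by blast
      then show "\<forall>\<^sub>F k in sequentially. \<forall>x\<in>cball x d. dist (f k (h x)) (g (h x)) < \<epsilon>"
        by (rule eventually_mono) (use h d in blast)
    qed
    with d show "\<exists>d>0. cball x d \<subseteq> S \<and> uniform_limit (cball x d) (\<lambda>k x. f k (h x)) (\<lambda>x. g (h x)) sequentially"
      by blast
  qed
  show ?thesis
  proof (rule Osgood_holomorphic2_on[OF assms(1,2)])
    show "continuous_on (A \<times> B) g"
      using lim f by (intro uniform_limit_theorem[OF _ lim])
        (auto intro: always_eventually holomorphic2_on_imp_continuous_on)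
    show "(\<lambda>x. g (x, y)) holomorphic_on A" if "y \<in> B" for y
      using that by (intro slice[OF \<open>open A\<close>] holomorphic2_on_imp_holomorphic_fst[OF f]) auto
    show "(\<lambda>y. g (x, y)) holomorphic_on B" if "x \<in> A" for x
      using that by (intro slice[OF \<open>open B\<close>] holomorphic2_on_imp_holomorphic_snd[OF f]) auto
  qed
qed

section \<open>Closure properties of analyticity in two variables\<close>

lemma holomorphic2_on_add:
  assumes "holomorphic2_on f S" "holomorphic2_on g S"
  shows "holomorphic2_on (\<lambda>p. f p + g p) S"
  unfolding holomorphic2_on_def
proof
  fix p assume "p \<in> S"
  obtain a b where 1: "(f has_derivative (\<lambda>h. a * fst h + b * snd h)) (at p)"
    using assms(1) \<open>p \<in> S\<close> by (rule holomorphic2_onD)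
  obtain a' b' where 2: "(g has_derivative (\<lambda>h. a' * fst h + b' * snd h)) (at p)"
    using assms(2) \<open>p \<in> S\<close> by (rule holomorphic2_onD)
  show "\<exists>a b. ((\<lambda>p. f p + g p) has_derivative (\<lambda>h. a * fst h + b * snd h)) (at p)"
    using has_derivative_add[OF 1 2]
    by - (rule exI[of _ "a + a'"], rule exI[of _ "b + b'"], simp add: algebra_simps)
qed

lemma holomorphic2_on_mult:
  assumes "holomorphic2_on f S" "holomorphic2_on g S"
  shows "holomorphic2_on (\<lambda>p. f p * g p) S"
  unfolding holomorphic2_on_def
proof
  fix p assume "p \<in> S"
  obtain a b where 1: "(f has_derivative (\<lambda>h. a * fst h + b * snd h)) (at p)"
    using assms(1) \<open>p \<in> S\<close> by (rule holomorphic2_onD)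
  obtain a' b' where 2: "(g has_derivative (\<lambda>h. a' * fst h + b' * snd h)) (at p)"
    using assms(2) \<open>p \<in> S\<close> by (rule holomorphic2_onD)
  show "\<exists>a b. ((\<lambda>p. f p * g p) has_derivative (\<lambda>h. a * fst h + b * snd h)) (at p)"
    using has_derivative_mult[OF 1 2]
    by - (rule exI[of _ "f p * a' + a * g p"], rule exI[of _ "f p * b' + b * g p"], simp add: algebra_simps)
qed

lemma holomorphic2_on_const: "holomorphic2_on (\<lambda>p. k) S"
  unfolding holomorphic2_on_def by (intro ballI exI[of _ 0]) (auto intro!: derivative_eq_intros)

lemma holomorphic2_on_minus: "holomorphic2_on f S \<Longrightarrow> holomorphic2_on (\<lambda>p. - f p) S"
  using holomorphic2_on_mult[OF holomorphic2_on_const[of "-1"]] by simp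

lemma holomorphic2_on_diff:
  "holomorphic2_on f S \<Longrightarrow> holomorphic2_on g S \<Longrightarrow> holomorphic2_on (\<lambda>p. f p - g p) S"
  using holomorphic2_on_add[OF _ holomorphic2_on_minus] by simp

lemma holomorphic2_on_power: "holomorphic2_on f S \<Longrightarrow> holomorphic2_on (\<lambda>p. f p ^ k) S"
  by (induction k) (auto intro: holomorphic2_on_const holomorphic2_on_mult)

lemma holomorphic2_on_sum:
  "(\<And>i. i \<in> I \<Longrightarrow> holomorphic2_on (f i) S) \<Longrightarrow> holomorphic2_on (\<lambda>p. \<Sum>i\<in>I. f i p) S"
  by (induction I rule: infinite_finite_induct)
    (auto intro: holomorphic2_on_const holomorphic2_on_add)

lemma holomorphic2_on_compose:
  assumes f: "holomorphic2_on f S" and g: "\<And>p. p \<in> S \<Longrightarrow> g field_differentiable (at (f p))"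
  shows "holomorphic2_on (\<lambda>p. g (f p)) S"
  unfolding holomorphic2_on_def
proof
  fix p assume p: "p \<in> S"
  obtain a b where 1: "(f has_derivative (\<lambda>h. a * fst h + b * snd h)) (at p)"
    using f p by (rule holomorphic2_onD)
  obtain d where 2: "(g has_derivative (*) d) (at (f p))"
    using g[OF p] by (auto simp: field_differentiable_def has_field_derivative_def)
  show "\<exists>a b. ((\<lambda>p. g (f p)) has_derivative (\<lambda>h. a * fst h + b * snd h)) (at p)"
    using has_derivative_compose[OF 1 2]
    by - (rule exI[of _ "d * a"], rule exI[of _ "d * b"], simp add: algebra_simps)
qed

lemma holomorphic2_on_compose_Pair:
  assumes f: "holomorphic2_on f S" and g: "holomorphic2_on g S" and F: "holomorphic2_on F T"
    and T: "\<And>p. p \<in> S \<Longrightarrow> (f p, g p) \<in> T"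
  shows "holomorphic2_on (\<lambda>p. F (f p, g p)) S"
  unfolding holomorphic2_on_def
proof
  fix p assume p: "p \<in> S"
  obtain a b where 1: "(f has_derivative (\<lambda>h. a * fst h + b * snd h)) (at p)"
    using f p by (rule holomorphic2_onD)
  obtain a' b' where 2: "(g has_derivative (\<lambda>h. a' * fst h + b' * snd h)) (at p)"
    using g p by (rule holomorphic2_onD)
  obtain a'' b'' where 3: "(F has_derivative (\<lambda>h. a'' * fst h + b'' * snd h)) (at (f p, g p))"
    using F T[OF p] by (rule holomorphic2_onD)
  show "\<exists>a b. ((\<lambda>p. F (f p, g p)) has_derivative (\<lambda>h. a * fst h + b * snd h)) (at p)"
    using has_derivative_compose[OF has_derivative_Pair[OF 1 2] 3]
    by - (rule exI[of _ "a'' * a + b'' * a'"], rule exI[of _ "a'' * b + b'' * b'"], simp add: algebra_simps)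
qed

lemma holomorphic2_on_fst: "holomorphic2_on fst S"
  unfolding holomorphic2_on_def
  by (rule ballI, rule exI[of _ 1], rule exI[of _ 0])
    (simp add: bounded_linear_fst bounded_linear_imp_has_derivative)

lemma holomorphic2_on_snd: "holomorphic2_on snd S"
  unfolding holomorphic2_on_def
  by (rule ballI, rule exI[of _ 0], rule exI[of _ 1])
    (simp add: bounded_linear_snd bounded_linear_imp_has_derivative)

lemma holomorphic2_on_of_fst:
  assumes "f holomorphic_on A" "open A"
  shows "holomorphic2_on (\<lambda>p. f (fst p)) (A \<times> B)"
proof (rule holomorphic2_on_compose[OF holomorphic2_on_fst])
  show "f field_differentiable at (fst p)" if "p \<in> A \<times> B" for p
    using holomorphic_on_imp_differentiable_at[OF assms(1), of "fst p"] assms(2) that by auto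
qed

lemma holomorphic2_on_of_snd:
  assumes "f holomorphic_on B" "open B"
  shows "holomorphic2_on (\<lambda>p. f (snd p)) (A \<times> B)"
proof (rule holomorphic2_on_compose[OF holomorphic2_on_snd])
  show "f field_differentiable at (snd p)" if "p \<in> A \<times> B" for p
    using holomorphic_on_imp_differentiable_at[OF assms(1), of "snd p"] assms(2) that by auto
qed

subsection \<open>A contraction argument for perturbed difference equations\<close>

text \<open>Discrete form of (y^-p)' = -p y^(-p-1), by Bernoulli's inequality. The factor p on the
  left is the source of the gain 1/p.\<close>

lemma inverse_power_telescope_bound:
  fixes y :: real
  assumes "y > 0"
  shows "real p / (y + 1) ^ (p + 1) \<le> 1 / y ^ p - 1 / (y + 1) ^ p"
proof -
  have "1 + real p * (1 / y) \<le> (1 + 1 / y) ^ p"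
    using assms by (intro Bernoulli_inequality) (simp add: field_simps)
  moreover have "1 + 1 / y = (y + 1) / y" using assms by (simp add: field_simps)
  moreover have "real p / (y + 1) \<le> real p * (1 / y)" using assms by (simp add: field_simps)
  ultimately have "1 + real p / (y + 1) \<le> (y + 1) ^ p / y ^ p"
    by (simp add: power_divide)
  then have "(1 + real p / (y + 1)) / (y + 1) ^ p \<le> ((y + 1) ^ p / y ^ p) / (y + 1) ^ p"
    using assms by (intro divide_right_mono) auto
  also have "\<dots> = 1 / y ^ p" using assms by simp
  finally have "(1 + real p / (y + 1)) / (y + 1) ^ p \<le> 1 / y ^ p" .
  moreover have "(1 + real p / (y + 1)) / (y + 1) ^ p = 1 / (y + 1) ^ p + real p / (y + 1) ^ (p + 1)"
    by (simp add: add_divide_distrib)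
  ultimately show ?thesis by linarith
qed

text \<open>The weight k is at most w + k, so it costs one power of the denominator; what remains
  telescopes.\<close>

lemma sums_weighted_inverse_power:
  fixes w :: real
  assumes "w > 0" "p > 0"
  shows "summable (\<lambda>k. real (Suc k) / (w + real (Suc k)) ^ (p + 2))"
    and "(\<Sum>k. real (Suc k) / (w + real (Suc k)) ^ (p + 2)) \<le> 1 / (real p * w ^ p)"
proof -
  define a where "a = (\<lambda>k::nat. 1 / (real p * (w + real k) ^ p))"
  have lim: "a \<longlonglongrightarrow> 0"
  proof (rule Lim_null_comparison)
    show "\<forall>\<^sub>F k in sequentially. norm (a k) \<le> 1 / real k"
    proof (rule eventually_sequentiallyI[of 1])
      fix k :: nat assume k: "1 \<le> k"
      have "real k \<le> w + real k" using assms by simp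
      also have "\<dots> \<le> (w + real k) ^ p" using k assms by (intro self_le_power) auto
      also have "\<dots> \<le> real p * (w + real k) ^ p" using assms by simp
      finally show "norm (a k) \<le> 1 / real k" using k assms by (auto simp: a_def field_simps)
    qed
    show "(\<lambda>k. 1 / real k) \<longlonglongrightarrow> 0" by (rule lim_1_over_n)
  qed
  have tel: "(\<lambda>k. a k - a (Suc k)) sums (a 0 - 0)" by (rule telescope_sums'[OF lim])
  have le: "real (Suc k) / (w + real (Suc k)) ^ (p + 2) \<le> a k - a (Suc k)" for k
  proof -
    define x where "x = w + real (Suc k)"
    have x: "x > 0" "real (Suc k) \<le> x" using assms by (auto simp: x_def)
    have "real (Suc k) / x ^ (p + 2) \<le> x / x ^ (p + 2)" using x by (intro divide_right_mono) auto
    also have "\<dots> = 1 / x ^ (p + 1)" using x by simp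
    also have "\<dots> \<le> (1 / (w + real k) ^ p - 1 / x ^ p) / real p"
      using inverse_power_telescope_bound[of "w + real k" p] assms
      by (simp add: x_def field_simps)
    also have "\<dots> = a k - a (Suc k)" using assms
      by (simp add: a_def x_def diff_divide_distrib mult.commute)
    finally show ?thesis by (simp add: x_def)
  qed
  show s: "summable (\<lambda>k. real (Suc k) / (w + real (Suc k)) ^ (p + 2))"
    using assms le by (intro summable_comparison_test'[OF sums_summable[OF tel], of 0]) auto
  have "(\<Sum>k. real (Suc k) / (w + real (Suc k)) ^ (p + 2)) \<le> (\<Sum>k. a k - a (Suc k))"
    using le s sums_summable[OF tel] by (rule suminf_le)
  also have "\<dots> = 1 / (real p * w ^ p)" using sums_unique[OF tel] by (simp add: a_def)
  finally show "(\<Sum>k. real (Suc k) / (w + real (Suc k)) ^ (p + 2)) \<le> 1 / (real p * w ^ p)" .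
qed

text \<open>
  Summing the error of an approximate solution \<open>\<Phi>\<close> twice along \<open>z + 1, z + 2, \<dots>\<close> inverts
  \<open>\<Delta>\<^sup>2\<close> on decaying functions, and on functions of size \<open>W\<^sup>-\<^sup>p\<close> the inverse gains a factor \<open>1 / p\<close>.
  So an arbitrarily large Lipschitz constant is beaten by a large \<open>p\<close>, that is, by a sufficiently
  precise approximate solution.
\<close>

locale perturbed_difference_equation =
  fixes D M :: "complex set" and W :: "complex \<Rightarrow> real" and \<Phi> :: "complex \<times> complex \<Rightarrow> complex"
    and R :: "complex \<Rightarrow> complex \<Rightarrow> complex" and p :: nat and K A :: real
  assumes open_D: "open D" and open_M: "open M"
    and shift: "z \<in> D \<Longrightarrow> z + 1 \<in> D"
    and W_shift: "W (z + 1) = W z + 1" and W_ge: "z \<in> D \<Longrightarrow> W z \<ge> 1"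
    and p_pos: "p > 0" and K_le: "0 \<le> K" "2 * K \<le> real p" and A_le: "0 \<le> A" "2 * A \<le> real p"
    and \<Phi>_hol: "holomorphic2_on \<Phi> (D \<times> M)"
    and residual: "z - 1 \<in> D \<Longrightarrow> \<mu> \<in> M \<Longrightarrow>
      norm (Delta2 (\<lambda>x. \<Phi> (x, \<mu>)) z - R (\<Phi> (z, \<mu>)) \<mu>) \<le> A / W z ^ (p + 2)"
    and Lipschitz: "z \<in> D \<Longrightarrow> \<mu> \<in> M \<Longrightarrow> norm a \<le> 1 / W z ^ p \<Longrightarrow> norm b \<le> 1 / W z ^ p \<Longrightarrow>
      norm (R (\<Phi> (z, \<mu>) + a) \<mu> - R (\<Phi> (z, \<mu>) + b) \<mu>) \<le> K / W z ^ 2 * norm (a - b)"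
    and R_hol: "holomorphic2_on \<psi> (D \<times> M) \<Longrightarrow>
      (\<And>z \<mu>. z \<in> D \<Longrightarrow> \<mu> \<in> M \<Longrightarrow> norm (\<psi> (z, \<mu>)) \<le> 1 / W z ^ p) \<Longrightarrow>
      holomorphic2_on (\<lambda>q. R (\<Phi> q + \<psi> q) (snd q)) (D \<times> M)"
begin

definition admissible :: "(complex \<times> complex \<Rightarrow> complex) \<Rightarrow> bool" where
  "admissible \<psi> \<longleftrightarrow> holomorphic2_on \<psi> (D \<times> M) \<and> (\<forall>z\<in>D. \<forall>\<mu>\<in>M. norm (\<psi> (z, \<mu>)) \<le> 1 / W z ^ p)"

text \<open>The correction \<open>\<psi>\<close> turns \<open>\<Phi> + \<psi>\<close> into a
  solution exactly when its second difference is this function.\<close>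

definition source :: "(complex \<times> complex \<Rightarrow> complex) \<Rightarrow> complex \<Rightarrow> complex \<Rightarrow> complex" where
  "source \<psi> z \<mu> = R (\<Phi> (z, \<mu>) + \<psi> (z, \<mu>)) \<mu> - Delta2 (\<lambda>x. \<Phi> (x, \<mu>)) z"

text \<open>The weights 1, 2, 3, ... are the fundamental solution of the second difference on a
  half-line. As the sum starts at z + 1, the leftmost point at which \<open>\<Phi>\<close> is
  evaluated is z itself, so the map is defined on all of \<open>D\<close>.\<close>

definition step :: "(complex \<times> complex \<Rightarrow> complex) \<Rightarrow> complex \<times> complex \<Rightarrow> complex" where
  "step \<psi> = (\<lambda>(z, \<mu>). \<Sum>k. of_nat (Suc k) * source \<psi> (z + of_nat (Suc k)) \<mu>)"

lemma shift_nat: "z \<in> D \<Longrightarrow> z + of_nat k \<in> D"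
  using shift by (induction k) (auto simp: add_ac, metis add.assoc add.commute)

lemma W_shift_nat: "W (z + of_nat k) = W z + real k"
  by (induction k) (simp_all add: W_shift flip: add.assoc, metis W_shift add.commute add.left_commute)

lemma W_pos: "z \<in> D \<Longrightarrow> W z > 0"
  using W_ge by fastforce

lemma admissible_bound: "admissible \<psi> \<Longrightarrow> z \<in> D \<Longrightarrow> \<mu> \<in> M \<Longrightarrow> norm (\<psi> (z, \<mu>)) \<le> 1 / W z ^ p"
  by (simp add: admissible_def)

text \<open>The Lipschitz bound compares with \<open>\<psi> = 0\<close> and the residual accounts
  for the rest; each contributes at most p/2, so the ball of radius 1 in the weighted norm is mapped
  into itself.\<close>

lemma norm_source_le:
  assumes "admissible \<psi>" "z - 1 \<in> D" "\<mu> \<in> M"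
  shows "norm (source \<psi> z \<mu>) \<le> real p / W z ^ (p + 2)"
proof -
  have z: "z \<in> D" using shift[OF assms(2)] by simp
  have "norm (R (\<Phi> (z, \<mu>) + \<psi> (z, \<mu>)) \<mu> - R (\<Phi> (z, \<mu>) + 0) \<mu>) \<le> K / W z ^ 2 * norm (\<psi> (z, \<mu>) - 0)"
    using admissible_bound[OF assms(1) z assms(3)] W_pos[OF z] by (intro Lipschitz z assms) auto
  also have "\<dots> \<le> K / W z ^ 2 * (1 / W z ^ p)"
    using admissible_bound[OF assms(1) z assms(3)] K_le W_pos[OF z] by (intro mult_left_mono) auto
  also have "\<dots> = K / W z ^ (p + 2)" by (simp add: power_add power2_eq_square mult.commute)
  finally have 1: "norm (R (\<Phi> (z, \<mu>) + \<psi> (z, \<mu>)) \<mu> - R (\<Phi> (z, \<mu>)) \<mu>) \<le> K / W z ^ (p + 2)" by simp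
  have "source \<psi> z \<mu> = (R (\<Phi> (z, \<mu>) + \<psi> (z, \<mu>)) \<mu> - R (\<Phi> (z, \<mu>)) \<mu>)
      - (Delta2 (\<lambda>x. \<Phi> (x, \<mu>)) z - R (\<Phi> (z, \<mu>)) \<mu>)"
    by (simp add: source_def)
  then have "norm (source \<psi> z \<mu>) \<le> K / W z ^ (p + 2) + A / W z ^ (p + 2)"
    using 1 residual[OF assms(2,3)]
    by (simp only:) (rule order_trans[OF norm_triangle_ineq4 add_mono])
  also have "\<dots> = (K + A) / W z ^ (p + 2)" by (simp add: add_divide_distrib)
  also have "\<dots> \<le> real p / W z ^ (p + 2)" using K_le A_le W_pos[OF z] by (intro divide_right_mono) auto
  finally show ?thesis .
qed

lemma norm_summand_le:
  assumes "admissible \<psi>" "z \<in> D" "\<mu> \<in> M"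
  shows "norm (of_nat (Suc k) * source \<psi> (z + of_nat (Suc k)) \<mu>)
    \<le> real p * (real (Suc k) / (W z + real (Suc k)) ^ (p + 2))"
proof -
  have "norm (source \<psi> (z + of_nat (Suc k)) \<mu>) \<le> real p / W (z + of_nat (Suc k)) ^ (p + 2)"
    using shift_nat[OF assms(2), of k] by (intro norm_source_le assms) (simp add: algebra_simps)
  then have "real (Suc k) * norm (source \<psi> (z + of_nat (Suc k)) \<mu>)
      \<le> real (Suc k) * (real p / (W z + real (Suc k)) ^ (p + 2))"
    unfolding W_shift_nat by (rule mult_left_mono) (rule of_nat_0_le_iff)
  also have "\<dots> = real p * (real (Suc k) / (W z + real (Suc k)) ^ (p + 2))"
    unfolding times_divide_eq_right by (subst mult.commute) (rule refl)
  finally show ?thesis unfolding norm_mult norm_of_nat .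
qed

lemma summable_summand:
  assumes "admissible \<psi>" "z \<in> D" "\<mu> \<in> M"
  shows "summable (\<lambda>k. of_nat (Suc k) * source \<psi> (z + of_nat (Suc k)) \<mu>)"
  by (rule summable_comparison_test'[OF summable_mult[OF sums_weighted_inverse_power(1)[OF W_pos[OF assms(2)] p_pos]]
        norm_summand_le[OF assms]])

lemma norm_step_le:
  assumes "admissible \<psi>" "z \<in> D" "\<mu> \<in> M"
  shows "norm (step \<psi> (z, \<mu>)) \<le> 1 / W z ^ p"
proof -
  note S = sums_weighted_inverse_power[OF W_pos[OF assms(2)] p_pos]
  have "norm (step \<psi> (z, \<mu>)) \<le> (\<Sum>k. real p * (real (Suc k) / (W z + real (Suc k)) ^ (p + 2)))"
    unfolding step_def prod.case
    using norm_summand_le[OF assms] by (intro norm_suminf_le summable_mult S(1))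
  also have "\<dots> = real p * (\<Sum>k. real (Suc k) / (W z + real (Suc k)) ^ (p + 2))"
    by (rule suminf_mult[OF S(1)])
  also have "\<dots> \<le> real p * (1 / (real p * W z ^ p))"
    using S(2) by (intro mult_left_mono) auto
  also have "\<dots> = 1 / W z ^ p" using p_pos by simp
  finally show ?thesis .
qed

text \<open>Summing the Lipschitz bound gives the ratio K/p, which is at most 1/2 by the choice of
  p.\<close>

lemma norm_step_diff_le:
  assumes a: "admissible \<psi>" "admissible \<psi>'" and z: "z \<in> D" and \<mu>: "\<mu> \<in> M" and "0 \<le> d"
    and diff: "\<And>z. z \<in> D \<Longrightarrow> norm (\<psi> (z, \<mu>) - \<psi>' (z, \<mu>)) \<le> d / W z ^ p"
  shows "norm (step \<psi> (z, \<mu>) - step \<psi>' (z, \<mu>)) \<le> (d / 2) / W z ^ p"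
proof -
  note S = sums_weighted_inverse_power[OF W_pos[OF z] p_pos]
  have le: "norm (of_nat (Suc k) * source \<psi> (z + of_nat (Suc k)) \<mu> - of_nat (Suc k) * source \<psi>' (z + of_nat (Suc k)) \<mu>)
      \<le> (K * d) * (real (Suc k) / (W z + real (Suc k)) ^ (p + 2))" for k
  proof -
    define x where "x = z + of_nat (Suc k)"
    have x: "x \<in> D" unfolding x_def using z by (rule shift_nat)
    have Wx: "W x = W z + real (Suc k)" unfolding x_def by (rule W_shift_nat)
    have "norm (source \<psi> x \<mu> - source \<psi>' x \<mu>) = norm (R (\<Phi> (x, \<mu>) + \<psi> (x, \<mu>)) \<mu> - R (\<Phi> (x, \<mu>) + \<psi>' (x, \<mu>)) \<mu>)"
      by (simp add: source_def)
    also have "\<dots> \<le> K / W x ^ 2 * norm (\<psi> (x, \<mu>) - \<psi>' (x, \<mu>))"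
      by (intro Lipschitz x \<mu> admissible_bound a)
    also have "\<dots> \<le> K / W x ^ 2 * (d / W x ^ p)"
      using diff[OF x] K_le by (intro mult_left_mono) auto
    also have "\<dots> = K * d / W x ^ (p + 2)" by (simp add: power_add power2_eq_square mult.commute)
    finally have "real (Suc k) * norm (source \<psi> x \<mu> - source \<psi>' x \<mu>) \<le> real (Suc k) * (K * d / W x ^ (p + 2))"
      by (intro mult_left_mono) auto
    moreover have "norm (of_nat (Suc k) * source \<psi> x \<mu> - of_nat (Suc k) * source \<psi>' x \<mu>)
        = real (Suc k) * norm (source \<psi> x \<mu> - source \<psi>' x \<mu>)"
      by (metis norm_mult norm_of_nat right_diff_distrib)
    moreover have "real (Suc k) * (K * d / W x ^ (p + 2)) = (K * d) * (real (Suc k) / (W z + real (Suc k)) ^ (p + 2))"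
      unfolding Wx times_divide_eq_right by (subst mult.commute) (rule refl)
    ultimately show ?thesis unfolding x_def[symmetric] by linarith
  qed
  have "step \<psi> (z, \<mu>) - step \<psi>' (z, \<mu>) =
      (\<Sum>k. of_nat (Suc k) * source \<psi> (z + of_nat (Suc k)) \<mu> - of_nat (Suc k) * source \<psi>' (z + of_nat (Suc k)) \<mu>)"
    unfolding step_def prod.case by (rule suminf_diff) (use summable_summand a z \<mu> in blast)+
  also have "norm \<dots> \<le> (\<Sum>k. (K * d) * (real (Suc k) / (W z + real (Suc k)) ^ (p + 2)))"
    by (intro norm_suminf_le le summable_mult S(1))
  also have "\<dots> = (K * d) * (\<Sum>k. real (Suc k) / (W z + real (Suc k)) ^ (p + 2))"
    by (rule suminf_mult[OF S(1)])
  also have "\<dots> \<le> (K * d) * (1 / (real p * W z ^ p))"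
    using S(2) K_le \<open>0 \<le> d\<close> by (intro mult_left_mono) auto
  also have "\<dots> = (K / real p * d) / W z ^ p" by simp
  also have "\<dots> \<le> (d / 2) / W z ^ p"
  proof (rule divide_right_mono)
    have "K / real p \<le> 1 / 2" using K_le p_pos by (simp add: field_simps)
    then show "K / real p * d \<le> d / 2" using \<open>0 \<le> d\<close> mult_right_mono[of "K / real p" "1 / 2" d] by simp
  qed (use W_pos[OF z] in auto)
  finally show ?thesis .
qed

lemma holomorphic2_source_shift:
  assumes "admissible \<psi>"
  shows "holomorphic2_on (\<lambda>q. source \<psi> (fst q + of_nat (Suc k)) (snd q)) (D \<times> M)"
proof -
  have tr: "holomorphic2_on (\<lambda>q. F (fst q + of_nat j, snd q)) (D \<times> M)" if "holomorphic2_on F (D \<times> M)" for F j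
    using that shift_nat
    by (intro holomorphic2_on_compose_Pair[OF _ _ that] holomorphic2_on_add holomorphic2_on_fst
        holomorphic2_on_snd holomorphic2_on_const) auto
  have R: "holomorphic2_on (\<lambda>q. R (\<Phi> q + \<psi> q) (snd q)) (D \<times> M)"
    using assms by (intro R_hol) (auto simp: admissible_def)
  have eq: "source \<psi> (fst q + of_nat (Suc k)) (snd q) =
     R (\<Phi> (fst q + of_nat (Suc k), snd q) + \<psi> (fst q + of_nat (Suc k), snd q)) (snd q)
     - (\<Phi> (fst q + of_nat (Suc (Suc k)), snd q) - 2 * \<Phi> (fst q + of_nat (Suc k), snd q) + \<Phi> (fst q + of_nat k, snd q))" for q
    by (simp add: source_def Delta2_def algebra_simps)
  show ?thesis unfolding eq
    using tr[OF R, of "Suc k"]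
    by (intro holomorphic2_on_diff holomorphic2_on_add holomorphic2_on_mult holomorphic2_on_const tr \<Phi>_hol) simp_all
qed

lemma admissible_step:
  assumes "admissible \<psi>"
  shows "admissible (step \<psi>)"
proof -
  define f where "f = (\<lambda>k q. of_nat (Suc k) * source \<psi> (fst q + of_nat (Suc k)) (snd q))"
  have "holomorphic2_on (step \<psi>) (D \<times> M)"
  proof (rule holomorphic2_on_uniform_limit[OF open_D open_M])
    show "holomorphic2_on (\<lambda>q. \<Sum>k<N. f k q) (D \<times> M)" for N
      unfolding f_def
      by (intro holomorphic2_on_sum holomorphic2_on_mult holomorphic2_on_const holomorphic2_source_shift assms)
    have "uniform_limit (D \<times> M) (\<lambda>N q. \<Sum>k<N. f k q) (\<lambda>q. \<Sum>k. f k q) sequentially"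
    proof (rule Weierstrass_m_test)
      \<comment> \<open>Replacing \<open>W z\<close> by its lower bound 1 makes the majorant
        independent of the point.\<close>
      show "summable (\<lambda>k. real p * (real (Suc k) / (1 + real (Suc k)) ^ (p + 2)))"
        by (intro summable_mult sums_weighted_inverse_power p_pos) simp
      fix k q assume "q \<in> D \<times> M"
      then obtain z \<mu> where q: "q = (z, \<mu>)" "z \<in> D" "\<mu> \<in> M" by auto
      have "norm (f k q) \<le> real p * (real (Suc k) / (W z + real (Suc k)) ^ (p + 2))"
        using norm_summand_le[OF assms q(2,3), of k] by (simp add: f_def q(1))
      also have "\<dots> \<le> real p * (real (Suc k) / (1 + real (Suc k)) ^ (p + 2))"
        using W_ge[OF q(2)] by (intro mult_left_mono divide_left_mono power_mono mult_pos_pos zero_less_power) auto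
      finally show "norm (f k q) \<le> real p * (real (Suc k) / (1 + real (Suc k)) ^ (p + 2))" .
    qed
    then show "uniform_limit (D \<times> M) (\<lambda>N q. \<Sum>k<N. f k q) (step \<psi>) sequentially"
      by (simp add: f_def step_def case_prod_unfold)
  qed
  then show ?thesis using norm_step_le[OF assms] by (simp add: admissible_def)
qed

text \<open>After reindexing, the value of the source at z + k + 1 occurs with total weight k - 2 (k
  + 1) + (k + 2) = 0 in the three sums; only the value at z survives, coming from the sum based at z
  - 1.\<close>

lemma Delta2_step:
  assumes "admissible \<psi>" "z - 1 \<in> D" "\<mu> \<in> M"
  shows "Delta2 (\<lambda>x. step \<psi> (x, \<mu>)) z = source \<psi> z \<mu>"
proof -
  define g where "g = (\<lambda>k. source \<psi> (z + of_nat k) \<mu>)"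
  have z: "z \<in> D" "z + 1 \<in> D" using shift[OF assms(2)] shift by auto
  have s1: "summable (\<lambda>k. of_nat (Suc k) * g (Suc (Suc k)))"
    using summable_summand[OF assms(1) z(2) assms(3)] by (simp add: g_def add_ac)
  have s0: "summable (\<lambda>k. of_nat (Suc k) * g (Suc k))"
    using summable_summand[OF assms(1) z(1) assms(3)] by (simp add: g_def)
  have sm: "summable (\<lambda>k. of_nat (Suc k) * g k)"
    using summable_summand[OF assms(1,2,3)] by (simp add: g_def)
  have e1: "step \<psi> (z + 1, \<mu>) = (\<Sum>k. of_nat (Suc k) * g (Suc (Suc k)))"
    by (simp add: step_def g_def add_ac)
  have e0: "step \<psi> (z, \<mu>) = (\<Sum>k. of_nat (Suc k) * g (Suc k))"
    by (simp add: step_def g_def)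
  have em: "step \<psi> (z - 1, \<mu>) = (\<Sum>k. of_nat (Suc k) * g k)"
    by (simp add: step_def g_def)
  have s1': "summable (\<lambda>k. of_nat k * g (Suc k))"
    using s1 summable_Suc_iff[of "\<lambda>k. of_nat k * g (Suc k)"] by simp
  have e1': "(\<Sum>k. of_nat (Suc k) * g (Suc (Suc k))) = (\<Sum>k. of_nat k * g (Suc k))"
    using suminf_split_head[OF s1'] by simp
  have sm': "summable (\<lambda>k. of_nat (Suc (Suc k)) * g (Suc k))"
    using sm summable_Suc_iff[of "\<lambda>k. of_nat (Suc k) * g k"] by simp
  have em': "(\<Sum>k. of_nat (Suc k) * g k) = g 0 + (\<Sum>k. of_nat (Suc (Suc k)) * g (Suc k))"
    using suminf_split_head[OF sm] by simp
  have "(\<Sum>k. of_nat k * g (Suc k)) - 2 * (\<Sum>k. of_nat (Suc k) * g (Suc k)) + (\<Sum>k. of_nat (Suc (Suc k)) * g (Suc k))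
      = (\<Sum>k. of_nat k * g (Suc k) - 2 * (of_nat (Suc k) * g (Suc k)) + of_nat (Suc (Suc k)) * g (Suc k))"
    using s1' s0 sm' by (simp only: suminf_add[symmetric] suminf_diff[symmetric] suminf_mult[symmetric]
        summable_diff summable_add summable_mult)
  also have "\<dots> = 0" by (simp add: algebra_simps)
  finally have zero: "(\<Sum>k. of_nat k * g (Suc k)) - 2 * (\<Sum>k. of_nat (Suc k) * g (Suc k))
      + (\<Sum>k. of_nat (Suc (Suc k)) * g (Suc k)) = 0" .
  have cancel: "a - 2 * b + (c + d) = c" if "a - 2 * b + d = 0" for a b c d :: complex
    using that by (metis add.left_commute add.right_neutral)
  have "g 0 = source \<psi> z \<mu>" by (simp add: g_def)
  then show ?thesis
    unfolding Delta2_def e1 e0 em e1' em' using cancel[OF zero] by simp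
qed

theorem solution_exists:
  "\<exists>\<psi>. holomorphic2_on \<psi> (D \<times> M) \<and> (\<forall>z\<in>D. \<forall>\<mu>\<in>M. norm (\<psi> (z, \<mu>)) \<le> 1 / W z ^ p) \<and>
     (\<forall>z \<mu>. z - 1 \<in> D \<longrightarrow> \<mu> \<in> M \<longrightarrow>
        Delta2 (\<lambda>x. \<Phi> (x, \<mu>) + \<psi> (x, \<mu>)) z = R (\<Phi> (z, \<mu>) + \<psi> (z, \<mu>)) \<mu>)"
proof -
  define \<psi> where "\<psi> = (\<lambda>j. (step ^^ j) (\<lambda>_. 0))"
  have \<psi>_Suc: "\<psi> (Suc j) = step (\<psi> j)" for j by (simp add: \<psi>_def)
  have adm: "admissible (\<psi> j)" for j
  proof (induction j)
    case 0
    show ?case by (auto simp: \<psi>_def admissible_def holomorphic2_on_const W_pos intro!: zero_le_power less_imp_le)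
  next
    case (Suc j) then show ?case by (simp add: \<psi>_Suc admissible_step)
  qed
  have diff: "norm (\<psi> (Suc j) (z, \<mu>) - \<psi> j (z, \<mu>)) \<le> (1 / 2) ^ j / W z ^ p" if "z \<in> D" "\<mu> \<in> M" for j z \<mu>
    using that(1)
  proof (induction j arbitrary: z)
    case 0
    then show ?case using admissible_bound[OF adm[of 1]] that(2) by (simp add: \<psi>_def)
  next
    case (Suc j)
    show ?case
      using norm_step_diff_le[OF adm[of "Suc j"] adm[of j] Suc.prems that(2), of "(1 / 2) ^ j"] Suc.IH
      by (simp add: \<psi>_Suc mult.commute)
  qed
  define \<psi>' where "\<psi>' = (\<lambda>q. \<Sum>j. \<psi> (Suc j) q - \<psi> j q)"
  have tel: "(\<Sum>j<N. \<psi> (Suc j) q - \<psi> j q) = \<psi> N q" for N q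
    using sum_lessThan_telescope[of "\<lambda>j. \<psi> j q" N] by (simp add: \<psi>_def)
  have summ: "summable (\<lambda>j. norm (\<psi> (Suc j) (z, \<mu>) - \<psi> j (z, \<mu>)))" if "z \<in> D" "\<mu> \<in> M" for z \<mu>
  proof (rule summable_comparison_test'[of "\<lambda>j. (1 / 2) ^ j / W z ^ p" 0])
    show "summable (\<lambda>j. (1 / 2) ^ j / W z ^ p)" by (intro summable_divide summable_geometric) simp
    show "norm (norm (\<psi> (Suc j) (z, \<mu>) - \<psi> j (z, \<mu>))) \<le> (1 / 2) ^ j / W z ^ p" for j
      using diff[OF that, of j] by (simp only: real_norm_def abs_norm_cancel)
  qed
  have lim: "uniform_limit (D \<times> M) \<psi> \<psi>' sequentially"
  proof -
    have "uniform_limit (D \<times> M) (\<lambda>N q. \<Sum>j<N. \<psi> (Suc j) q - \<psi> j q) \<psi>' sequentially"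
      unfolding \<psi>'_def
    proof (rule Weierstrass_m_test)
      show "summable (\<lambda>j. (1 / 2 :: real) ^ j)" by (simp add: summable_geometric)
      fix j q assume "q \<in> D \<times> M"
      then obtain z \<mu> where q: "q = (z, \<mu>)" "z \<in> D" "\<mu> \<in> M" by auto
      have "norm (\<psi> (Suc j) q - \<psi> j q) \<le> (1 / 2) ^ j / W z ^ p" using diff q by simp
      also have "\<dots> \<le> (1 / 2) ^ j / 1"
        using W_ge[OF q(2)] by (intro divide_left_mono) (auto simp: one_le_power W_pos[OF q(2)])
      finally show "norm (\<psi> (Suc j) q - \<psi> j q) \<le> (1 / 2) ^ j" by simp
    qed
    then show ?thesis unfolding tel .
  qed
  \<comment> \<open>The uniform limit alone does not suffice: the contraction is measured in the
    weighted norm, so the distance to the limit must be bounded with the weight as well before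
    \<open>step\<close> can be passed to the limit.\<close>
  have tail: "norm (\<psi>' (z, \<mu>) - \<psi> N (z, \<mu>)) \<le> 2 * (1 / 2) ^ N / W z ^ p" if z: "z \<in> D" "\<mu> \<in> M" for N z \<mu>
  proof -
    let ?f = "\<lambda>j. \<psi> (Suc j) (z, \<mu>) - \<psi> j (z, \<mu>)"
    have "\<psi>' (z, \<mu>) - \<psi> N (z, \<mu>) = (\<Sum>j. ?f (j + N))"
      using suminf_minus_initial_segment[OF summable_norm_cancel[OF summ[OF z]], of N] tel[where N = N and q = "(z, \<mu>)"]
      by (simp add: \<psi>'_def)
    also have "norm \<dots> \<le> (\<Sum>j. (1 / 2) ^ (j + N) / W z ^ p)"
    proof (intro norm_suminf_le summable_divide)
      show "norm (?f (j + N)) \<le> (1 / 2) ^ (j + N) / W z ^ p" for j by (rule diff[OF z])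
      show "summable (\<lambda>j. (1 / 2 :: real) ^ (j + N))"
        by (intro summable_ignore_initial_segment) (simp add: summable_geometric)
    qed
    also have "\<dots> = (\<Sum>j. ((1 / 2) ^ N / W z ^ p) * (1 / 2) ^ j)"
      by (simp add: power_add mult.commute)
    also have "\<dots> = ((1 / 2) ^ N / W z ^ p) * (\<Sum>j. (1 / 2) ^ j)"
      by (rule suminf_mult) (simp add: summable_geometric)
    also have "\<dots> = 2 * (1 / 2) ^ N / W z ^ p" by (simp add: suminf_geometric)
    finally show ?thesis .
  qed
  have pw: "(\<lambda>j. \<psi> j (z, \<mu>)) \<longlonglongrightarrow> \<psi>' (z, \<mu>)" if "z \<in> D" "\<mu> \<in> M" for z \<mu>
    by (rule tendsto_uniform_limitI[OF lim]) (use that in simp)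
  have adm': "admissible \<psi>'"
    unfolding admissible_def
  proof (intro conjI ballI)
    show "holomorphic2_on \<psi>' (D \<times> M)"
      by (rule holomorphic2_on_uniform_limit[OF open_D open_M _ lim]) (use adm in \<open>simp add: admissible_def\<close>)
    fix z \<mu> assume z: "z \<in> D" "\<mu> \<in> M"
    show "norm (\<psi>' (z, \<mu>)) \<le> 1 / W z ^ p"
      by (rule LIMSEQ_le_const2[OF tendsto_norm[OF pw[OF z]]]) (use admissible_bound[OF adm z] in blast)
  qed
  have fixpoint: "step \<psi>' (z, \<mu>) = \<psi>' (z, \<mu>)" if z: "z \<in> D" "\<mu> \<in> M" for z \<mu>
  proof -
    have "(\<lambda>N. \<psi> (Suc N) (z, \<mu>)) \<longlonglongrightarrow> step \<psi>' (z, \<mu>)"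
    proof (rule LIM_zero_cancel, rule Lim_null_comparison, intro always_eventually allI)
      fix N
      have "norm (step \<psi>' (z, \<mu>) - step (\<psi> N) (z, \<mu>)) \<le> (2 * (1 / 2) ^ N / 2) / W z ^ p"
        by (intro norm_step_diff_le adm adm' z tail) auto
      then show "norm (\<psi> (Suc N) (z, \<mu>) - step \<psi>' (z, \<mu>)) \<le> (1 / 2) ^ N / W z ^ p"
        by (simp add: \<psi>_Suc norm_minus_commute)
    next
      have "(\<lambda>N. (1 / 2 :: real) ^ N) \<longlonglongrightarrow> 0" by (rule LIMSEQ_realpow_zero) auto
      then show "(\<lambda>N. (1 / 2) ^ N / W z ^ p) \<longlonglongrightarrow> 0"
        using tendsto_divide_zero by blast
    qed
    then show ?thesis using LIMSEQ_Suc[OF pw[OF z]] LIMSEQ_unique by blast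
  qed
  show ?thesis
  proof (intro exI[of _ \<psi>'] conjI allI impI)
    fix z \<mu> assume z: "z - 1 \<in> D" "\<mu> \<in> M"
    have z': "z \<in> D" "z + 1 \<in> D" using shift[OF z(1)] shift by auto
    have "Delta2 (\<lambda>x. \<psi>' (x, \<mu>)) z = Delta2 (\<lambda>x. step \<psi>' (x, \<mu>)) z"
      using fixpoint z z' by (simp add: Delta2_def)
    also have "\<dots> = source \<psi>' z \<mu>" by (rule Delta2_step[OF adm' z])
    finally show "Delta2 (\<lambda>x. \<Phi> (x, \<mu>) + \<psi>' (x, \<mu>)) z = R (\<Phi> (z, \<mu>) + \<psi>' (z, \<mu>)) \<mu>"
      by (simp add: source_def Delta2_def algebra_simps)
  next
    show "holomorphic2_on \<psi>' (D \<times> M)" using adm' unfolding admissible_def by (rule conjunct1)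
    show "\<forall>z\<in>D. \<forall>\<mu>\<in>M. norm (\<psi>' (z, \<mu>)) \<le> 1 / W z ^ p" using adm' unfolding admissible_def by (rule conjunct2)
  qed
qed

end

subsection \<open>Families of formal series with bounded coefficients\<close>

text \<open>The common degree bound is as important as the coefficient bound: it leaves finitely
  many powers of log z, each of which one factor \<open>w\<close> absorbs uniformly in the
  parameter.\<close>

definition bdd_poly :: "'m set \<Rightarrow> ('m \<Rightarrow> complex poly) \<Rightarrow> bool" where
  "bdd_poly M P \<longleftrightarrow> (\<exists>d B. \<forall>\<mu>\<in>M. degree (P \<mu>) \<le> d \<and> (\<forall>i. norm (coeff (P \<mu>) i) \<le> B))"

text \<open>The bounds may grow with the order without restriction, since only finite truncations
  are ever evaluated.\<close>

definition bdd_fps :: "'m set \<Rightarrow> ('m \<Rightarrow> complex poly fps) \<Rightarrow> bool" where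
  "bdd_fps M f \<longleftrightarrow> (\<forall>k. bdd_poly M (\<lambda>\<mu>. fps_nth (f \<mu>) k))"

lemma bdd_polyI:
  assumes "\<And>\<mu>. \<mu> \<in> M \<Longrightarrow> degree (P \<mu>) \<le> d" "\<And>\<mu> i. \<mu> \<in> M \<Longrightarrow> norm (coeff (P \<mu>) i) \<le> B"
  shows "bdd_poly M P"
  using assms unfolding bdd_poly_def by blast

lemma bdd_polyE:
  assumes "bdd_poly M P"
  obtains d B where "B \<ge> 0" "\<And>\<mu>. \<mu> \<in> M \<Longrightarrow> degree (P \<mu>) \<le> d"
    "\<And>\<mu> i. \<mu> \<in> M \<Longrightarrow> norm (coeff (P \<mu>) i) \<le> B"
proof -
  obtain d B where *: "\<And>\<mu>. \<mu> \<in> M \<Longrightarrow> degree (P \<mu>) \<le> d" "\<And>\<mu> i. \<mu> \<in> M \<Longrightarrow> norm (coeff (P \<mu>) i) \<le> B"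
    using assms unfolding bdd_poly_def by blast
  show ?thesis
  proof (rule that[of "max B 0" d])
    show "norm (coeff (P \<mu>) i) \<le> max B 0" if "\<mu> \<in> M" for \<mu> i using *(2)[OF that, of i] by linarith
  qed (use * in auto)
qed

lemma bdd_poly_cong: "(\<And>\<mu>. \<mu> \<in> M \<Longrightarrow> P \<mu> = Q \<mu>) \<Longrightarrow> bdd_poly M P \<longleftrightarrow> bdd_poly M Q"
  by (simp add: bdd_poly_def)

lemma bdd_poly_const: "bdd_poly M (\<lambda>_. p)"
proof (rule bdd_polyI)
  show "degree p \<le> degree p" ..
  show "norm (coeff p i) \<le> (\<Sum>j\<le>degree p. norm (coeff p j))" for i
  proof (cases "i \<le> degree p")
    case True
    then show ?thesis by (intro member_le_sum) auto
  qed (simp add: coeff_eq_0 sum_nonneg)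
qed

lemma bdd_poly_0 [simp]: "bdd_poly M (\<lambda>_. 0)"
  by (rule bdd_poly_const)

lemma bdd_poly_add:
  assumes "bdd_poly M P" "bdd_poly M Q"
  shows "bdd_poly M (\<lambda>\<mu>. P \<mu> + Q \<mu>)"
proof -
  obtain d B where P: "\<And>\<mu>. \<mu> \<in> M \<Longrightarrow> degree (P \<mu>) \<le> d" "\<And>\<mu> i. \<mu> \<in> M \<Longrightarrow> norm (coeff (P \<mu>) i) \<le> B"
    using assms(1) by (rule bdd_polyE) blast
  obtain d' B' where Q: "\<And>\<mu>. \<mu> \<in> M \<Longrightarrow> degree (Q \<mu>) \<le> d'" "\<And>\<mu> i. \<mu> \<in> M \<Longrightarrow> norm (coeff (Q \<mu>) i) \<le> B'"
    using assms(2) by (rule bdd_polyE) blast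
  show ?thesis
  proof (rule bdd_polyI)
    show "degree (P \<mu> + Q \<mu>) \<le> max d d'" if "\<mu> \<in> M" for \<mu>
      using P(1)[OF that] Q(1)[OF that] by (intro degree_add_le) auto
    show "norm (coeff (P \<mu> + Q \<mu>) i) \<le> B + B'" if "\<mu> \<in> M" for \<mu> i
      using norm_triangle_mono[OF P(2)[OF that, of i] Q(2)[OF that, of i]] by simp
  qed
qed

lemma bdd_poly_mult:
  assumes "bdd_poly M P" "bdd_poly M Q"
  shows "bdd_poly M (\<lambda>\<mu>. P \<mu> * Q \<mu>)"
proof -
  obtain d B where P: "B \<ge> 0" "\<And>\<mu>. \<mu> \<in> M \<Longrightarrow> degree (P \<mu>) \<le> d" "\<And>\<mu> i. \<mu> \<in> M \<Longrightarrow> norm (coeff (P \<mu>) i) \<le> B"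
    using assms(1) by (rule bdd_polyE) blast
  obtain d' B' where Q: "B' \<ge> 0" "\<And>\<mu>. \<mu> \<in> M \<Longrightarrow> degree (Q \<mu>) \<le> d'" "\<And>\<mu> i. \<mu> \<in> M \<Longrightarrow> norm (coeff (Q \<mu>) i) \<le> B'"
    using assms(2) by (rule bdd_polyE) blast
  show ?thesis
  proof (rule bdd_polyI)
    fix \<mu> assume \<mu>: "\<mu> \<in> M"
    show deg: "degree (P \<mu> * Q \<mu>) \<le> d + d'"
      using P(2)[OF \<mu>] Q(2)[OF \<mu>] by (meson add_mono degree_mult_le order_trans)
    show "norm (coeff (P \<mu> * Q \<mu>) i) \<le> real (d + d' + 1) * (B * B')" for i
    proof (cases "i \<le> d + d'")
      case True
      have "norm (coeff (P \<mu> * Q \<mu>) i) \<le> (\<Sum>j\<le>i. norm (coeff (P \<mu>) j) * norm (coeff (Q \<mu>) (i - j)))"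
        unfolding coeff_mult norm_mult[symmetric] by (rule norm_sum)
      also have "\<dots> \<le> (\<Sum>j\<le>i. B * B')"
        by (intro sum_mono mult_mono P Q \<mu>) auto
      also have "\<dots> = real (i + 1) * (B * B')" by simp
      also have "\<dots> \<le> real (d + d' + 1) * (B * B')"
        using True P(1) Q(1) by (intro mult_right_mono) auto
      finally show ?thesis .
    next
      case False
      then have "coeff (P \<mu> * Q \<mu>) i = 0" using deg by (intro coeff_eq_0) linarith
      then show ?thesis using P(1) Q(1) by simp
    qed
  qed
qed

lemma bdd_poly_smult:
  assumes "bdd_poly M P"
  shows "bdd_poly M (\<lambda>\<mu>. smult a (P \<mu>))"
  using bdd_poly_mult[OF bdd_poly_const[of M "[:a:]"] assms] by simp

lemma bdd_poly_const_fun: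
  assumes "bounded (g ` M)"
  shows "bdd_poly M (\<lambda>\<mu>. [:g \<mu>:])"
proof -
  obtain B where B: "\<And>\<mu>. \<mu> \<in> M \<Longrightarrow> norm (g \<mu>) \<le> B" using assms by (auto simp: bounded_iff)
  show ?thesis
  proof (rule bdd_polyI)
    show "degree [:g \<mu>:] \<le> 0" for \<mu> by simp
    show "norm (coeff [:g \<mu>:] i) \<le> B" if "\<mu> \<in> M" for \<mu> i
      using B[OF that] order_trans[OF norm_ge_zero B[OF that]] by (cases i) auto
  qed
qed

lemma bdd_poly_minus: "bdd_poly M P \<Longrightarrow> bdd_poly M (\<lambda>\<mu>. - P \<mu>)"
  using bdd_poly_smult[of M P "-1"] by simp

lemma bdd_poly_diff: "bdd_poly M P \<Longrightarrow> bdd_poly M Q \<Longrightarrow> bdd_poly M (\<lambda>\<mu>. P \<mu> - Q \<mu>)"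
  using bdd_poly_add[OF _ bdd_poly_minus] by simp

lemma bdd_poly_sum: "(\<And>i. i \<in> I \<Longrightarrow> bdd_poly M (P i)) \<Longrightarrow> bdd_poly M (\<lambda>\<mu>. \<Sum>i\<in>I. P i \<mu>)"
  by (induction I rule: infinite_finite_induct) (auto intro: bdd_poly_add)

lemma bdd_poly_pderiv:
  assumes "bdd_poly M P"
  shows "bdd_poly M (\<lambda>\<mu>. pderiv (P \<mu>))"
proof -
  obtain d B where P: "B \<ge> 0" "\<And>\<mu>. \<mu> \<in> M \<Longrightarrow> degree (P \<mu>) \<le> d" "\<And>\<mu> i. \<mu> \<in> M \<Longrightarrow> norm (coeff (P \<mu>) i) \<le> B"
    using assms by (rule bdd_polyE) blast
  show ?thesis
  proof (rule bdd_polyI)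
    fix \<mu> assume \<mu>: "\<mu> \<in> M"
    show "degree (pderiv (P \<mu>)) \<le> d" using P(2)[OF \<mu>] by (simp add: degree_pderiv)
    show "norm (coeff (pderiv (P \<mu>)) i) \<le> real (d + 1) * B" for i
    proof (cases "Suc i \<le> d")
      case True
      have "norm (coeff (pderiv (P \<mu>)) i) = real (Suc i) * norm (coeff (P \<mu>) (Suc i))"
        unfolding coeff_pderiv norm_mult norm_of_nat by (rule refl)
      also have "\<dots> \<le> real (d + 1) * B" using True by (intro mult_mono P \<mu>) auto
      finally show ?thesis .
    next
      case False
      then have "coeff (P \<mu>) (Suc i) = 0" using P(2)[OF \<mu>] by (intro coeff_eq_0) linarith
      then show ?thesis using P(1) by (simp add: coeff_pderiv)
    qed
  qed
qed

lemma bdd_fpsD: "bdd_fps M f \<Longrightarrow> bdd_poly M (\<lambda>\<mu>. fps_nth (f \<mu>) k)"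
  by (simp add: bdd_fps_def)

lemma bdd_fps_const: "bdd_fps M (\<lambda>_. f)"
  by (simp add: bdd_fps_def bdd_poly_const)

lemma bdd_fps_add: "bdd_fps M f \<Longrightarrow> bdd_fps M g \<Longrightarrow> bdd_fps M (\<lambda>\<mu>. f \<mu> + g \<mu>)"
  by (simp add: bdd_fps_def bdd_poly_add)

lemma bdd_fps_minus: "bdd_fps M f \<Longrightarrow> bdd_fps M (\<lambda>\<mu>. - f \<mu>)"
  by (simp add: bdd_fps_def bdd_poly_minus)

lemma bdd_fps_mult: "bdd_fps M f \<Longrightarrow> bdd_fps M g \<Longrightarrow> bdd_fps M (\<lambda>\<mu>. f \<mu> * g \<mu>)"
  by (simp add: bdd_fps_def fps_mult_nth bdd_poly_sum bdd_poly_mult)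

lemma bdd_fps_power: "bdd_fps M f \<Longrightarrow> bdd_fps M (\<lambda>\<mu>. f \<mu> ^ k)"
  by (induction k) (auto intro: bdd_fps_const bdd_fps_mult)

lemma bdd_fps_const_fun: "bounded (g ` M) \<Longrightarrow> bdd_fps M (\<lambda>\<mu>. fps_const [:g \<mu>:])"
  unfolding bdd_fps_def
proof
  fix k assume "bounded (g ` M)"
  then show "bdd_poly M (\<lambda>\<mu>. fps_nth (fps_const [:g \<mu>:]) k)"
    by (cases "k = 0") (simp_all add: bdd_poly_const_fun)
qed

lemma bdd_fps_compose:
  assumes "\<And>k. bounded (g k ` M)" "bdd_fps M f"
  shows "bdd_fps M (\<lambda>\<mu>. Abs_fps (\<lambda>k. [:g k \<mu>:]) oo f \<mu>)"
  unfolding bdd_fps_def fps_compose_nth fps_nth_Abs_fps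
  by (intro allI bdd_poly_sum bdd_poly_mult bdd_poly_const_fun bdd_fpsD bdd_fps_power assms)

lemma bdd_fps_formal_zd: "bdd_fps M f \<Longrightarrow> bdd_fps M (\<lambda>\<mu>. formal_zd n (f \<mu>))"
  by (simp add: bdd_fps_def formal_zd_def bdd_poly_diff bdd_poly_pderiv bdd_poly_smult)

lemma bdd_fps_formal_d2: "bdd_fps M f \<Longrightarrow> bdd_fps M (\<lambda>\<mu>. formal_d2 n (f \<mu>))"
  unfolding formal_d2_def diff_conv_add_uminus
  by (intro bdd_fps_mult bdd_fps_const bdd_fps_add bdd_fps_minus bdd_fps_formal_zd)

lemma bdd_fps_formal_d2_funpow: "bdd_fps M f \<Longrightarrow> bdd_fps M (\<lambda>\<mu>. (formal_d2 n ^^ l) (f \<mu>))"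
  by (induction l) (auto intro: bdd_fps_formal_d2)

lemma bdd_fps_formal_Delta2: "bdd_fps M f \<Longrightarrow> bdd_fps M (\<lambda>\<mu>. formal_Delta2 n (f \<mu>))"
  unfolding bdd_fps_def[of M "\<lambda>\<mu>. formal_Delta2 n (f \<mu>)"]
  unfolding formal_Delta2_def fps_nth_Abs_fps
  by (intro allI bdd_poly_sum bdd_poly_smult bdd_fpsD bdd_fps_formal_d2_funpow)


subsection \<open>Uniform asymptotic expansions\<close>

locale inner_asymptotics =
  fixes n :: nat and \<gamma> :: real and M :: "complex set" and lg :: "complex \<Rightarrow> complex" and \<kappa> :: complex
  assumes n_ge: "n \<ge> 2" and \<gamma>_pos: "\<gamma> > 0"
    and lg_eq: "z \<notin> \<real>\<^sub>\<le>\<^sub>0 \<Longrightarrow> lg z = Ln z + \<kappa>" and \<kappa>: "exp (2 * \<kappa>) = 1"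
begin

abbreviation "r \<equiv> rexp n"

lemma r_pos: "r > 0"
  using n_ge by (simp add: rexp_def)

text \<open>In \<open>Dom_s \<gamma> \<rho>\<close> the real part exceeds (\<open>\<rho>\<close> -
  |Im z|)/\<open>\<gamma>\<close>. One copy of |Im z|/\<open>\<gamma>\<close> repairs this loss and
  the second keeps \<open>W\<close> comparable to the norm.\<close>

definition W :: "complex \<Rightarrow> real" where
  "W z = Re z + 2 / \<gamma> * \<bar>Im z\<bar>"

definition w :: "complex \<Rightarrow> complex" where
  "w z = exp (- (of_real r * lg z))"

text \<open>The limit \<open>\<rho>\<close> to infinity as a filter on pairs: Landau estimates along
  it are automatically uniform in the whole domain and in \<open>\<mu>\<close>.\<close>

definition Fl :: "(complex \<times> complex) filter" where
  "Fl = (INF \<rho>\<in>{0<..}. principal (Dom_s \<gamma> \<rho> \<times> M))"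

lemma Re_\<kappa>: "Re \<kappa> = 0"
proof -
  have "norm (exp (2 * \<kappa>)) = 1" using \<kappa> by simp
  then show ?thesis by simp
qed

lemma eventually_Fl: "eventually P Fl \<longleftrightarrow> (\<exists>\<rho>>0. \<forall>z\<in>Dom_s \<gamma> \<rho>. \<forall>\<mu>\<in>M. P (z, \<mu>))"
proof -
  have "eventually P Fl \<longleftrightarrow> (\<exists>\<rho>\<in>{0<..}. eventually P (principal (Dom_s \<gamma> \<rho> \<times> M)))"
    unfolding Fl_def
  proof (rule eventually_INF_base)
    show "\<exists>x\<in>{0<..}. principal (Dom_s \<gamma> x \<times> M) \<le> inf (principal (Dom_s \<gamma> a \<times> M)) (principal (Dom_s \<gamma> b \<times> M))"
      if "a \<in> {0<..}" "b \<in> {0<..}" for a b :: real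
      using that by (intro bexI[of _ "max a b"]) (auto simp: Dom_s_def)
  qed auto
  then show ?thesis by (auto simp: eventually_principal)
qed

lemma Dom_s_antimono: "\<rho> \<le> \<rho>' \<Longrightarrow> Dom_s \<gamma> \<rho>' \<subseteq> Dom_s \<gamma> \<rho>"
  by (auto simp: Dom_s_def)

lemma eventually_Fl_uniform:
  assumes "eventually P Fl"
  shows "\<exists>\<rho>0>0. \<forall>\<rho>\<ge>\<rho>0. \<forall>z\<in>Dom_s \<gamma> \<rho>. \<forall>\<mu>\<in>M. P (z, \<mu>)"
  using assms Dom_s_antimono unfolding eventually_Fl by blast

lemma Dom_s_not_nonpos: "z \<in> Dom_s \<gamma> \<rho> \<Longrightarrow> \<rho> > 0 \<Longrightarrow> z \<notin> \<real>\<^sub>\<le>\<^sub>0"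
proof
  assume z: "z \<in> Dom_s \<gamma> \<rho>" "\<rho> > 0" "z \<in> \<real>\<^sub>\<le>\<^sub>0"
  then have "Im z = 0" "Re z \<le> 0" by (auto simp: complex_nonpos_Reals_iff)
  with z(1,2) \<gamma>_pos mult_nonneg_nonpos[of \<gamma> "Re z"] show False by (simp add: Dom_s_def)
qed

lemma eventually_mem: "\<forall>\<^sub>F x in Fl. fst x \<in> Dom_s \<gamma> \<rho> \<and> fst x \<notin> \<real>\<^sub>\<le>\<^sub>0 \<and> snd x \<in> M"
  unfolding eventually_Fl
  using Dom_s_antimono[of \<rho> "max \<rho> 1"] Dom_s_not_nonpos[of _ "max \<rho> 1"]
  by (intro exI[of _ "max \<rho> 1"]) auto

lemma norm_gt_Dom_s: "z \<in> Dom_s \<gamma> \<rho> \<Longrightarrow> norm z > \<rho> / (1 + \<gamma>)"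
proof -
  assume "z \<in> Dom_s \<gamma> \<rho>"
  then have "\<rho> < \<bar>Im z\<bar> + \<gamma> * Re z" by (simp add: Dom_s_def)
  also have "\<dots> \<le> norm z + \<gamma> * norm z"
    using abs_Im_le_cmod[of z] complex_Re_le_cmod[of z] \<gamma>_pos by (intro add_mono mult_left_mono) auto
  finally show ?thesis using \<gamma>_pos by (simp add: field_simps)
qed

lemma W_gt_Dom_s:
  assumes "z \<in> Dom_s \<gamma> \<rho>"
  shows "W z > (\<rho> + \<bar>Im z\<bar>) / \<gamma>"
proof -
  have "\<gamma> * Re z > \<rho> - \<bar>Im z\<bar>" using assms by (simp add: Dom_s_def)
  then have "Re z > (\<rho> - \<bar>Im z\<bar>) / \<gamma>" using \<gamma>_pos by (simp add: field_simps)
  then have "W z > (\<rho> - \<bar>Im z\<bar>) / \<gamma> + 2 / \<gamma> * \<bar>Im z\<bar>" by (simp add: W_def)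
  also have "(\<rho> - \<bar>Im z\<bar>) / \<gamma> + 2 / \<gamma> * \<bar>Im z\<bar> = (\<rho> + \<bar>Im z\<bar>) / \<gamma>" using \<gamma>_pos by (simp add: field_simps)
  finally show ?thesis .
qed

lemma W_le_norm: "W z \<le> (1 + 2 / \<gamma>) * norm z"
proof -
  have "W z \<le> norm z + 2 / \<gamma> * norm z"
    unfolding W_def using abs_Im_le_cmod[of z] complex_Re_le_cmod[of z] \<gamma>_pos
    by (intro add_mono mult_left_mono) auto
  then show ?thesis by (simp add: algebra_simps)
qed

lemma norm_le_W:
  assumes "z \<in> Dom_s \<gamma> \<rho>" "\<rho> > 0"
  shows "norm z \<le> (1 + \<gamma>) * W z"
proof -
  have W: "W z > \<bar>Im z\<bar> / \<gamma>"
    using W_gt_Dom_s[OF assms(1)] assms(2) \<gamma>_pos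
    by (smt (verit) divide_strict_right_mono)
  then have Im: "\<bar>Im z\<bar> \<le> \<gamma> * W z" using \<gamma>_pos by (simp add: field_simps)
  have "\<bar>Re z\<bar> \<le> W z"
  proof (cases "Re z \<ge> 0")
    case True
    then show ?thesis using \<gamma>_pos by (simp add: W_def)
  next
    case False
    have "- \<gamma> * Re z \<le> \<bar>Im z\<bar>" using assms by (simp add: Dom_s_def)
    then have "- Re z \<le> \<bar>Im z\<bar> / \<gamma>" using \<gamma>_pos by (simp add: field_simps)
    then show ?thesis using False W by linarith
  qed
  then show ?thesis using Im cmod_le[of z] by (simp add: algebra_simps)
qed

lemma norm_w: "z \<notin> \<real>\<^sub>\<le>\<^sub>0 \<Longrightarrow> norm (w z) = norm z powr (- r)"
proof -
  assume z: "z \<notin> \<real>\<^sub>\<le>\<^sub>0"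
  then have "z \<noteq> 0" by auto
  then show ?thesis using lg_eq[OF z] Re_\<kappa> by (simp add: w_def powr_def)
qed

lemma w_nonzero [simp]: "w z \<noteq> 0"
  by (simp add: w_def)

lemma filterlim_norm_Fl: "filterlim (\<lambda>x. norm (fst x)) at_top Fl"
  unfolding filterlim_at_top
proof
  fix C :: real
  show "\<forall>\<^sub>F x in Fl. C \<le> norm (fst x)"
    unfolding eventually_Fl
  proof (intro exI[of _ "max 1 (C * (1 + \<gamma>))"] conjI ballI)
    fix z \<mu> assume "z \<in> Dom_s \<gamma> (max 1 (C * (1 + \<gamma>)))"
    then have "norm z > max 1 (C * (1 + \<gamma>)) / (1 + \<gamma>)" by (rule norm_gt_Dom_s)
    moreover have "max 1 (C * (1 + \<gamma>)) / (1 + \<gamma>) \<ge> C" using \<gamma>_pos by (simp add: field_simps)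
    ultimately show "C \<le> norm (fst (z, \<mu>))" by simp
  qed simp
qed

lemma tendsto_w: "((\<lambda>x. w (fst x)) \<longlongrightarrow> 0) Fl"
proof (rule tendsto_norm_zero_cancel)
  have "((\<lambda>x. norm (fst x) powr (- r)) \<longlongrightarrow> 0) Fl"
    using r_pos by (intro tendsto_neg_powr filterlim_norm_Fl) auto
  moreover have "\<forall>\<^sub>F x in Fl. norm (fst x) powr (- r) = norm (w (fst x))"
    using eventually_mem[of 1] by eventually_elim (simp add: norm_w)
  ultimately show "((\<lambda>x. norm (w (fst x))) \<longlongrightarrow> 0) Fl"
    by (rule Lim_transform_eventually)
qed

abbreviation Ow :: "nat \<Rightarrow> (complex \<times> complex \<Rightarrow> complex) set" where
  "Ow N \<equiv> O[Fl](\<lambda>x. w (fst x) ^ N)"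

lemma w_bigo_1: "(\<lambda>x. w (fst x)) \<in> O[Fl](\<lambda>_. 1)"
proof (rule bigoI[of _ 1])
  have "\<forall>\<^sub>F x in Fl. dist (w (fst x)) 0 < 1" using tendsto_w by (rule tendstoD) simp
  then show "\<forall>\<^sub>F x in Fl. norm (w (fst x)) \<le> 1 * norm (1 :: complex)" by eventually_elim simp
qed

lemma Ow_antimono: "f \<in> Ow a \<Longrightarrow> b \<le> a \<Longrightarrow> f \<in> Ow b"
proof -
  assume f: "f \<in> Ow a" and "b \<le> a"
  have "(\<lambda>x. w (fst x) ^ (a - b) * w (fst x) ^ b) \<in> O[Fl](\<lambda>x. 1 ^ (a - b) * w (fst x) ^ b)"
    by (intro landau_o.big.mult landau_o.big_power w_bigo_1) simp
  then have "(\<lambda>x. w (fst x) ^ a) \<in> Ow b" using \<open>b \<le> a\<close> by (simp flip: power_add)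
  with f show ?thesis by (rule landau_o.big_trans)
qed

lemma lg_power_bigo: "(\<lambda>x. w (fst x) * lg (fst x) ^ d) \<in> O[Fl](\<lambda>_. 1)"
proof -
  \<comment> \<open>With this exponent the d-th power of the logarithm grows at most like |z|^(a d),
    and a d stays below r, the decay rate of \<open>w\<close>.\<close>
  define a where "a = r / real (Suc d)"
  have a: "a > 0" using r_pos by (simp add: a_def)
  define C where "C = 1 / a + pi + norm \<kappa>"
  have C: "C \<ge> 0" using a by (simp add: C_def)
  show ?thesis
  proof (rule bigoI[of _ "C ^ d"])
    have "\<forall>\<^sub>F x in Fl. norm (fst x) \<ge> 1"
      using filterlim_norm_Fl unfolding filterlim_at_top by blast
    then show "\<forall>\<^sub>F x in Fl. norm (w (fst x) * lg (fst x) ^ d) \<le> C ^ d * norm (1 :: complex)"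
      using eventually_mem[of 1]
    proof eventually_elim
      case (elim x)
      define z where "z = fst x"
      have z: "norm z \<ge> 1" "z \<notin> \<real>\<^sub>\<le>\<^sub>0" using elim by (auto simp: z_def)
      then have z0: "z \<noteq> 0" by auto
      have "norm (lg z) \<le> norm (Ln z) + norm \<kappa>" unfolding lg_eq[OF z(2)] by (rule norm_triangle_ineq)
      also have "norm (Ln z) \<le> \<bar>Re (Ln z)\<bar> + \<bar>Im (Ln z)\<bar>" by (rule cmod_le)
      also have "\<bar>Re (Ln z)\<bar> = ln (norm z)" using z z0 by simp
      also have "\<bar>Im (Ln z)\<bar> \<le> pi" using Im_Ln_le_pi[OF z0] mpi_less_Im_Ln[OF z0] by linarith
      also have "ln (norm z) \<le> norm z powr a / a" by (rule ln_powr_bound[OF z(1) a])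
      finally have "norm (lg z) \<le> norm z powr a / a + (pi + norm \<kappa>) * 1" by simp
      also have "\<dots> \<le> norm z powr a / a + (pi + norm \<kappa>) * (norm z powr a)"
        using z(1) a by (intro add_left_mono mult_left_mono ge_one_powr_ge_zero) auto
      also have "\<dots> = C * norm z powr a" by (simp add: C_def algebra_simps)
      finally have lg: "norm (lg z) \<le> C * norm z powr a" .
      have "norm (w z * lg z ^ d) \<le> norm z powr (- r) * (C * norm z powr a) ^ d"
        unfolding norm_mult norm_power norm_w[OF z(2)] using lg by (intro mult_left_mono power_mono) auto
      also have "\<dots> = C ^ d * (norm z powr (- r) * norm z powr (a * real d))"
        using z0 by (simp add: power_mult_distrib powr_powr powr_realpow[symmetric])
      also have "\<dots> = C ^ d * norm z powr (a * real d - r)"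
        by (simp add: powr_add[symmetric])
      also have "\<dots> \<le> C ^ d * 1"
      proof (intro mult_left_mono)
        have "a * real d \<le> r" using r_pos by (simp add: a_def field_simps)
        then have "norm z powr (a * real d - r) \<le> norm z powr 0" using z(1) by (intro powr_mono) auto
        then show "norm z powr (a * real d - r) \<le> 1" using z0 by simp
      qed (use C in simp)
      finally show ?case by (simp add: z_def)
    qed
  qed
qed

lemma bdd_poly_bigo:
  assumes "bdd_poly M P"
  shows "(\<lambda>x. w (fst x) * poly (P (snd x)) (lg (fst x))) \<in> O[Fl](\<lambda>_. 1)"
proof -
  obtain d B where P: "B \<ge> 0" "\<And>\<mu>. \<mu> \<in> M \<Longrightarrow> degree (P \<mu>) \<le> d" "\<And>\<mu> i. \<mu> \<in> M \<Longrightarrow> norm (coeff (P \<mu>) i) \<le> B"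
    using assms by (rule bdd_polyE) blast
  have c: "(\<lambda>x. coeff (P (snd x)) i) \<in> O[Fl](\<lambda>_. 1)" for i
  proof (rule bigoI[of _ B])
    show "\<forall>\<^sub>F x in Fl. norm (coeff (P (snd x)) i) \<le> B * norm (1 :: complex)"
      using eventually_mem[of 1] by eventually_elim (simp add: P)
  qed
  have "(\<lambda>x. \<Sum>i\<le>d. coeff (P (snd x)) i * (w (fst x) * lg (fst x) ^ i)) \<in> O[Fl](\<lambda>_. 1)"
    using landau_o.big.mult[OF c lg_power_bigo] by (intro big_sum_in_bigo) simp
  moreover have "\<forall>\<^sub>F x in Fl. (\<Sum>i\<le>d. coeff (P (snd x)) i * (w (fst x) * lg (fst x) ^ i))
      = w (fst x) * poly (P (snd x)) (lg (fst x))"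
    using eventually_mem[of 1]
  proof eventually_elim
    case (elim x)
    have "(\<Sum>i\<le>d. monom (coeff (P (snd x)) i) i) = P (snd x)"
      using elim by (intro poly_as_sum_of_monoms' P(2)) simp
    from arg_cong[OF this, of "\<lambda>p. poly p (lg (fst x))", symmetric]
    have "poly (P (snd x)) (lg (fst x)) = (\<Sum>i\<le>d. coeff (P (snd x)) i * lg (fst x) ^ i)"
      unfolding poly_sum poly_monom .
    then show ?case by (simp add: sum_distrib_left mult_ac)
  qed
  ultimately show ?thesis by (subst (asm) landau_o.big.in_cong)
qed

text \<open>The strict inequality leaves one factor \<open>w\<close> to absorb the polynomial in the
  logarithm.\<close>

lemma term_Ow:
  assumes "bdd_poly M P" "k > N"
  shows "(\<lambda>x. w (fst x) ^ k * poly (P (snd x)) (lg (fst x))) \<in> Ow N"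
proof -
  have "(\<lambda>x. w (fst x) ^ (k - 1) * (w (fst x) * poly (P (snd x)) (lg (fst x)))) \<in> O[Fl](\<lambda>x. w (fst x) ^ (k - 1) * 1)"
    by (rule landau_o.big.mult[OF landau_o.big_refl bdd_poly_bigo[OF assms(1)]])
  then have "(\<lambda>x. w (fst x) ^ (k - 1) * (w (fst x) * poly (P (snd x)) (lg (fst x)))) \<in> Ow N"
    using assms(2) by (intro Ow_antimono[of _ "k - 1" N]) simp_all
  moreover have "u ^ (k - 1) * (u * y) = u ^ k * y" for u y :: complex
    using assms(2) by (cases k) simp_all
  ultimately show ?thesis by (simp only:)
qed

definition ev :: "nat \<Rightarrow> (complex \<Rightarrow> complex poly fps) \<Rightarrow> complex \<times> complex \<Rightarrow> complex" where
  "ev N f x = (\<Sum>k\<le>N. w (fst x) ^ k * poly (fps_nth (f (snd x)) k) (lg (fst x)))"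

text \<open>Although the first omitted term has order N + 1, the remainder is only required to be
  \<open>O(w^N)\<close>: that term may contain logarithms. Since all N are allowed, no information
  is lost.\<close>

definition asy :: "(complex \<times> complex \<Rightarrow> complex) \<Rightarrow> (complex \<Rightarrow> complex poly fps) \<Rightarrow> bool" where
  "asy h f \<longleftrightarrow> bdd_fps M f \<and> (\<forall>N. (\<lambda>x. h x - ev N f x) \<in> Ow N)"

lemma asyD: "asy h f \<Longrightarrow> (\<lambda>x. h x - ev N f x) \<in> Ow N" "asy h f \<Longrightarrow> bdd_fps M f"
  by (auto simp: asy_def)

lemma ev_add: "ev N (\<lambda>\<mu>. f \<mu> + g \<mu>) x = ev N f x + ev N g x"
  by (simp add: ev_def sum.distrib algebra_simps)

lemma ev_uminus: "ev N (\<lambda>\<mu>. - f \<mu>) x = - ev N f x"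
  by (simp add: ev_def sum_negf)

lemma asy_add:
  assumes "asy h f" "asy h' f'"
  shows "asy (\<lambda>x. h x + h' x) (\<lambda>\<mu>. f \<mu> + f' \<mu>)"
  unfolding asy_def
proof (intro conjI allI)
  fix N
  have "(\<lambda>x. (h x - ev N f x) + (h' x - ev N f' x)) \<in> Ow N"
    using asyD(1)[OF assms(1)] asyD(1)[OF assms(2)] by (rule sum_in_bigo)
  then show "(\<lambda>x. h x + h' x - ev N (\<lambda>\<mu>. f \<mu> + f' \<mu>) x) \<in> Ow N"
    by (simp add: ev_add algebra_simps)
qed (intro bdd_fps_add asyD(2)[OF assms(1)] asyD(2)[OF assms(2)])

lemma asy_uminus:
  assumes "asy h f"
  shows "asy (\<lambda>x. - h x) (\<lambda>\<mu>. - f \<mu>)"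
  unfolding asy_def
proof (intro conjI allI)
  fix N
  have "(\<lambda>x. - (h x - ev N f x)) \<in> Ow N"
    using asyD(1)[OF assms(1)] by (simp only: landau_o.big.uminus_in_iff)
  then show "(\<lambda>x. - h x - ev N (\<lambda>\<mu>. - f \<mu>) x) \<in> Ow N"
    by (simp add: ev_uminus)
qed (intro bdd_fps_minus asyD(2)[OF assms(1)])

lemma asy_diff: "asy h f \<Longrightarrow> asy h' f' \<Longrightarrow> asy (\<lambda>x. h x - h' x) (\<lambda>\<mu>. f \<mu> - f' \<mu>)"
  using asy_add[OF _ asy_uminus] by simp

text \<open>A coefficient of order 0 may contain log z and need not be bounded, hence the weaker
  comparison with 1/w.\<close>

lemma bigo_inverse_w:
  assumes "bdd_poly M P"
  shows "(\<lambda>x. poly (P (snd x)) (lg (fst x))) \<in> O[Fl](\<lambda>x. 1 / w (fst x))"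
proof -
  have "(\<lambda>x. 1 / w (fst x) * (w (fst x) * poly (P (snd x)) (lg (fst x)))) \<in> O[Fl](\<lambda>x. 1 / w (fst x) * 1)"
    by (rule landau_o.big.mult[OF landau_o.big_refl bdd_poly_bigo[OF assms]])
  then show ?thesis by simp
qed

lemma ev_bigo_inverse_w:
  assumes "bdd_fps M f"
  shows "(\<lambda>x. ev N f x) \<in> O[Fl](\<lambda>x. 1 / w (fst x))"
  unfolding ev_def
proof (rule big_sum_in_bigo)
  fix k
  have "(\<lambda>x. w (fst x) ^ k * poly (fps_nth (f (snd x)) k) (lg (fst x))) \<in> O[Fl](\<lambda>x. 1 ^ k * (1 / w (fst x)))"
    by (intro landau_o.big.mult landau_o.big_power w_bigo_1 bigo_inverse_w bdd_fpsD assms)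
  then show "(\<lambda>x. w (fst x) ^ k * poly (fps_nth (f (snd x)) k) (lg (fst x))) \<in> O[Fl](\<lambda>x. 1 / w (fst x))"
    by simp
qed

lemma Ow_mult_inverse_w:
  assumes "f \<in> Ow (Suc N)" "g \<in> O[Fl](\<lambda>x. 1 / w (fst x))"
  shows "(\<lambda>x. f x * g x) \<in> Ow N"
  using landau_o.big.mult[OF assms] by simp

lemma asy_bigo_inverse_w:
  assumes "asy h f"
  shows "h \<in> O[Fl](\<lambda>x. 1 / w (fst x))"
proof -
  have "(\<lambda>_. 1) \<in> O[Fl](\<lambda>x. 1 / w (fst x))"
    using landau_o.big.mult[OF w_bigo_1, of "\<lambda>x. 1 / w (fst x)" "\<lambda>x. 1 / w (fst x)"] by simp
  then have "(\<lambda>x. h x - ev 0 f x) \<in> O[Fl](\<lambda>x. 1 / w (fst x))"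
    using asyD(1)[OF assms, of 0] landau_o.big_trans by fastforce
  from sum_in_bigo(1)[OF this ev_bigo_inverse_w[OF asyD(2)[OF assms], of 0]] show ?thesis by simp
qed

lemma asy_mult:
  assumes "asy h f" "asy h' f'"
  shows "asy (\<lambda>x. h x * h' x) (\<lambda>\<mu>. f \<mu> * f' \<mu>)"
  unfolding asy_def
proof (intro conjI allI)
  fix N
  let ?t = "\<lambda>f k x. w (fst x) ^ k * poly (fps_nth (f (snd x)) k) (lg (fst x))"
  \<comment> \<open>Truncating both factors one order higher compensates for the cofactor, which is
    only \<open>O(1/w)\<close>. The product of the truncations is a sum over the square
    \<open>S\<close>; the triangle \<open>T\<close> is the truncation of the product series and the
    rest has order above N.\<close>
  define S where "S = {..Suc N} \<times> {..Suc N}"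
  define T where "T = {(i, j). i + j \<le> N}"
  have TS: "T \<subseteq> S" and finS: "finite S" by (auto simp: S_def T_def)
  have bf: "bdd_fps M f" "bdd_fps M f'" using asyD(2) assms by auto
  have 1: "(\<lambda>x. (h x - ev (Suc N) f x) * h' x) \<in> Ow N"
    by (rule Ow_mult_inverse_w[OF asyD(1)[OF assms(1)] asy_bigo_inverse_w[OF assms(2)]])
  have 2: "(\<lambda>x. (h' x - ev (Suc N) f' x) * ev (Suc N) f x) \<in> Ow N"
    by (rule Ow_mult_inverse_w[OF asyD(1)[OF assms(2)] ev_bigo_inverse_w[OF bf(1)]])
  have 3: "(\<lambda>x. \<Sum>(i, j)\<in>S - T. ?t f i x * ?t f' j x) \<in> Ow N"
  proof (rule big_sum_in_bigo)
    fix p assume "p \<in> S - T"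
    then obtain i j where p: "p = (i, j)" "i + j > N" by (cases p) (auto simp: T_def not_le)
    have "(\<lambda>x. w (fst x) ^ (i + j) * poly (fps_nth (f (snd x)) i * fps_nth (f' (snd x)) j) (lg (fst x))) \<in> Ow N"
      using p(2) bf by (intro term_Ow bdd_poly_mult bdd_fpsD)
    then show "(\<lambda>x. case p of (i, j) \<Rightarrow> ?t f i x * ?t f' j x) \<in> Ow N"
      by (simp add: p(1) power_add mult_ac)
  qed
  have evN: "ev N (\<lambda>\<mu>. f \<mu> * f' \<mu>) x = (\<Sum>(i, j)\<in>T. ?t f i x * ?t f' j x)" for x
    unfolding T_def sum.triangle_reindex_eq ev_def fps_mult_nth poly_sum poly_mult sum_distrib_left
  proof (rule sum.cong[OF refl], unfold atLeast0AtMost, rule sum.cong[OF refl])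
    fix k i :: nat assume "i \<in> {..k}"
    then have "w (fst x) ^ k = w (fst x) ^ i * w (fst x) ^ (k - i)" by (simp flip: power_add)
    then show "w (fst x) ^ k * (poly (fps_nth (f (snd x)) i) (lg (fst x)) * poly (fps_nth (f' (snd x)) (k - i)) (lg (fst x)))
        = ?t f i x * ?t f' (k - i) x"
      by (simp only: mult_ac)
  qed
  have evS: "ev (Suc N) f x * ev (Suc N) f' x = (\<Sum>(i, j)\<in>S. ?t f i x * ?t f' j x)" for x
    unfolding ev_def S_def sum_product sum.cartesian_product by simp
  have 4: "ev (Suc N) f x * ev (Suc N) f' x - ev N (\<lambda>\<mu>. f \<mu> * f' \<mu>) x = (\<Sum>(i, j)\<in>S - T. ?t f i x * ?t f' j x)" for x
    unfolding evN evS using sum_diff[OF finS TS, of "\<lambda>(i, j). ?t f i x * ?t f' j x"] by simp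
  have 5: "(a - a') * b + (b - b') * a' + (a' * b' - c) = a * b - c" for a a' b b' c :: complex
    by (simp add: algebra_simps)
  have "h x * h' x - ev N (\<lambda>\<mu>. f \<mu> * f' \<mu>) x =
     ((h x - ev (Suc N) f x) * h' x + (h' x - ev (Suc N) f' x) * ev (Suc N) f x) + (\<Sum>(i, j)\<in>S - T. ?t f i x * ?t f' j x)" for x
    unfolding 4[symmetric] 5 by (rule refl)
  then show "(\<lambda>x. h x * h' x - ev N (\<lambda>\<mu>. f \<mu> * f' \<mu>) x) \<in> Ow N"
    using sum_in_bigo(1)[OF sum_in_bigo(1)[OF 1 2] 3] by (simp only:)
qed (intro bdd_fps_mult asyD(2)[OF assms(1)] asyD(2)[OF assms(2)])

text \<open>It is applied to cut-off series: a truncation is expanded to every order by its own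
  finite series, so the formal solution need not converge.\<close>

lemma asy_finite:
  assumes "bdd_fps M f" "\<And>\<mu> k. \<mu> \<in> M \<Longrightarrow> k > K \<Longrightarrow> fps_nth (f \<mu>) k = 0"
  shows "asy (ev K f) f"
  unfolding asy_def
proof (intro conjI allI)
  fix N
  let ?t = "\<lambda>k x. w (fst x) ^ k * poly (fps_nth (f (snd x)) k) (lg (fst x))"
  have "(\<lambda>x. \<Sum>k\<in>{..K} - {..N}. ?t k x) \<in> Ow N"
    using assms(1) by (intro big_sum_in_bigo term_Ow bdd_fpsD) auto
  moreover have "\<forall>\<^sub>F x in Fl. (\<Sum>k\<in>{..K} - {..N}. ?t k x) = ev K f x - ev N f x"
    using eventually_mem[of 1]
  proof eventually_elim
    case (elim x)
    show ?case
    proof (cases "N \<le> K")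
      case True
      then show ?thesis unfolding ev_def by (intro sum_diff) auto
    next
      case False
      have "(\<Sum>k\<le>N. ?t k x) = (\<Sum>k\<le>K. ?t k x)"
        using False assms(2) elim by (intro sum.mono_neutral_right) auto
      moreover have "{..K} - {..N} = {}" using False by auto
      ultimately show ?thesis unfolding ev_def by (simp only: sum.empty diff_self)
    qed
  qed
  ultimately show "(\<lambda>x. ev K f x - ev N f x) \<in> Ow N" by (subst (asm) landau_o.big.in_cong)
qed (rule assms)

lemma asy_const_fun:
  assumes "bounded (g ` M)"
  shows "asy (\<lambda>x. g (snd x)) (\<lambda>\<mu>. fps_const [:g \<mu>:])"
  using asy_finite[of "\<lambda>\<mu>. fps_const [:g \<mu>:]" 0] bdd_fps_const_fun[OF assms] by (simp add: ev_def[abs_def])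

lemma asy_w: "asy (\<lambda>x. w (fst x)) (\<lambda>_. fps_X)"
  using asy_finite[OF bdd_fps_const, of 1 fps_X] by (simp add: ev_def[abs_def] fps_X_def)

lemma asy_power:
  assumes "asy h f"
  shows "asy (\<lambda>x. h x ^ k) (\<lambda>\<mu>. f \<mu> ^ k)"
proof (induction k)
  case 0
  show ?case using asy_const_fun[of "\<lambda>_. 1"] by (simp add: image_constant_conv one_pCons[symmetric])
next
  case (Suc k)
  then show ?case using asy_mult[OF assms] by simp
qed

lemma asy_sum:
  assumes "\<And>i. i \<in> I \<Longrightarrow> asy (h i) (f i)"
  shows "asy (\<lambda>x. \<Sum>i\<in>I. h i x) (\<lambda>\<mu>. \<Sum>i\<in>I. f i \<mu>)"
  using assms
proof (induction I rule: infinite_finite_induct)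
  case (infinite A)
  show ?case using asy_const_fun[of "\<lambda>_. 0"] infinite(1) by (simp add: image_constant_conv)
next
  case empty
  show ?case using asy_const_fun[of "\<lambda>_. 0"] by (simp add: image_constant_conv)
qed (auto intro: asy_add)

lemma asy_imp_Ow:
  assumes "asy h f" "\<And>\<mu> k. \<mu> \<in> M \<Longrightarrow> k \<le> N \<Longrightarrow> fps_nth (f \<mu>) k = 0"
  shows "h \<in> Ow N"
proof -
  have "\<forall>\<^sub>F x in Fl. h x - ev N f x = h x"
    using eventually_mem[of 1] by eventually_elim (simp add: ev_def assms(2))
  then show ?thesis by (rule iffD1[OF landau_o.big.in_cong asyD(1)[OF assms(1)]])
qed

end

section \<open>Composition of expansions with convergent power series\<close>

lemma power_series_tail_bound:
  fixes a :: "nat \<Rightarrow> complex"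
  assumes "(\<lambda>k. a k * y ^ k) sums S" "\<delta> > 0" "\<And>k. norm (a k) \<le> B / \<delta> ^ k" "norm y \<le> \<delta> / 2"
  shows "norm (S - (\<Sum>k<m. a k * y ^ k)) \<le> 2 * B * (norm y / \<delta>) ^ m"
proof -
  define q where "q = norm y / \<delta>"
  have q: "0 \<le> q" "q \<le> 1 / 2" using assms(2,4) by (auto simp: q_def field_simps)
  have B: "B \<ge> 0" using order_trans[OF norm_ge_zero assms(3)[of 0]] by simp
  have le: "norm (a (k + m) * y ^ (k + m)) \<le> B * q ^ m * (1 / 2) ^ k" for k
  proof -
    have "norm (a (k + m) * y ^ (k + m)) \<le> B / \<delta> ^ (k + m) * norm y ^ (k + m)"
      unfolding norm_mult norm_power using assms(3) by (intro mult_right_mono) auto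
    also have "\<dots> = B * q ^ m * q ^ k" by (simp add: q_def power_divide power_add mult_ac)
    also have "\<dots> \<le> B * q ^ m * (1 / 2) ^ k" using q B by (intro mult_left_mono power_mono) auto
    finally show ?thesis .
  qed
  have "(\<lambda>k. a (k + m) * y ^ (k + m)) sums (S - (\<Sum>k<m. a k * y ^ k))"
    using sums_split_initial_segment[OF assms(1), of m] by simp
  then have "S - (\<Sum>k<m. a k * y ^ k) = (\<Sum>k. a (k + m) * y ^ (k + m))" by (rule sums_unique)
  also have "norm \<dots> \<le> (\<Sum>k. B * q ^ m * (1 / 2) ^ k)"
    by (intro norm_suminf_le le summable_mult summable_geometric) simp
  also have "\<dots> = B * q ^ m * (\<Sum>k. (1 / 2) ^ k)"
    by (rule suminf_mult) (simp add: summable_geometric)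
  also have "\<dots> = 2 * B * q ^ m" by (simp add: suminf_geometric)
  finally show ?thesis by (simp add: q_def)
qed

text \<open>Powers of \<open>f\<close> beyond the j-th start above order j, so finitely many terms
  determine the coefficient.\<close>

lemma fps_compose_nth_sum:
  fixes a f :: "complex poly fps"
  assumes "fps_nth f 0 = 0" "j < m"
  shows "fps_nth (a oo f) j = fps_nth (\<Sum>k<m. fps_const (fps_nth a k) * f ^ k) j"
proof -
  have "fps_nth (\<Sum>k<m. fps_const (fps_nth a k) * f ^ k) j = (\<Sum>k<m. fps_nth a k * fps_nth (f ^ k) j)"
    by (simp add: fps_sum_nth)
  also have "\<dots> = (\<Sum>k=0..j. fps_nth a k * fps_nth (f ^ k) j)"
  proof (rule sum.mono_neutral_right)
    show "\<forall>i\<in>{..<m} - {0..j}. fps_nth a i * fps_nth (f ^ i) j = 0"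
      using startsby_zero_power_prefix[OF assms(1)] by auto
  qed (use assms(2) in auto)
  finally show ?thesis by (simp add: fps_compose_nth)
qed

lemma even_power_bound_rescale: "x \<le> 2 * B * (y / d) ^ (2 * N) \<Longrightarrow> x \<le> 2 * B / d ^ (2 * N) * (y ^ 2) ^ N"
  for x y B d :: real
  by (simp add: power_divide power_mult)

context inner_asymptotics
begin

text \<open>A vanishing constant coefficient by itself only yields \<open>O(1)\<close>, because one
  power is lost to logarithms. Squaring first makes orders 0 and 1 vanish and gives |h|^2 =
  \<open>O(w)\<close>; in particular h tends to 0.\<close>

lemma asy_power2_Ow:
  assumes "asy h f" "\<And>\<mu>. \<mu> \<in> M \<Longrightarrow> fps_nth (f \<mu>) 0 = 0"
  shows "(\<lambda>x. h x ^ 2) \<in> Ow 1"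
proof (rule asy_imp_Ow[OF asy_power[OF assms(1)]])
  show "fps_nth (f \<mu> ^ 2) k = 0" if "\<mu> \<in> M" "k \<le> 1" for \<mu> k
    using startsby_zero_power_prefix[OF assms(2)[OF that(1)], of 2] that(2) by simp
qed

lemma eventually_norm_le:
  assumes "(\<lambda>x. h x ^ 2) \<in> Ow 1" "e > 0"
  shows "\<forall>\<^sub>F x in Fl. norm (h x) \<le> e"
proof -
  obtain C where C: "C > 0" "\<forall>\<^sub>F x in Fl. norm (h x ^ 2) \<le> C * norm (w (fst x) ^ 1)"
    using landau_o.bigE[OF assms(1)] by blast
  have "\<forall>\<^sub>F x in Fl. dist (w (fst x)) 0 < e\<^sup>2 / C"
    using tendsto_w by (rule tendstoD) (use C assms in simp)
  with C(2) show ?thesis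
  proof eventually_elim
    case (elim x)
    have "C * norm (w (fst x)) \<le> e\<^sup>2" using elim(2) C(1) by (simp add: field_simps)
    with elim(1) have "norm (h x) ^ 2 \<le> e ^ 2" by (simp add: norm_power)
    then show ?case by (rule power2_le_imp_le) (use assms(2) in simp)
  qed
qed

text \<open>The partial sums are polynomials in \<open>h\<close> and are covered by the algebra of
  expansions. The bound on \<open>g\<close> has the form of Cauchy's inequality and makes the tail
  uniformly small in the parameter.\<close>

lemma asy_compose:
  assumes h: "asy h f" and f0: "\<And>\<mu>. \<mu> \<in> M \<Longrightarrow> fps_nth (f \<mu>) 0 = 0"
    and \<delta>: "\<delta> > 0" and g: "\<And>k \<mu>. \<mu> \<in> M \<Longrightarrow> norm (g k \<mu>) \<le> B / \<delta> ^ k"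
    and sums: "\<forall>\<^sub>F x in Fl. (\<lambda>k. g k (snd x) * h x ^ k) sums H x"
  shows "asy H (\<lambda>\<mu>. Abs_fps (\<lambda>k. [:g k \<mu>:]) oo f \<mu>)"
  unfolding asy_def
proof (intro conjI allI)
  have bg: "bounded (g k ` M)" for k
    using g unfolding bounded_iff by blast
  show "bdd_fps M (\<lambda>\<mu>. Abs_fps (\<lambda>k. [:g k \<mu>:]) oo f \<mu>)"
    by (rule bdd_fps_compose[OF bg asyD(2)[OF h]])
  have h2: "(\<lambda>x. h x ^ 2) \<in> Ow 1" by (rule asy_power2_Ow[OF h f0])
  fix N :: nat
  \<comment> \<open>Each power of \<open>h\<close> is worth only half a power of \<open>w\<close>,
    so about 2N terms are needed for a tail of size \<open>w^N\<close>; the extra one makes m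
    positive and exceeds every order up to N.\<close>
  define m where "m = 2 * N + 1"
  define S where "S = (\<lambda>x. \<Sum>k<m. g k (snd x) * h x ^ k)"
  have "(\<lambda>x. H x - S x) \<in> O[Fl](\<lambda>x. (h x ^ 2) ^ N)"
  proof (rule bigoI[of _ "2 * B / \<delta> ^ (2 * N)"])
    have "\<forall>\<^sub>F x in Fl. norm (h x) \<le> \<delta> / 2" by (rule eventually_norm_le[OF h2]) (use \<delta> in simp)
    then show "\<forall>\<^sub>F x in Fl. norm (H x - S x) \<le> 2 * B / \<delta> ^ (2 * N) * norm ((h x ^ 2) ^ N)"
      using sums eventually_mem[of 1]
    proof eventually_elim
      case (elim x)
      have g': "norm (g k (snd x)) \<le> B / \<delta> ^ k" for k using g elim(3) by blast
      have B: "B \<ge> 0" using order_trans[OF norm_ge_zero g'[of 0]] by simp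
      have q: "norm (h x) / \<delta> \<le> 1" "0 \<le> norm (h x) / \<delta>" using elim(1) \<delta> by (simp_all add: field_simps)
      have "norm (H x - S x) \<le> 2 * B * (norm (h x) / \<delta>) ^ m"
        unfolding S_def by (rule power_series_tail_bound[OF elim(2) \<delta> g' elim(1)])
      also have "\<dots> \<le> 2 * B * (norm (h x) / \<delta>) ^ (2 * N)"
        using q B unfolding m_def by (intro mult_left_mono power_decreasing) auto
      finally show ?case unfolding norm_power by (rule even_power_bound_rescale)
    qed
  qed
  also have "(\<lambda>x. (h x ^ 2) ^ N) \<in> O[Fl](\<lambda>x. (w (fst x) ^ 1) ^ N)"
    by (rule landau_o.big_power[OF h2])
  finally have 1: "(\<lambda>x. H x - S x) \<in> Ow N" by simp
  define F where "F = (\<lambda>\<mu>. \<Sum>k<m. fps_const [:g k \<mu>:] * f \<mu> ^ k)"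
  have "asy S F"
    unfolding S_def F_def by (intro asy_sum asy_mult asy_const_fun asy_power bg h)
  then have 2: "(\<lambda>x. S x - ev N F x) \<in> Ow N" by (rule asyD)
  have "(\<lambda>x. (H x - S x) + (S x - ev N F x)) \<in> Ow N" by (rule sum_in_bigo(1)[OF 1 2])
  moreover have "\<forall>\<^sub>F x in Fl. (H x - S x) + (S x - ev N F x) = H x - ev N (\<lambda>\<mu>. Abs_fps (\<lambda>k. [:g k \<mu>:]) oo f \<mu>) x"
    using eventually_mem[of 1]
  proof eventually_elim
    case (elim x)
    have "fps_nth (F (snd x)) j = fps_nth (Abs_fps (\<lambda>k. [:g k (snd x):]) oo f (snd x)) j" if "j \<le> N" for j
      using fps_compose_nth_sum[OF f0, of "snd x" j m "Abs_fps (\<lambda>k. [:g k (snd x):])"] that elim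
      by (simp add: F_def m_def)
    then have "ev N F x = ev N (\<lambda>\<mu>. Abs_fps (\<lambda>k. [:g k \<mu>:]) oo f \<mu>) x" by (simp add: ev_def)
    then show ?case by simp
  qed
  ultimately show "(\<lambda>x. H x - ev N (\<lambda>\<mu>. Abs_fps (\<lambda>k. [:g k \<mu>:]) oo f \<mu>) x) \<in> Ow N"
    by (rule iffD1[OF landau_o.big.in_cong, rotated])
qed

end

section \<open>Taylor expansion of the second difference and orders of the iterated formal
  derivative\<close>

lemma sum_even_part:
  fixes b :: "nat \<Rightarrow> complex"
  shows "(\<Sum>i\<le>2 * q + 1. b i) + (\<Sum>i\<le>2 * q + 1. b i * (- 1) ^ i) = (\<Sum>l\<le>q. 2 * b (2 * l))"
proof (induction q)
  case 0
  show ?case by simp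
next
  case (Suc q)
  have "{..2 * Suc q + 1} = insert (2 * q + 3) (insert (2 * q + 2) {..2 * q + 1})" by auto
  then have *: "(\<Sum>i\<le>2 * Suc q + 1. c i) = c (2 * q + 3) + (c (2 * q + 2) + (\<Sum>i\<le>2 * q + 1. c i))" for c :: "nat \<Rightarrow> complex"
    by simp
  have "(\<Sum>l\<le>Suc q. 2 * b (2 * l)) = (\<Sum>l\<le>q. 2 * b (2 * l)) + 2 * b (2 * q + 2)" by simp
  also have "(\<Sum>l\<le>q. 2 * b (2 * l)) = (\<Sum>i\<le>2 * q + 1. b i) + (\<Sum>i\<le>2 * q + 1. b i * (- 1) ^ i)"
    by (rule Suc.IH[symmetric])
  finally show ?case unfolding *[of b] *[of "\<lambda>i. b i * (- 1) ^ i"] by (simp add: power_add)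
qed

text \<open>Taylor's formula of order 2q + 1 at both ends of the segment: odd derivatives cancel,
  even ones double, and each end contributes a remainder of at most \<open>B\<close> divided by a
  factorial.\<close>

lemma second_difference_Taylor:
  fixes h :: "complex \<Rightarrow> complex"
  assumes "h holomorphic_on S" "open S" "closed_segment (z - 1) (z + 1) \<subseteq> S"
    and "\<And>x. x \<in> closed_segment (z - 1) (z + 1) \<Longrightarrow> norm ((deriv ^^ (2 * q + 2)) h x) \<le> B"
  shows "norm (Delta2 h z - (\<Sum>l=1..q. 2 / fact (2 * l) * (deriv ^^ (2 * l)) h z)) \<le> 2 * B"
proof -
  define T where "T = closed_segment (z - 1) (z + 1)"
  have zT: "z \<in> T"
    using midpoint_in_closed_segment[of "z - 1" "z + 1"] by (simp add: T_def midpoint_def scaleR_conv_of_real)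
  have endT: "z + 1 \<in> T" "z - 1 \<in> T" by (auto simp: T_def)
  have B: "B \<ge> 0" using assms(4)[of z] zT norm_ge_zero order_trans unfolding T_def by blast
  have der: "((deriv ^^ i) h has_field_derivative (deriv ^^ Suc i) h x) (at x within T)" if "x \<in> T" for i x
  proof (rule has_field_derivative_at_within)
    show "((deriv ^^ i) h has_field_derivative (deriv ^^ Suc i) h x) (at x)"
      using assms(3) that unfolding T_def
      by (intro has_field_derivative_higher_deriv[OF assms(1,2)]) blast
  qed
  have conv: "convex T" unfolding T_def by (rule convex_closed_segment)
  have bd: "norm ((deriv ^^ Suc (2 * q + 1)) h x) \<le> B" if "x \<in> T" for x
    using assms(4)[of x] that by (simp add: T_def)
  have T1: "norm ((deriv ^^ 0) h (z + 1) - (\<Sum>i\<le>2 * q + 1. (deriv ^^ i) h z * ((z + 1) - z) ^ i / fact i))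
     \<le> B * norm ((z + 1) - z) ^ Suc (2 * q + 1) / fact (2 * q + 1)"
    by (rule complex_Taylor[where f = "\<lambda>i. (deriv ^^ i) h", OF conv der bd zT endT(1)])
  have T2: "norm ((deriv ^^ 0) h (z - 1) - (\<Sum>i\<le>2 * q + 1. (deriv ^^ i) h z * ((z - 1) - z) ^ i / fact i))
     \<le> B * norm ((z - 1) - z) ^ Suc (2 * q + 1) / fact (2 * q + 1)"
    by (rule complex_Taylor[where f = "\<lambda>i. (deriv ^^ i) h", OF conv der bd zT endT(2)])
  define b where "b = (\<lambda>i. (deriv ^^ i) h z / fact i)"
  have e1: "(\<Sum>i\<le>2 * q + 1. (deriv ^^ i) h z * ((z + 1) - z) ^ i / fact i) = (\<Sum>i\<le>2 * q + 1. b i)"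
    by (simp add: b_def)
  have e2: "(\<Sum>i\<le>2 * q + 1. (deriv ^^ i) h z * ((z - 1) - z) ^ i / fact i) = (\<Sum>i\<le>2 * q + 1. b i * (- 1) ^ i)"
    by (intro sum.cong) (simp_all add: b_def)
  have le: "B / fact (2 * q + 1) \<le> B" using divide_left_mono[OF fact_ge_1 B, of "2 * q + 1"] by simp
  have n1: "norm (h (z + 1) - (\<Sum>i\<le>2 * q + 1. b i)) \<le> B"
    using T1 le unfolding e1 by simp
  have n2: "norm (h (z - 1) - (\<Sum>i\<le>2 * q + 1. b i * (- 1) ^ i)) \<le> B"
    using T2 le unfolding e2 by simp
  have "(\<Sum>l\<le>q. 2 * b (2 * l)) = 2 * h z + (\<Sum>l=1..q. 2 * b (2 * l))"
    by (simp add: b_def atMost_atLeast0 sum.atLeast_Suc_atMost)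
  then have "(\<Sum>l=1..q. 2 / fact (2 * l) * (deriv ^^ (2 * l)) h z) =
      (\<Sum>i\<le>2 * q + 1. b i) + (\<Sum>i\<le>2 * q + 1. b i * (- 1) ^ i) - 2 * h z"
    unfolding sum_even_part by (simp add: b_def)
  then have "Delta2 h z - (\<Sum>l=1..q. 2 / fact (2 * l) * (deriv ^^ (2 * l)) h z) =
     (h (z + 1) - (\<Sum>i\<le>2 * q + 1. b i)) + (h (z - 1) - (\<Sum>i\<le>2 * q + 1. b i * (- 1) ^ i))"
    by (simp add: Delta2_def algebra_simps)
  then show ?thesis using norm_triangle_mono[OF n1 n2] by simp
qed

lemma formal_d2_nth:
  "fps_nth (formal_d2 n f) k =
     (if k < n - 1 then 0 else fps_nth (formal_zd n (formal_zd n f)) (k - (n - 1)) - fps_nth (formal_zd n f) (k - (n - 1)))"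
  by (simp add: formal_d2_def fps_X_power_mult_nth)

lemma formal_d2_funpow_support:
  assumes "\<And>k. k > K \<Longrightarrow> fps_nth f k = 0" "k > K + l * (n - 1)"
  shows "fps_nth ((formal_d2 n ^^ l) f) k = 0"
  using assms(2)
proof (induction l arbitrary: k)
  case 0
  then show ?case using assms(1) by simp
next
  case (Suc l)
  have "fps_nth ((formal_d2 n ^^ l) f) (k - (n - 1)) = 0" using Suc.prems by (intro Suc.IH) simp
  then show ?case by (simp add: formal_d2_nth formal_zd_def)
qed

text \<open>Every application raises the order by at least one. Hence the sum over l in
  \<open>formal_Delta2\<close> may be extended beyond l = k at will.\<close>

lemma formal_d2_funpow_order:
  assumes "n \<ge> 2" "k < l"
  shows "fps_nth ((formal_d2 n ^^ l) f) k = 0"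
  using assms(2)
proof (induction l arbitrary: k)
  case (Suc l)
  show ?case
  proof (cases "k < n - 1")
    case False
    then have "fps_nth ((formal_d2 n ^^ l) f) (k - (n - 1)) = 0" using Suc.prems assms(1) by (intro Suc.IH) auto
    then show ?thesis by (simp add: formal_d2_nth formal_zd_def)
  qed (simp add: formal_d2_nth)
qed simp

section \<open>Derivatives and second differences of truncated expansions\<close>

context inner_asymptotics
begin

lemma open_slit: "open (- \<real>\<^sub>\<le>\<^sub>0 :: complex set)"
  by (simp add: open_Compl)

lemma lg_has_derivative:
  assumes "z \<notin> \<real>\<^sub>\<le>\<^sub>0"
  shows "(lg has_field_derivative 1 / z) (at z)"
proof (rule has_field_derivative_transform_within_open[where S = "- \<real>\<^sub>\<le>\<^sub>0"])
  show "((\<lambda>z. Ln z + \<kappa>) has_field_derivative 1 / z) (at z)"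
    using assms by (auto intro!: derivative_eq_intros simp: field_simps)
  show "open (- \<real>\<^sub>\<le>\<^sub>0 :: complex set)" by (rule open_slit)
qed (use assms lg_eq in auto)

lemma w_has_derivative:
  assumes "z \<notin> \<real>\<^sub>\<le>\<^sub>0"
  shows "(w has_field_derivative - (of_real r * w z / z)) (at z)"
  unfolding w_def[abs_def]
  by (rule derivative_eq_intros lg_has_derivative[OF assms] refl | simp)+

lemma r_mult: "real (n - 1) * r = 2"
  using n_ge by (simp add: rexp_def of_nat_diff del: distrib_right_numeral left_diff_distrib_numeral)

text \<open>As (n - 1) r = 2, the power is exp(-2 lg z), and the branch constant drops out by exp(2
  \<open>\<kappa>\<close>) = 1. This converts the factor z^-2 produced by two derivatives into the
  shift by n - 1 orders in \<open>formal_d2\<close>.\<close>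

lemma w_power_eq:
  assumes "z \<notin> \<real>\<^sub>\<le>\<^sub>0"
  shows "w z ^ (n - 1) = 1 / z ^ 2"
proof -
  have z: "z \<noteq> 0" using assms by auto
  have "w z ^ (n - 1) = exp (of_nat (n - 1) * - (of_real r * lg z))"
    unfolding w_def by (rule exp_of_nat_mult[symmetric])
  also have "of_nat (n - 1) * - (of_real r * lg z) = - (of_real (real (n - 1) * r) * lg z)"
    by simp
  also have "exp \<dots> = 1 / exp (2 * lg z)" unfolding r_mult by (simp add: exp_minus divide_inverse)
  also have "2 * lg z = 2 * Ln z + 2 * \<kappa>" using lg_eq[OF assms] by simp
  also have "exp \<dots> = exp (Ln z) ^ 2" unfolding exp_add \<kappa> by (simp add: exp_double)
  finally show ?thesis using z by simp
qed

lemma monomial_has_derivative: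
  assumes "z \<notin> \<real>\<^sub>\<le>\<^sub>0"
  shows "((\<lambda>z. w z ^ k * poly P (lg z)) has_field_derivative
    w z ^ k * poly (pderiv P - smult (of_real (real k * r)) P) (lg z) / z) (at z)"
proof -
  have 1: "((\<lambda>z. w z ^ k) has_field_derivative - (of_real (real k * r) * w z ^ k / z)) (at z)"
    using DERIV_power[OF w_has_derivative[OF assms], of k] by (cases k) (simp_all add: field_simps)
  have 2: "((\<lambda>z. poly P (lg z)) has_field_derivative poly (pderiv P) (lg z) * (1 / z)) (at z)"
    by (rule DERIV_chain2[OF poly_DERIV lg_has_derivative[OF assms]])
  show ?thesis
    using DERIV_mult[OF 1 2] by (simp add: field_simps diff_divide_distrib)
qed

text \<open>The operator z d/dz acts order by order, so a truncation is differentiated exactly,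
  without remainder.\<close>

lemma ev_has_derivative:
  assumes "z \<notin> \<real>\<^sub>\<le>\<^sub>0"
  shows "((\<lambda>z. ev K f (z, \<mu>)) has_field_derivative ev K (\<lambda>\<mu>. formal_zd n (f \<mu>)) (z, \<mu>) / z) (at z)"
proof -
  have "((\<lambda>z. \<Sum>k\<le>K. w z ^ k * poly (fps_nth (f \<mu>) k) (lg z)) has_field_derivative
     (\<Sum>k\<le>K. w z ^ k * poly (pderiv (fps_nth (f \<mu>) k) - smult (of_real (real k * r)) (fps_nth (f \<mu>) k)) (lg z) / z)) (at z)"
    by (intro DERIV_sum monomial_has_derivative assms)
  then show ?thesis by (simp add: ev_def formal_zd_def sum_divide_distrib)
qed

lemma ev_shift: "w (fst x) ^ m * ev K g x = ev (K + m) (\<lambda>\<mu>. fps_X ^ m * g \<mu>) x"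
proof -
  let ?t = "\<lambda>k. w (fst x) ^ k * poly (fps_nth (fps_X ^ m * g (snd x)) k) (lg (fst x))"
  have "ev (K + m) (\<lambda>\<mu>. fps_X ^ m * g \<mu>) x = (\<Sum>k\<in>{m..K + m}. ?t k)"
    unfolding ev_def by (rule sum.mono_neutral_right) (auto simp: fps_X_power_mult_nth)
  also have "\<dots> = (\<Sum>k\<in>{0..K}. ?t (k + m))"
    using sum.shift_bounds_cl_nat_ivl[of ?t 0 m K] by simp
  also have "\<dots> = (\<Sum>k\<le>K. w (fst x) ^ m * (w (fst x) ^ k * poly (fps_nth (g (snd x)) k) (lg (fst x))))"
    unfolding atLeast0AtMost by (intro sum.cong) (simp_all add: fps_X_power_mult_nth power_add mult_ac)
  finally show ?thesis unfolding ev_def sum_distrib_left by (rule sym)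
qed

lemma ev_holomorphic: "(\<lambda>z. ev K f (z, \<mu>)) holomorphic_on - \<real>\<^sub>\<le>\<^sub>0"
  unfolding holomorphic_on_open[OF open_slit] using ev_has_derivative by blast

lemma ev_diff: "ev K f x - ev K g x = ev K (\<lambda>\<mu>. f \<mu> - g \<mu>) x"
  using ev_add[of K f "\<lambda>\<mu>. - g \<mu>" x] ev_uminus[of K g x] by simp

lemma deriv2_ev:
  assumes "z \<notin> \<real>\<^sub>\<le>\<^sub>0"
  shows "(deriv ^^ 2) (\<lambda>z. ev K f (z, \<mu>)) z = ev (K + (n - 1)) (\<lambda>\<mu>. formal_d2 n (f \<mu>)) (z, \<mu>)"
proof -
  define f1 where "f1 = (\<lambda>\<mu>. formal_zd n (f \<mu>))"
  define f2 where "f2 = (\<lambda>\<mu>. formal_zd n (f1 \<mu>))"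
  have z0: "z \<noteq> 0" using assms by auto
  have d1: "deriv (\<lambda>z. ev K f (z, \<mu>)) y = ev K f1 (y, \<mu>) / y" if "y \<notin> \<real>\<^sub>\<le>\<^sub>0" for y
    unfolding f1_def by (rule DERIV_imp_deriv[OF ev_has_derivative[OF that]])
  have "\<forall>\<^sub>F y in nhds z. y \<in> - \<real>\<^sub>\<le>\<^sub>0" using assms by (intro eventually_nhds_in_open open_slit) simp
  then have "\<forall>\<^sub>F y in nhds z. deriv (\<lambda>z. ev K f (z, \<mu>)) y = ev K f1 (y, \<mu>) / y"
    by eventually_elim (simp add: d1)
  then have "(deriv ^^ 2) (\<lambda>z. ev K f (z, \<mu>)) z = deriv (\<lambda>y. ev K f1 (y, \<mu>) / y) z"
    by (simp add: numeral_2_eq_2 deriv_cong_ev)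
  also have "((\<lambda>y. ev K f1 (y, \<mu>) / y) has_field_derivative
      (ev K f2 (z, \<mu>) / z * z - ev K f1 (z, \<mu>) * 1) / (z * z)) (at z)"
    unfolding f2_def by (rule DERIV_divide[OF ev_has_derivative[OF assms] DERIV_ident z0])
  then have "deriv (\<lambda>y. ev K f1 (y, \<mu>) / y) z = (ev K f2 (z, \<mu>) - ev K f1 (z, \<mu>)) / z ^ 2"
    using z0 by (simp add: DERIV_imp_deriv power2_eq_square)
  also have "\<dots> = w z ^ (n - 1) * ev K (\<lambda>\<mu>. f2 \<mu> - f1 \<mu>) (z, \<mu>)"
    unfolding w_power_eq[OF assms] ev_diff by simp
  also have "\<dots> = ev (K + (n - 1)) (\<lambda>\<mu>. formal_d2 n (f \<mu>)) (z, \<mu>)"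
    using ev_shift[of "(z, \<mu>)" "n - 1" K "\<lambda>\<mu>. f2 \<mu> - f1 \<mu>"]
    by (simp add: f1_def f2_def formal_d2_def)
  finally show ?thesis .
qed

lemma higher_deriv_ev:
  assumes "z \<notin> \<real>\<^sub>\<le>\<^sub>0"
  shows "(deriv ^^ (2 * l)) (\<lambda>z. ev K f (z, \<mu>)) z = ev (K + l * (n - 1)) (\<lambda>\<mu>. (formal_d2 n ^^ l) (f \<mu>)) (z, \<mu>)"
  using assms
proof (induction l arbitrary: z)
  case (Suc l)
  have "\<forall>\<^sub>F y in nhds z. y \<in> - \<real>\<^sub>\<le>\<^sub>0" using Suc.prems by (intro eventually_nhds_in_open open_slit) simp
  then have ev: "\<forall>\<^sub>F y in nhds z. (deriv ^^ (2 * l)) (\<lambda>z. ev K f (z, \<mu>)) y =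
      ev (K + l * (n - 1)) (\<lambda>\<mu>. (formal_d2 n ^^ l) (f \<mu>)) (y, \<mu>)"
    by eventually_elim (use Suc.IH in simp)
  have "(deriv ^^ (2 * Suc l)) (\<lambda>z. ev K f (z, \<mu>)) z = (deriv ^^ 2) ((deriv ^^ (2 * l)) (\<lambda>z. ev K f (z, \<mu>))) z"
    by (simp add: numeral_2_eq_2)
  also have "\<dots> = (deriv ^^ 2) (\<lambda>y. ev (K + l * (n - 1)) (\<lambda>\<mu>. (formal_d2 n ^^ l) (f \<mu>)) (y, \<mu>)) z"
    by (rule higher_deriv_cong_ev[OF ev refl])
  also have "\<dots> = ev (K + l * (n - 1) + (n - 1)) (\<lambda>\<mu>. formal_d2 n ((formal_d2 n ^^ l) (f \<mu>))) (z, \<mu>)"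
    by (rule deriv2_ev[OF Suc.prems])
  finally show ?case by (simp add: add_ac)
qed simp

lemma norm_w_le_shift:
  assumes z: "z \<notin> \<real>\<^sub>\<le>\<^sub>0" and y: "y \<notin> \<real>\<^sub>\<le>\<^sub>0" and "norm (y - z) \<le> 1" "norm z \<ge> 2"
  shows "norm (w y) \<le> 2 powr r * norm (w z)"
proof -
  have "norm z \<le> norm y + norm (y - z)" by (metis norm_minus_commute norm_triangle_sub)
  then have "norm z / 2 \<le> norm y" using assms(3,4) by linarith
  then have "norm y powr (- r) \<le> (norm z / 2) powr (- r)"
    using r_pos assms(4) by (intro powr_mono2') auto
  also have "\<dots> = 2 powr r * norm z powr (- r)"
    using assms(4) by (simp add: powr_divide powr_minus field_simps)
  finally show ?thesis using norm_w z y by simp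
qed

text \<open>A horizontal move by 1 changes the defining inequality by at most
  \<open>\<gamma>\<close>, which is what the larger parameter pays for.\<close>

lemma segment_Dom_s:
  assumes "z \<in> Dom_s \<gamma> (\<rho> + \<gamma>)" "y \<in> closed_segment (z - 1) (z + 1)"
  shows "y \<in> Dom_s \<gamma> \<rho>" "norm (y - z) \<le> 1"
proof -
  obtain u where u: "0 \<le> u" "u \<le> 1" "y = (1 - u) *\<^sub>R (z - 1) + u *\<^sub>R (z + 1)"
    using assms(2) unfolding in_segment by blast
  have y: "y = z + of_real (2 * u - 1)"
    using u(3) by (simp add: scaleR_conv_of_real algebra_simps)
  have "norm (y - z) = \<bar>2 * u - 1\<bar>" unfolding y by (metis add_diff_cancel_left' norm_of_real)
  then show "norm (y - z) \<le> 1" using u by linarith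
  have Re: "Re y = Re z + (2 * u - 1)" and Im: "Im y = Im z" using y by simp_all
  have "\<gamma> * (- 1) \<le> \<gamma> * (2 * u - 1)" using u \<gamma>_pos by (intro mult_left_mono) auto
  then show "y \<in> Dom_s \<gamma> \<rho>" using assms(1) unfolding Dom_s_def mem_Collect_eq Re Im
    by (simp add: algebra_simps)
qed

text \<open>Even derivatives of a truncation are truncations of the iterated formal derivatives, so
  Taylor's formula matches \<open>formal_Delta2\<close> term by term. Its remainder is governed by a
  derivative of high formal order, which has to be bounded on the whole segment from z - 1 to z +
  1.\<close>

lemma asy_Delta2:
  assumes bdd: "bdd_fps M f" and fin: "\<And>\<mu> k. \<mu> \<in> M \<Longrightarrow> k > K \<Longrightarrow> fps_nth (f \<mu>) k = 0"
  shows "asy (\<lambda>x. Delta2 (\<lambda>z. ev K f (z, snd x)) (fst x)) (\<lambda>\<mu>. formal_Delta2 n (f \<mu>))"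
  unfolding asy_def
proof (intro conjI allI)
  show "bdd_fps M (\<lambda>\<mu>. formal_Delta2 n (f \<mu>))" using bdd by (rule bdd_fps_formal_Delta2)
  fix N :: nat
  \<comment> \<open>Beyond N, so that the derivative of order 2q + 2 in the remainder is
    \<open>O(w^N)\<close> and every l that contributes to orders up to N occurs in the sum.\<close>
  define q where "q = Suc N"
  define F where "F = (\<lambda>l \<mu>. (formal_d2 n ^^ l) (f \<mu>))"
  define e where "e = (\<lambda>l. ev (K + l * (n - 1)) (F l))"
  have asyF: "asy (e l) (F l)" for l
    unfolding e_def F_def
    by (intro asy_finite bdd_fps_formal_d2_funpow bdd formal_d2_funpow_support[OF fin])
  define E where "E = (\<lambda>x. Delta2 (\<lambda>z. ev K f (z, snd x)) (fst x) - (\<Sum>l=1..q. 2 / fact (2 * l) * e l x))"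
  have EO: "E \<in> Ow N"
  proof -
    have "e (Suc q) \<in> Ow N"
      by (rule asy_imp_Ow[OF asyF]) (simp add: F_def formal_d2_funpow_order[OF n_ge] q_def del: funpow.simps)
    then obtain C where C: "C > 0" "\<forall>\<^sub>F x in Fl. norm (e (Suc q) x) \<le> C * norm (w (fst x) ^ N)"
      by (rule landau_o.bigE)
    then obtain \<rho> where \<rho>: "\<rho> > 0"
      "\<And>z \<mu>. z \<in> Dom_s \<gamma> \<rho> \<Longrightarrow> \<mu> \<in> M \<Longrightarrow> norm (e (Suc q) (z, \<mu>)) \<le> C * norm (w z) ^ N"
      unfolding eventually_Fl by (auto simp: norm_power)
    define C' where "C' = 2 * (C * (2 powr r) ^ N)"
    show ?thesis
    proof (rule bigoI[of _ C'])
      have "\<forall>\<^sub>F x in Fl. norm (fst x) \<ge> 2" using filterlim_norm_Fl unfolding filterlim_at_top by blast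
      then show "\<forall>\<^sub>F x in Fl. norm (E x) \<le> C' * norm (w (fst x) ^ N)"
        using eventually_mem[of "\<rho> + \<gamma>"]
      proof eventually_elim
        case (elim x)
        obtain z \<mu> where x: "x = (z, \<mu>)" by (cases x)
        have z: "norm z \<ge> 2" "z \<in> Dom_s \<gamma> (\<rho> + \<gamma>)" "z \<notin> \<real>\<^sub>\<le>\<^sub>0" "\<mu> \<in> M" using elim x by auto
        define h where "h = (\<lambda>z. ev K f (z, \<mu>))"
        have sl: "y \<notin> \<real>\<^sub>\<le>\<^sub>0" if "y \<in> closed_segment (z - 1) (z + 1)" for y
          using segment_Dom_s(1)[OF z(2) that] \<rho>(1) by (rule Dom_s_not_nonpos)
        have "norm (Delta2 h z - (\<Sum>l=1..q. 2 / fact (2 * l) * (deriv ^^ (2 * l)) h z))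
            \<le> 2 * (C * (2 powr r * norm (w z)) ^ N)"
        proof (rule second_difference_Taylor)
          show "h holomorphic_on - \<real>\<^sub>\<le>\<^sub>0" unfolding h_def by (rule ev_holomorphic)
          show "open (- \<real>\<^sub>\<le>\<^sub>0 :: complex set)" by (rule open_slit)
          show "closed_segment (z - 1) (z + 1) \<subseteq> - \<real>\<^sub>\<le>\<^sub>0" using sl by blast
          fix y assume y: "y \<in> closed_segment (z - 1) (z + 1)"
          have "(deriv ^^ (2 * q + 2)) h y = e (Suc q) (y, \<mu>)"
            using higher_deriv_ev[OF sl[OF y], of "Suc q" K f \<mu>] by (simp add: h_def e_def F_def)
          also have "norm \<dots> \<le> C * norm (w y) ^ N"
            by (rule \<rho>(2)[OF segment_Dom_s(1)[OF z(2) y] z(4)])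
          also have "\<dots> \<le> C * (2 powr r * norm (w z)) ^ N"
            using C(1) norm_w_le_shift[OF z(3) sl[OF y] segment_Dom_s(2)[OF z(2) y] z(1)]
            by (intro mult_left_mono power_mono) auto
          finally show "norm ((deriv ^^ (2 * q + 2)) h y) \<le> C * (2 powr r * norm (w z)) ^ N" .
        qed
        moreover have "(deriv ^^ (2 * l)) h z = e l (z, \<mu>)" for l
          unfolding h_def e_def F_def by (rule higher_deriv_ev[OF z(3)])
        ultimately show ?case
          by (simp add: E_def x C'_def norm_power power_mult_distrib mult_ac h_def)
      qed
    qed
  qed
  have "(\<lambda>x. \<Sum>l=1..q. 2 / fact (2 * l) * (e l x - ev N (F l) x)) \<in> Ow N"
  proof (rule big_sum_in_bigo)
    fix l
    show "(\<lambda>x. 2 / fact (2 * l) * (e l x - ev N (F l) x)) \<in> Ow N"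
      by (rule landau_o.big.cmult_in_iff[THEN iffD2, OF _ asyD(1)[OF asyF]]) simp
  qed
  from sum_in_bigo(1)[OF EO this]
  have "(\<lambda>x. E x + (\<Sum>l=1..q. 2 / fact (2 * l) * (e l x - ev N (F l) x))) \<in> Ow N" .
  moreover have "E x + (\<Sum>l=1..q. 2 / fact (2 * l) * (e l x - ev N (F l) x)) =
      Delta2 (\<lambda>z. ev K f (z, snd x)) (fst x) - ev N (\<lambda>\<mu>. formal_Delta2 n (f \<mu>)) x" for x
  proof -
    have nth: "fps_nth (formal_Delta2 n (f \<mu>)) k = (\<Sum>l=1..q. smult (2 / fact (2 * l)) (fps_nth (F l \<mu>) k))"
      if "k \<le> N" for k \<mu>
      unfolding formal_Delta2_def F_def fps_nth_Abs_fps
      by (rule sum.mono_neutral_left) (use that in \<open>auto simp: q_def formal_d2_funpow_order[OF n_ge]\<close>)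
    have "ev N (\<lambda>\<mu>. formal_Delta2 n (f \<mu>)) x =
        (\<Sum>k\<le>N. \<Sum>l=1..q. 2 / fact (2 * l) * (w (fst x) ^ k * poly (fps_nth (F l (snd x)) k) (lg (fst x))))"
      unfolding ev_def by (intro sum.cong) (simp_all add: nth poly_sum sum_distrib_left mult_ac)
    also have "\<dots> = (\<Sum>l=1..q. 2 / fact (2 * l) * ev N (F l) x)"
      unfolding ev_def sum_distrib_left by (rule sum.swap)
    finally show ?thesis
      by (simp add: E_def right_diff_distrib sum_subtractf)
  qed
  ultimately show "(\<lambda>x. Delta2 (\<lambda>z. ev K f (z, snd x)) (fst x) - ev N (\<lambda>\<mu>. formal_Delta2 n (f \<mu>)) x) \<in> Ow N"
    by (simp only:)
qed

end

subsection \<open>Uniform bounds for the coefficients of the formal solution\<close>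

lemma bdd_polyI_coeff:
  assumes deg: "\<And>\<mu>. \<mu> \<in> M \<Longrightarrow> degree (P \<mu>) \<le> d"
    and bdd: "\<And>i. i \<le> d \<Longrightarrow> bounded ((\<lambda>\<mu>. coeff (P \<mu>) i) ` M)"
  shows "bdd_poly M P"
proof -
  have "\<forall>i\<in>{..d}. \<exists>B. \<forall>\<mu>\<in>M. norm (coeff (P \<mu>) i) \<le> B"
    using bdd unfolding bounded_iff by blast
  then obtain B where B: "\<And>i \<mu>. i \<le> d \<Longrightarrow> \<mu> \<in> M \<Longrightarrow> norm (coeff (P \<mu>) i) \<le> B i"
    by (metis atMost_iff)
  show ?thesis
  proof (rule bdd_polyI[OF deg])
    fix \<mu> i assume \<mu>: "\<mu> \<in> M"
    have nonneg: "0 \<le> B j" if "j \<le> d" for j using order_trans[OF norm_ge_zero B[OF that \<mu>]] .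
    show "norm (coeff (P \<mu>) i) \<le> (\<Sum>j\<le>d. B j)"
    proof (cases "i \<le> d")
      case True
      have "B i \<le> (\<Sum>j\<le>d. B j)" using True nonneg by (intro member_le_sum) auto
      then show ?thesis using B[OF True \<mu>] by linarith
    next
      case False
      then have "coeff (P \<mu>) i = 0" using deg[OF \<mu>] by (intro coeff_eq_0) linarith
      then show ?thesis using nonneg by (auto intro!: sum_nonneg)
    qed
  qed
qed

lemma bdd_poly_coeff: "bdd_poly M P \<Longrightarrow> bounded ((\<lambda>\<mu>. coeff (P \<mu>) i) ` M)"
  unfolding bdd_poly_def bounded_iff by blast

lemma bounded_fun_add: "bounded (f ` M) \<Longrightarrow> bounded (g ` M) \<Longrightarrow> bounded ((\<lambda>\<mu>. f \<mu> + g \<mu>) ` M)"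
  for f g :: "'m \<Rightarrow> complex"
  by (rule bounded_plus_comp)

lemma bounded_fun_cmult: "bounded (f ` M) \<Longrightarrow> bounded ((\<lambda>\<mu>. a * f \<mu>) ` M)"
  for f :: "'m \<Rightarrow> complex" and a :: complex
  using bounded_linear_image[of "f ` M" "(*) a"] bounded_linear_mult_right[of a] by (simp add: image_image)

text \<open>
  Comparing coefficients from the top degree downwards; at the resonance \<open>b = 0\<close> only the constant
  coefficient stays undetermined.
\<close>

lemma bdd_poly_second_order_ode:
  assumes deg: "\<And>\<mu>. \<mu> \<in> M \<Longrightarrow> degree (P \<mu>) \<le> d" and Q: "bdd_poly M Q"
    and eq: "\<And>\<mu>. \<mu> \<in> M \<Longrightarrow> pderiv (pderiv (P \<mu>)) - smult a (pderiv (P \<mu>)) + smult b (P \<mu>) = Q \<mu>"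
    and ab: "b \<noteq> 0 \<or> (a \<noteq> 0 \<and> bounded ((\<lambda>\<mu>. coeff (P \<mu>) 0) ` M))"
  shows "bdd_poly M P"
proof -
  let ?bc = "\<lambda>i. bounded ((\<lambda>\<mu>. coeff (P \<mu>) i) ` M)"
  have rec: "of_nat (Suc i) * of_nat (Suc (Suc i)) * coeff (P \<mu>) (Suc (Suc i))
      - a * (of_nat (Suc i) * coeff (P \<mu>) (Suc i)) + b * coeff (P \<mu>) i = coeff (Q \<mu>) i" if "\<mu> \<in> M" for \<mu> i
    using arg_cong[OF eq[OF that], of "\<lambda>p. coeff p i"] by (simp add: coeff_pderiv algebra_simps)
  have top: "?bc i" if "i > d" for i
  proof -
    have "coeff (P \<mu>) i = 0" if "\<mu> \<in> M" for \<mu> using deg[OF that] \<open>i > d\<close> by (intro coeff_eq_0) linarith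
    then show ?thesis by (auto simp: bounded_iff intro!: exI[of _ 0])
  qed
  have all: "?bc i" if i: "i > 0 \<or> b \<noteq> 0" for i
    using i
  proof (induction "Suc d - i" arbitrary: i rule: less_induct)
    case less
    show ?case
    proof (cases "i > d")
      case False
      have IH: "?bc j" if "j > i" for j using that False by (intro less.hyps) auto
      show ?thesis
      proof (cases "b = 0")
        case False
        have "coeff (P \<mu>) i = inverse b * (coeff (Q \<mu>) i + (- (of_nat (Suc i) * of_nat (Suc (Suc i))) * coeff (P \<mu>) (Suc (Suc i))
            + a * of_nat (Suc i) * coeff (P \<mu>) (Suc i)))" if "\<mu> \<in> M" for \<mu>
          using rec[OF that, of i] False by (simp add: field_simps)
        moreover have "bounded ((\<lambda>\<mu>. inverse b * (coeff (Q \<mu>) i + (- (of_nat (Suc i) * of_nat (Suc (Suc i))) * coeff (P \<mu>) (Suc (Suc i))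
            + a * of_nat (Suc i) * coeff (P \<mu>) (Suc i)))) ` M)"
          by (intro bounded_fun_cmult bounded_fun_add bdd_poly_coeff[OF Q] IH) auto
        ultimately show ?thesis by (simp cong: image_cong)
      next
        case True
        then obtain j where j: "i = Suc j" using less.prems by (cases i) auto
        have a: "a \<noteq> 0" using ab True by blast
        have nz: "a * of_nat (Suc j) \<noteq> 0" using a by (simp del: of_nat_Suc)
        have "coeff (P \<mu>) i = inverse (a * of_nat (Suc j)) * (of_nat (Suc j) * of_nat (Suc (Suc j)) * coeff (P \<mu>) (Suc i)
            + (- 1) * coeff (Q \<mu>) j)" if "\<mu> \<in> M" for \<mu>
        proof -
          have "a * of_nat (Suc j) * coeff (P \<mu>) i = of_nat (Suc j) * of_nat (Suc (Suc j)) * coeff (P \<mu>) (Suc i) - coeff (Q \<mu>) j"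
            using rec[OF that, of j] True j by (simp add: algebra_simps)
          then show ?thesis using nz by (simp add: field_simps del: of_nat_Suc)
        qed
        moreover have "bounded ((\<lambda>\<mu>. inverse (a * of_nat (Suc j)) * (of_nat (Suc j) * of_nat (Suc (Suc j)) * coeff (P \<mu>) (Suc i)
            + (- 1) * coeff (Q \<mu>) j)) ` M)"
          by (intro bounded_fun_cmult bounded_fun_add bdd_poly_coeff[OF Q] IH) auto
        ultimately show ?thesis by (simp cong: image_cong)
      qed
    qed (rule top)
  qed
  show ?thesis
  proof (rule bdd_polyI_coeff[OF deg])
    show "?bc i" for i using all[of i] ab by (cases "i = 0") auto
  qed
qed

section \<open>Triangular structure of the formal equation\<close>

text \<open>On order k the operator z d/dz is d/dL - x with x = k r, and its square minus itself is
  the second-order operator displayed here. Its zeroth-order term x (x + 1) is the indicial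
  polynomial.\<close>

lemma formal_d2_nth_add:
  "fps_nth (formal_d2 n f) (k + (n - 1)) =
     pderiv (pderiv (fps_nth f k)) - smult (of_real (2 * (real k * rexp n) + 1)) (pderiv (fps_nth f k))
     + smult (of_real (real k * rexp n * (real k * rexp n + 1))) (fps_nth f k)"
proof -
  define a where "a = complex_of_real (real k * rexp n)"
  have "pderiv (pderiv P - smult a P) - smult a (pderiv P - smult a P) - (pderiv P - smult a P) =
      pderiv (pderiv P) - smult (2 * a + 1) (pderiv P) + smult (a * (a + 1)) P" for P
    by (rule poly_eqI) (simp add: pderiv_diff pderiv_smult algebra_simps)
  then show ?thesis by (simp add: formal_d2_nth formal_zd_def a_def)
qed

text \<open>The operator acts order by order and then shifts by n - 1. For l at least 2, the
  coefficient of order k + (n - 1) therefore involves only coefficients below k.\<close>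

lemma formal_d2_funpow_cong:
  assumes "\<And>j. j < k \<Longrightarrow> fps_nth f j = fps_nth g j" "j < k + l * (n - 1)"
  shows "fps_nth ((formal_d2 n ^^ l) f) j = fps_nth ((formal_d2 n ^^ l) g) j"
  using assms(2)
proof (induction l arbitrary: j)
  case (Suc l)
  show ?case
  proof (cases "j < n - 1")
    case False
    then have "fps_nth ((formal_d2 n ^^ l) f) (j - (n - 1)) = fps_nth ((formal_d2 n ^^ l) g) (j - (n - 1))"
      using Suc.prems by (intro Suc.IH) auto
    then show ?thesis by (simp add: formal_d2_nth formal_zd_def)
  qed (simp add: formal_d2_nth)
qed (use assms in simp)

lemma fps_power_diff_factor:
  fixes f g h :: "'a::comm_ring_1 fps"
  assumes "f - g = fps_X ^ k * h"
  shows "f ^ i - g ^ i = fps_X ^ k * (h * (\<Sum>j<i. g ^ (i - Suc j) * f ^ j))"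
  unfolding power_diff_sumr2 assms by (simp add: mult_ac)

lemma fps_cutoff_decomp:
  fixes f :: "'a::comm_ring_1 fps"
  shows "f - fps_cutoff k f = fps_X ^ k * fps_shift k f"
  by (rule fps_ext) (simp add: fps_X_power_mult_nth)

lemma fps_eq_X_mult_shift:
  fixes f :: "'a::comm_ring_1 fps"
  assumes "fps_nth f 0 = 0"
  shows "f = fps_X * fps_shift 1 f"
  using assms by (intro fps_ext) (simp add: fps_X_mult_nth)

text \<open>Factoring \<open>fps_X\<close> out of \<open>f\<close> and of its cut-off adds i - 1 to
  the order of the difference of i-th powers. The leading coefficient of that difference is the
  derivative of the power at the linear coefficient; k at least 2 ensures that the cut-off keeps
  this coefficient.\<close>

lemma fps_power_cutoff_nth:
  fixes f :: "'a::comm_ring_1 fps"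
  assumes f0: "fps_nth f 0 = 0" and k: "k \<ge> 1"
  shows "j < k + i - 1 \<Longrightarrow> i \<ge> 1 \<Longrightarrow> fps_nth (f ^ i) j = fps_nth (fps_cutoff k f ^ i) j"
    and "k \<ge> 2 \<Longrightarrow> i \<ge> 1 \<Longrightarrow> fps_nth (f ^ i) (k + i - 1) =
       fps_nth (fps_cutoff k f ^ i) (k + i - 1) + of_nat i * fps_nth f 1 ^ (i - 1) * fps_nth f k"
proof -
  define g where "g = fps_cutoff k f"
  define f' where "f' = fps_shift 1 f"
  define g' where "g' = fps_shift 1 g"
  have f: "f = fps_X * f'" unfolding f'_def by (rule fps_eq_X_mult_shift[OF f0])
  have g: "g = fps_X * g'" unfolding g'_def using k by (intro fps_eq_X_mult_shift) (simp add: g_def f0)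
  have diff: "f ^ i - g ^ i = fps_X ^ (k + i - 1) * (fps_shift k f * (\<Sum>j<i. g' ^ (i - Suc j) * f' ^ j))" if "i \<ge> 1"
  proof -
    have "f ^ i - g ^ i = fps_X ^ k * (fps_shift k f * (\<Sum>j<i. g ^ (i - Suc j) * f ^ j))"
      unfolding g_def by (rule fps_power_diff_factor[OF fps_cutoff_decomp])
    also have "(\<Sum>j<i. g ^ (i - Suc j) * f ^ j) = (\<Sum>j<i. fps_X ^ (i - 1) * (g' ^ (i - Suc j) * f' ^ j))"
    proof (rule sum.cong[OF refl])
      fix j assume "j \<in> {..<i}"
      then have e: "(i - Suc j) + j = i - 1" by auto
      have "g ^ (i - Suc j) * f ^ j = (fps_X ^ (i - Suc j) * fps_X ^ j) * (g' ^ (i - Suc j) * f' ^ j)"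
        by (simp only: f g power_mult_distrib mult_ac)
      also have "fps_X ^ (i - Suc j) * fps_X ^ j = (fps_X ^ (i - 1) :: 'a fps)"
        by (simp only: power_add[symmetric] e)
      finally show "g ^ (i - Suc j) * f ^ j = fps_X ^ (i - 1) * (g' ^ (i - Suc j) * f' ^ j)" .
    qed
    also have "\<dots> = fps_X ^ (i - 1) * (\<Sum>j<i. g' ^ (i - Suc j) * f' ^ j)" by (rule sum_distrib_left[symmetric])
    also have "fps_X ^ k * (fps_shift k f * (fps_X ^ (i - 1) * (\<Sum>j<i. g' ^ (i - Suc j) * f' ^ j)))
      = fps_X ^ (k + i - 1) * (fps_shift k f * (\<Sum>j<i. g' ^ (i - Suc j) * f' ^ j))"
    proof -
      have "k + i - 1 = k + (i - 1)" using that by simp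
      then show ?thesis by (simp only: power_add mult_ac)
    qed
    finally show ?thesis .
  qed
  show "fps_nth (f ^ i) j = fps_nth (fps_cutoff k f ^ i) j" if "j < k + i - 1" "i \<ge> 1"
    using arg_cong[OF diff[OF that(2)], of "\<lambda>p. fps_nth p j"] that(1) by (simp add: fps_X_power_mult_nth g_def)
  show "fps_nth (f ^ i) (k + i - 1) = fps_nth (fps_cutoff k f ^ i) (k + i - 1) + of_nat i * fps_nth f 1 ^ (i - 1) * fps_nth f k"
    if "k \<ge> 2" "i \<ge> 1"
  proof -
    have "fps_nth (\<Sum>j<i. g' ^ (i - Suc j) * f' ^ j) 0 = (\<Sum>j<i. fps_nth f 1 ^ (i - 1))"
      unfolding fps_sum_nth
    proof (rule sum.cong[OF refl])
      fix j assume "j \<in> {..<i}"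
      then have "i - 1 = (i - Suc j) + j" by auto
      moreover have "fps_nth g' 0 = fps_nth f 1" "fps_nth f' 0 = fps_nth f 1" using that by (simp_all add: g'_def f'_def g_def)
      ultimately show "fps_nth (g' ^ (i - Suc j) * f' ^ j) 0 = fps_nth f 1 ^ (i - 1)"
        by (simp add: fps_mult_nth_0 fps_power_zeroth flip: power_add)
    qed
    then have "fps_nth (f ^ i - g ^ i) (k + i - 1) = fps_nth f k * (of_nat i * fps_nth f 1 ^ (i - 1))"
      unfolding diff[OF that(2)] by (simp add: fps_X_power_mult_nth)
    then show ?thesis by (simp add: g_def algebra_simps)
  qed
qed

text \<open>Linearisation about constant term 1, as needed for exponentials, where raising to a
  power gains no order.\<close>

lemma fps_power_perturb_nth:
  fixes f g h :: "'a::comm_ring_1 fps"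
  assumes "f - g = fps_X ^ k * h" "fps_nth f 0 = 1" "k \<ge> 1"
  shows "j < k \<Longrightarrow> fps_nth (f ^ i) j = fps_nth (g ^ i) j"
    and "fps_nth (f ^ i) k = fps_nth (g ^ i) k + of_nat i * fps_nth h 0"
proof -
  have g0: "fps_nth g 0 = 1"
    using arg_cong[OF assms(1), of "\<lambda>p. fps_nth p 0"] assms(2,3) by (simp add: fps_X_power_mult_nth)
  note d = fps_power_diff_factor[OF assms(1), of i]
  show "fps_nth (f ^ i) j = fps_nth (g ^ i) j" if "j < k"
    using arg_cong[OF d, of "\<lambda>p. fps_nth p j"] that by (simp add: fps_X_power_mult_nth)
  have "fps_nth (f ^ i - g ^ i) k = fps_nth h 0 * fps_nth (\<Sum>j<i. g ^ (i - Suc j) * f ^ j) 0"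
    unfolding d by (simp add: fps_X_power_mult_nth)
  also have "fps_nth (\<Sum>j<i. g ^ (i - Suc j) * f ^ j) 0 = of_nat i"
    by (simp add: fps_sum_nth fps_mult_nth_0 fps_power_zeroth assms(2) g0)
  finally show "fps_nth (f ^ i) k = fps_nth (g ^ i) k + of_nat i * fps_nth h 0" by (simp add: algebra_simps)
qed

text \<open>At order k only the linear term of \<open>a\<close> sees the k-th coefficient of
  \<open>u\<close>; quadratic and higher powers meet it at order k + 1 or later.\<close>

lemma fps_compose_cutoff_nth:
  fixes a u :: "complex poly fps"
  assumes u0: "fps_nth u 0 = 0" and k: "k \<ge> 1"
  shows "j < k \<Longrightarrow> fps_nth (a oo u) j = fps_nth (a oo fps_cutoff k u) j"
    and "fps_nth (a oo u) k = fps_nth (a oo fps_cutoff k u) k + fps_nth a 1 * fps_nth u k"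
proof -
  let ?v = "fps_cutoff k u"
  have pw: "fps_nth (u ^ i) j = fps_nth (?v ^ i) j" if "j < k + i - 1" for i j
    using that fps_power_cutoff_nth(1)[OF u0 k, of j i] by (cases "i = 0") auto
  show "fps_nth (a oo u) j = fps_nth (a oo ?v) j" if "j < k"
    unfolding fps_compose_nth
  proof (rule sum.cong[OF refl])
    show "fps_nth a i * fps_nth (u ^ i) j = fps_nth a i * fps_nth (?v ^ i) j" for i
      using pw[of j i] that by (cases "i = 0") auto
  qed
  have "fps_nth (a oo u) k - fps_nth (a oo ?v) k = (\<Sum>i=0..k. fps_nth a i * (fps_nth (u ^ i) k - fps_nth (?v ^ i) k))"
    unfolding fps_compose_nth by (simp add: right_diff_distrib sum_subtractf)
  also have "\<dots> = (\<Sum>i\<in>{1}. fps_nth a i * (fps_nth (u ^ i) k - fps_nth (?v ^ i) k))"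
  proof (rule sum.mono_neutral_right)
    show "\<forall>i\<in>{0..k} - {1}. fps_nth a i * (fps_nth (u ^ i) k - fps_nth (?v ^ i) k) = 0"
    proof
      fix i assume "i \<in> {0..k} - {1}"
      then consider "i = 0" | "i \<ge> 2" by fastforce
      then show "fps_nth a i * (fps_nth (u ^ i) k - fps_nth (?v ^ i) k) = 0"
        using pw[of k i] by cases auto
    qed
  qed (use k in auto)
  also have "\<dots> = fps_nth a 1 * fps_nth u k" by simp
  finally show "fps_nth (a oo u) k = fps_nth (a oo ?v) k + fps_nth a 1 * fps_nth u k"
    by (simp add: algebra_simps)
qed

text \<open>The k-th coefficient enters \<open>u ^ n\<close> first at order k + n - 1, linearly. The
  powers from n + 1 on, which make up \<open>G\<close>, reach it only at a later order.\<close>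

lemma formal_rhs_Polynomial_nth:
  assumes u0: "fps_nth u 0 = 0" and u1: "fps_nth u 1 = [:c0:]" and k: "k \<ge> 2" and n: "n \<ge> 2"
    and g: "\<And>i. i < n + 1 \<Longrightarrow> g i = 0"
  shows "fps_nth (formal_rhs Polynomial n l0 g u) (k + (n - 1)) =
    smult (- (of_nat n * c0 ^ (n - 1))) (fps_nth u k) + fps_nth (formal_rhs Polynomial n l0 g (fps_cutoff k u)) (k + (n - 1))"
proof -
  let ?v = "fps_cutoff k u"
  have k1: "k \<ge> 1" using k by simp
  have eq: "k + (n - 1) = k + n - 1" using n by simp
  have "fps_nth (u ^ n) (k + (n - 1)) = fps_nth (?v ^ n) (k + (n - 1)) + of_nat n * fps_nth u 1 ^ (n - 1) * fps_nth u k"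
    unfolding eq using k n by (intro fps_power_cutoff_nth(2)[OF u0 k1]) auto
  also have "of_nat n * fps_nth u 1 ^ (n - 1) * fps_nth u k = smult (of_nat n * c0 ^ (n - 1)) (fps_nth u k)"
    unfolding u1 by (simp add: poly_const_pow of_nat_poly mult.commute)
  finally have 1: "fps_nth (u ^ n) (k + (n - 1)) = fps_nth (?v ^ n) (k + (n - 1)) + smult (of_nat n * c0 ^ (n - 1)) (fps_nth u k)" .
  have 2: "fps_nth (Abs_fps (\<lambda>k. [:g k:]) oo u) (k + (n - 1)) = fps_nth (Abs_fps (\<lambda>k. [:g k:]) oo ?v) (k + (n - 1))"
    unfolding fps_compose_nth
  proof (rule sum.cong[OF refl])
    fix i
    show "fps_nth (Abs_fps (\<lambda>k. [:g k:])) i * fps_nth (u ^ i) (k + (n - 1)) =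
        fps_nth (Abs_fps (\<lambda>k. [:g k:])) i * fps_nth (?v ^ i) (k + (n - 1))"
    proof (cases "i < n + 1")
      case False
      then show ?thesis using n by (subst fps_power_cutoff_nth(1)[OF u0 k1]) auto
    qed (simp add: g)
  qed
  show ?thesis using 1 2 by simp
qed

lemma formal_exp_phi_power_nth:
  "fps_nth (formal_exp_phi n l0 u ^ m) j =
     (if j < m then 0 else smult (exp (l0 / of_nat (n - 1)) ^ m) (fps_nth ((Abs_fps (\<lambda>k. [: 1 / fact k :]) oo u) ^ m) (j - m)))"
proof -
  have "formal_exp_phi n l0 u ^ m = fps_const [:exp (l0 / of_nat (n - 1)) ^ m:] * (fps_X ^ m * (Abs_fps (\<lambda>k. [: 1 / fact k :]) oo u) ^ m)"
    by (simp add: formal_exp_phi_def power_mult_distrib fps_const_power poly_const_pow mult.assoc)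
  then show ?thesis by (simp add: fps_X_power_mult_nth)
qed

text \<open>The (n - 1)-st power of the exponential is exp(l0) w^(n-1) times a power of a series
  with constant term 1, whose change at order k is linear. Terms of \<open>G\<close> shift by at
  least n orders, so at order k + (n - 1) they see only coefficients below k.\<close>

lemma formal_rhs_Trigonometric_nth:
  assumes u0: "fps_nth u 0 = 0" and k: "k \<ge> 1" and n: "n \<ge> 2" and g: "\<And>i. i < n \<Longrightarrow> g i = 0"
  shows "fps_nth (formal_rhs Trigonometric n l0 g u) (k + (n - 1)) =
    smult (- (of_nat (n - 1) * exp l0)) (fps_nth u k) + fps_nth (formal_rhs Trigonometric n l0 g (fps_cutoff k u)) (k + (n - 1))"
proof -
  define v where "v = fps_cutoff k u"
  define ex :: "complex poly fps" where "ex = Abs_fps (\<lambda>k. [: 1 / fact k :])"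
  define A where "A = ex oo u"
  define B where "B = ex oo v"
  define E where "E = exp (l0 / of_nat (n - 1))"
  have AB: "A - B = fps_X ^ k * fps_shift k (A - B)"
  proof (rule fps_ext)
    show "fps_nth (A - B) j = fps_nth (fps_X ^ k * fps_shift k (A - B)) j" for j
      using fps_compose_cutoff_nth(1)[OF u0 k, of j ex] by (auto simp: fps_X_power_mult_nth A_def B_def v_def)
  qed
  have h0: "fps_nth (fps_shift k (A - B)) 0 = fps_nth u k"
    using fps_compose_cutoff_nth(2)[OF u0 k, of ex] by (simp add: A_def B_def v_def ex_def one_pCons[symmetric])
  have A0: "fps_nth A 0 = 1" by (simp add: A_def ex_def fps_compose_nth one_pCons)
  have En: "E ^ (n - 1) = exp l0"
    unfolding E_def using n by (simp flip: exp_of_nat_mult)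
  have 1: "fps_nth (formal_exp_phi n l0 u ^ (n - 1)) (k + (n - 1)) =
      smult (of_nat (n - 1) * exp l0) (fps_nth u k) + fps_nth (formal_exp_phi n l0 v ^ (n - 1)) (k + (n - 1))"
  proof -
    have "fps_nth (A ^ (n - 1)) k = fps_nth (B ^ (n - 1)) k + smult (of_nat (n - 1)) (fps_nth u k)"
      using fps_power_perturb_nth(2)[OF AB A0 k, of "n - 1"] unfolding h0 by (simp add: of_nat_poly)
    then show ?thesis
      unfolding formal_exp_phi_power_nth E_def[symmetric] ex_def[symmetric] A_def[symmetric] B_def[symmetric] En
      by (simp add: smult_add_right mult.commute)
  qed
  have 2: "fps_nth (Abs_fps (\<lambda>k. [:g k:]) oo formal_exp_phi n l0 u) (k + (n - 1)) =
      fps_nth (Abs_fps (\<lambda>k. [:g k:]) oo formal_exp_phi n l0 v) (k + (n - 1))"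
    unfolding fps_compose_nth
  proof (rule sum.cong[OF refl])
    fix i
    show "fps_nth (Abs_fps (\<lambda>k. [:g k:])) i * fps_nth (formal_exp_phi n l0 u ^ i) (k + (n - 1)) =
        fps_nth (Abs_fps (\<lambda>k. [:g k:])) i * fps_nth (formal_exp_phi n l0 v ^ i) (k + (n - 1))"
    proof (cases "i < n")
      case False
      then have "fps_nth (A ^ i) (k + (n - 1) - i) = fps_nth (B ^ i) (k + (n - 1) - i)"
        using n k by (intro fps_power_perturb_nth(1)[OF AB A0 k]) auto
      then show ?thesis
        unfolding formal_exp_phi_power_nth ex_def[symmetric] A_def[symmetric] B_def[symmetric] by simp
    qed (simp add: g)
  qed
  show ?thesis using 1 2 by (simp add: v_def)
qed

lemma bdd_fps_formal_exp_phi: "bdd_fps M u \<Longrightarrow> bdd_fps M (\<lambda>\<mu>. formal_exp_phi n l0 (u \<mu>))"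
  unfolding formal_exp_phi_def
  using bdd_fps_compose[of "\<lambda>k _. 1 / fact k" M u]
  by (intro bdd_fps_mult bdd_fps_const) (simp add: image_constant_conv)

lemma bdd_fps_formal_rhs:
  assumes "bdd_fps M u" "\<And>k. bounded (Gk k ` M)"
  shows "bdd_fps M (\<lambda>\<mu>. formal_rhs cs n l0 (\<lambda>k. Gk k \<mu>) (u \<mu>))"
  by (cases cs)
    (simp_all add: bdd_fps_add bdd_fps_minus bdd_fps_power bdd_fps_compose bdd_fps_formal_exp_phi assms flip: add_uminus_conv_diff
      del: add_uminus_conv_diff)

text \<open>To leading order the linearised right-hand side is this number times z^-2: it equals -n
  c0^(n-1) = n r (r + 1), respectively -(n - 1) exp(l0). A power z^-x solves the linearised equation
  at leading order exactly when x (x + 1) has this value.\<close>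

definition resonance :: "inner_case \<Rightarrow> nat \<Rightarrow> real" where
  "resonance cs n = (case cs of Polynomial \<Rightarrow> (rexp n + 2) * (rexp n + 1) | Trigonometric \<Rightarrow> 2)"

lemma formal_sum_nth:
  "fps_nth (formal_sum cs n c \<mu>) 0 = 0"
  "k \<ge> 1 \<Longrightarrow> degree (fps_nth (formal_sum cs n c \<mu>) k) \<le> log_deg cs n k"
  "k \<ge> 1 \<Longrightarrow> coeff (fps_nth (formal_sum cs n c \<mu>) k) 0 = c (k - 1) 0 \<mu>"
proof -
  show "fps_nth (formal_sum cs n c \<mu>) 0 = 0" by (simp add: formal_sum_def)
  assume "k \<ge> 1"
  then have eq: "fps_nth (formal_sum cs n c \<mu>) k = (\<Sum>j\<le>log_deg cs n k. monom (c (k - 1) j \<mu>) j)"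
    by (simp add: formal_sum_def)
  show "degree (fps_nth (formal_sum cs n c \<mu>) k) \<le> log_deg cs n k"
    unfolding eq by (intro degree_sum_le) (auto intro: order_trans[OF degree_monom_le])
  show "coeff (fps_nth (formal_sum cs n c \<mu>) k) 0 = c (k - 1) 0 \<mu>"
  proof -
    have "(\<Sum>j\<le>log_deg cs n k. coeff (monom (c (k - 1) j \<mu>) j) 0) = (\<Sum>j\<le>log_deg cs n k. if j = 0 then c (k - 1) 0 \<mu> else 0)"
      by (intro sum.cong) auto
    then show ?thesis unfolding eq coeff_sum by simp
  qed
qed

lemma rexp_mult_n: "n \<ge> 2 \<Longrightarrow> real n * rexp n = rexp n + 2"
  by (simp add: rexp_def field_simps)

text \<open>The positive root of the indicial equation is x = r + 1 in the polynomial and x = 1 in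
  the trigonometric case; r (n - 1) = 2 translates x = k r into a condition on k.\<close>

lemma resonant_index:
  assumes n: "n \<ge> 2" and "real k * rexp n * (real k * rexp n + 1) = resonance cs n"
  shows "case cs of Polynomial \<Rightarrow> 2 * k = n + 1 | Trigonometric \<Rightarrow> 2 * k + 1 = n"
proof -
  define r where "r = rexp n"
  have "real n - 1 > 0" using n by simp
  then have r: "r > 0" "r * (real n - 1) = 2"
    unfolding r_def rexp_def by (simp, metis less_irrefl nonzero_eq_divide_eq)
  define x where "x = real k * r"
  have x: "x \<ge> 0" using r by (simp add: x_def)
  show ?thesis
  proof (cases cs)
    case Polynomial
    have "x * (x + 1) = (r + 2) * (r + 1)" using assms(2) Polynomial by (simp add: resonance_def x_def r_def)
    then have "(x - (r + 1)) * (x + r + 2) = 0" by (simp add: algebra_simps)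
    then have "x = r + 1" using x r by simp
    then have "r * (2 * real k) = r * (real n + 1)" using r(2) by (simp add: x_def algebra_simps)
    then have "real (2 * k) = real (n + 1)" using r by simp
    then show ?thesis using Polynomial by (simp only: of_nat_eq_iff inner_case.case)
  next
    case Trigonometric
    have "x * (x + 1) = 2" using assms(2) Trigonometric by (simp add: resonance_def x_def r_def)
    then have "(x - 1) * (x + 2) = 0" by (simp add: algebra_simps)
    then have "x = 1" using x by simp
    then have "r * (2 * real k + 1) = r * real n" using r(2) by (simp add: x_def algebra_simps)
    then have "real (2 * k + 1) = real n" using r by simp
    then show ?thesis using Trigonometric by (simp only: of_nat_eq_iff inner_case.case)
  qed
qed

text \<open>Strong induction over the order. Comparing coefficients at order k + (n - 1) gives a
  linear equation for the k-th polynomial, whose inhomogeneity depends on earlier, already bounded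
  coefficients.\<close>

lemma bdd_formal_sum:
  assumes n: "n \<ge> 2" and c0: "c0 ^ (n - 1) = of_real (- rexp n * (rexp n + 1))"
    and l0: "exp l0 = of_real (- 2 / (real n - 1))"
    and sol: "formal_solution cs n c0 l0 M Gk c"
    and exp: "inner_expansion cs n \<rr> M G Gk" and Gk: "\<And>k. bounded (Gk k ` M)"
  shows "bdd_fps M (formal_sum cs n c)"
proof -
  define u where "u = formal_sum cs n c"
  define ft where "ft = formal_tilde_phi0 cs n l0"
  have u0: "fps_nth (u \<mu>) 0 = 0" for \<mu> by (simp add: u_def formal_sum_nth)
  have ft0: "fps_nth ft k = 0" if "k \<ge> 1" for k using that by (cases cs) (simp_all add: ft_def)
  have eqn: "formal_Delta2 n (ft + u \<mu>) = formal_rhs cs n l0 (\<lambda>k. Gk k \<mu>) (u \<mu>)" if "\<mu> \<in> M" for \<mu>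
    using sol that by (simp add: formal_solution_def ft_def u_def)
  have "bdd_poly M (\<lambda>\<mu>. fps_nth (u \<mu>) k)" for k
  proof (induction k rule: less_induct)
    case (less k)
    show ?case
    proof (cases "k = 0 \<or> cs = Polynomial \<and> k = 1")
      case True
      then show ?thesis
      proof
        assume "k = 0"
        then show ?thesis by (simp add: u0)
      next
        assume *: "cs = Polynomial \<and> k = 1"
        have "fps_nth (u \<mu>) k = [:c0:]" if "\<mu> \<in> M" for \<mu>
          using sol that * by (simp add: u_def formal_sum_def formal_solution_def monom_0)
        then show ?thesis using bdd_poly_cong[of M "\<lambda>\<mu>. fps_nth (u \<mu>) k" "\<lambda>_. [:c0:]"] bdd_poly_const by blast
      qed
    next
      case False
      then have k: "k \<ge> 1" and k2: "cs = Polynomial \<Longrightarrow> k \<ge> 2" by auto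
      define v where "v = (\<lambda>\<mu>. fps_cutoff k (u \<mu>))"
      have v: "bdd_fps M v"
        unfolding bdd_fps_def
      proof
        show "bdd_poly M (\<lambda>\<mu>. fps_nth (v \<mu>) j)" for j
          using less.IH[of j] by (cases "j < k") (simp_all add: v_def)
      qed
      \<comment> \<open>Both terms are built from the cut-off \<open>v\<close> alone:
        \<open>Q1\<close> collects the derivatives of order four and higher, \<open>Q2\<close> the
        right-hand side without its linear dependence on the k-th coefficient.\<close>
      define Q1 where "Q1 = (\<lambda>\<mu>. \<Sum>l\<in>{2..k + (n - 1)}. smult (2 / fact (2 * l)) (fps_nth ((formal_d2 n ^^ l) (ft + v \<mu>)) (k + (n - 1))))"
      define Q2 where "Q2 = (\<lambda>\<mu>. fps_nth (formal_rhs cs n l0 (\<lambda>k. Gk k \<mu>) (v \<mu>)) (k + (n - 1)))"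
      have Q: "bdd_poly M (\<lambda>\<mu>. Q2 \<mu> - Q1 \<mu>)"
        unfolding Q1_def Q2_def
        by (intro bdd_poly_diff bdd_poly_sum bdd_poly_smult bdd_fpsD bdd_fps_formal_d2_funpow
            bdd_fps_formal_rhs bdd_fps_add bdd_fps_const v Gk)
      have rhs: "fps_nth (formal_rhs cs n l0 (\<lambda>k. Gk k \<mu>) (u \<mu>)) (k + (n - 1)) = smult (of_real (resonance cs n)) (fps_nth (u \<mu>) k) + Q2 \<mu>"
        if \<mu>: "\<mu> \<in> M" for \<mu>
      proof (cases cs)
        case Polynomial
        have u1: "fps_nth (u \<mu>) 1 = [:c0:]"
          using sol \<mu> Polynomial by (simp add: u_def formal_sum_def formal_solution_def monom_0)
        have g: "Gk i \<mu> = 0" if "i < n + 1" for i using exp \<mu> Polynomial that by simp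
        have "- (of_nat n * c0 ^ (n - 1)) = complex_of_real (real n * rexp n * (rexp n + 1))"
          unfolding c0 by simp
        also have "\<dots> = of_real (resonance cs n)"
          unfolding rexp_mult_n[OF n] using Polynomial by (simp add: resonance_def)
        finally have s: "- (of_nat n * c0 ^ (n - 1)) = complex_of_real (resonance cs n)" .
        show ?thesis
          using formal_rhs_Polynomial_nth[OF u0 u1 k2[OF Polynomial] n g, where ?l0.0 = l0] Polynomial
          unfolding s by (simp add: Q2_def v_def)
      next
        case Trigonometric
        have g: "Gk i \<mu> = 0" if "i < n" for i using exp \<mu> Trigonometric that by simp
        have "- (of_nat (n - 1) * exp l0) = complex_of_real (- (real (n - 1) * (- 2 / (real n - 1))))"
          unfolding l0 by simp
        also have "- (real (n - 1) * (- 2 / (real n - 1))) = resonance cs n"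
          using n Trigonometric by (simp add: resonance_def field_simps of_nat_diff)
        finally have s: "- (of_nat (n - 1) * exp l0) = complex_of_real (resonance cs n)" .
        show ?thesis
          using formal_rhs_Trigonometric_nth[OF u0 k n g, where ?l0.0 = l0] Trigonometric
          unfolding s by (simp add: Q2_def v_def)
      qed
      let ?x = "real k * rexp n"
      have ode: "pderiv (pderiv (fps_nth (u \<mu>) k)) - smult (of_real (2 * ?x + 1)) (pderiv (fps_nth (u \<mu>) k))
          + smult (of_real (?x * (?x + 1) - resonance cs n)) (fps_nth (u \<mu>) k) = Q2 \<mu> - Q1 \<mu>" if \<mu>: "\<mu> \<in> M" for \<mu>
      proof -
        have set: "{1..k + (n - 1)} = insert 1 {2..k + (n - 1)}" using k by auto
        have "fps_nth (formal_Delta2 n (ft + u \<mu>)) (k + (n - 1)) =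
            fps_nth (formal_d2 n (ft + u \<mu>)) (k + (n - 1)) +
            (\<Sum>l\<in>{2..k + (n - 1)}. smult (2 / fact (2 * l)) (fps_nth ((formal_d2 n ^^ l) (ft + u \<mu>)) (k + (n - 1))))"
          unfolding formal_Delta2_def fps_nth_Abs_fps set by (subst sum.insert) auto
        also have "(\<Sum>l\<in>{2..k + (n - 1)}. smult (2 / fact (2 * l)) (fps_nth ((formal_d2 n ^^ l) (ft + u \<mu>)) (k + (n - 1)))) = Q1 \<mu>"
          unfolding Q1_def
        proof (rule sum.cong[OF refl])
          fix l assume l: "l \<in> {2..k + (n - 1)}"
          have "2 * (n - 1) \<le> l * (n - 1)" using l by (intro mult_right_mono) auto
          then have "k + (n - 1) < k + l * (n - 1)" using n by linarith
          then have "fps_nth ((formal_d2 n ^^ l) (ft + u \<mu>)) (k + (n - 1)) = fps_nth ((formal_d2 n ^^ l) (ft + v \<mu>)) (k + (n - 1))"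
            by - (rule formal_d2_funpow_cong[of k], simp add: v_def, assumption)
          then show "smult (2 / fact (2 * l)) (fps_nth ((formal_d2 n ^^ l) (ft + u \<mu>)) (k + (n - 1))) =
              smult (2 / fact (2 * l)) (fps_nth ((formal_d2 n ^^ l) (ft + v \<mu>)) (k + (n - 1)))" by simp
        qed
        finally have "fps_nth (formal_d2 n (ft + u \<mu>)) (k + (n - 1)) + Q1 \<mu> =
            smult (of_real (resonance cs n)) (fps_nth (u \<mu>) k) + Q2 \<mu>"
          unfolding eqn[OF \<mu>] rhs[OF \<mu>] by simp
        moreover have "fps_nth (ft + u \<mu>) k = fps_nth (u \<mu>) k" using ft0[OF k] by simp
        ultimately have "pderiv (pderiv (fps_nth (u \<mu>) k)) - smult (of_real (2 * ?x + 1)) (pderiv (fps_nth (u \<mu>) k))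
           + smult (of_real (?x * (?x + 1))) (fps_nth (u \<mu>) k) + Q1 \<mu> =
            smult (of_real (resonance cs n)) (fps_nth (u \<mu>) k) + Q2 \<mu>"
          unfolding formal_d2_nth_add by (simp only:)
        then show ?thesis
          unfolding of_real_diff smult_diff_left by (simp add: algebra_simps)
      qed
      show ?thesis
      proof (rule bdd_poly_second_order_ode[OF _ Q ode])
        show "degree (fps_nth (u \<mu>) k) \<le> log_deg cs n k" for \<mu>
          unfolding u_def by (rule formal_sum_nth(2)[OF k])
        have a: "complex_of_real (2 * ?x + 1) \<noteq> 0"
        proof -
          have "rexp n \<ge> 0" using n by (simp add: rexp_def)
          then have "?x \<ge> 0" by simp
          then have "2 * ?x + 1 \<noteq> 0" by linarith
          then show ?thesis by (simp only: of_real_eq_0_iff not_False_eq_True)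
        qed
        show "complex_of_real (?x * (?x + 1) - resonance cs n) \<noteq> 0 \<or>
            complex_of_real (2 * ?x + 1) \<noteq> 0 \<and> bounded ((\<lambda>\<mu>. coeff (fps_nth (u \<mu>) k) 0) ` M)"
        proof (cases "?x * (?x + 1) = resonance cs n")
          case True
          \<comment> \<open>A resonance can occur only for odd n, and its index is that of the
            coefficient controlled by \<open>normalized\<close>.\<close>
          have idx: "case cs of Polynomial \<Rightarrow> 2 * k = n + 1 | Trigonometric \<Rightarrow> 2 * k + 1 = n"
            by (rule resonant_index[OF n True])
          have "bounded (c (k - 1) 0 ` M)"
          proof (cases cs)
            case Polynomial
            then have "odd n" "(n + 1) div 2 = k" using idx by (auto, presburger)
            then have "\<forall>\<mu>\<in>M. c (k - 1) 0 \<mu> = 0"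
              using sol Polynomial by (simp add: formal_solution_def)
            then show ?thesis by (auto simp: bounded_iff intro!: exI[of _ 0])
          next
            case Trigonometric
            then have "odd n" "(n + 1) div 2 - 2 = k - 1" using idx by auto
            then show ?thesis using sol Trigonometric by (simp add: formal_solution_def)
          qed
          then have "bounded ((\<lambda>\<mu>. coeff (fps_nth (u \<mu>) k) 0) ` M)"
            unfolding u_def formal_sum_nth(3)[OF k] .
          with a show ?thesis by blast
        next
          case False
          then have "?x * (?x + 1) - resonance cs n \<noteq> 0" by simp
          then show ?thesis by (metis of_real_eq_0_iff)
        qed
      qed
    qed
  qed
  then show ?thesis by (simp add: bdd_fps_def u_def)
qed

subsection \<open>Estimates for the nonlinearity\<close>

text \<open>The bound uses values of the sum on one circle only, so a parameter in the coefficients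
  does not affect its uniformity.\<close>

lemma power_series_Cauchy_bound:
  fixes a :: "nat \<Rightarrow> complex"
  assumes summ: "\<And>y. norm y < R \<Longrightarrow> summable (\<lambda>k. a k * y ^ k)" and \<delta>: "0 < \<delta>" "\<delta> < R"
    and B: "\<And>y. norm y = \<delta> \<Longrightarrow> norm (\<Sum>k. a k * y ^ k) \<le> B"
  shows "norm (a k) \<le> B / \<delta> ^ k"
proof -
  define F where "F = Abs_fps a"
  have "conv_radius a \<ge> ereal R"
  proof (rule conv_radius_geI_ex')
    fix s :: real assume s: "0 < s" "ereal s < ereal R"
    show "summable (\<lambda>n. a n * of_real s ^ n)" using s by (intro summ) simp
  qed
  then have F: "fps_conv_radius F \<ge> ereal R" by (simp add: fps_conv_radius_def F_def)
  have F0: "fps_conv_radius F > 0" using F \<delta> by (metis ereal_less(2) less_le_trans less_trans)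
  have hol: "eval_fps F holomorphic_on ball 0 R"
  proof (rule holomorphic_on_eval_fps)
    show "ball (0 :: complex) R \<subseteq> eball 0 (fps_conv_radius F)"
    proof
      fix x :: complex assume "x \<in> ball 0 R"
      then have "ereal (dist 0 x) < ereal R" by simp
      then have "ereal (dist 0 x) < fps_conv_radius F" using F by (rule less_le_trans)
      then show "x \<in> eball 0 (fps_conv_radius F)" by simp
    qed
  qed
  have bd: "norm ((deriv ^^ k) (eval_fps F) 0) \<le> fact k * B / \<delta> ^ k"
  proof (rule Cauchy_inequality)
    show "eval_fps F holomorphic_on ball 0 \<delta>" using hol \<delta> by (rule_tac holomorphic_on_subset) auto
    show "continuous_on (cball 0 \<delta>) (eval_fps F)"
      using holomorphic_on_imp_continuous_on[OF hol] \<delta> by (rule_tac continuous_on_subset) auto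
    show "norm (eval_fps F x) \<le> B" if "norm (0 - x) = \<delta>" for x
      using B[of x] that by (simp add: eval_fps_def F_def)
  qed (rule \<delta>)
  have "norm (a k) = norm ((deriv ^^ k) (eval_fps F) 0) / fact k"
    using fps_nth_conv_deriv[OF F0, of k] by (simp add: F_def norm_divide)
  also have "\<dots> \<le> (fact k * B / \<delta> ^ k) / fact k" by (rule divide_right_mono[OF bd]) simp
  also have "\<dots> = B / \<delta> ^ k" by simp
  finally show ?thesis .
qed

lemma norm_power_diff_le:
  fixes x y :: complex
  assumes "norm x \<le> t" "norm y \<le> t"
  shows "norm (x ^ k - y ^ k) \<le> real k * t ^ (k - 1) * norm (x - y)"
proof -
  have t: "0 \<le> t" using assms(1) norm_ge_zero order_trans by blast
  have "norm (x ^ k - y ^ k) = norm (x - y) * norm (\<Sum>i<k. y ^ (k - Suc i) * x ^ i)"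
    unfolding power_diff_sumr2 norm_mult by (rule refl)
  also have "norm (x - y) * norm (\<Sum>i<k. y ^ (k - Suc i) * x ^ i) \<le> norm (x - y) * (\<Sum>i<k. t ^ (k - 1))"
  proof (rule mult_left_mono[OF _ norm_ge_zero], rule sum_norm_le)
    fix i assume "i \<in> {..<k}"
    then have e: "k - 1 = (k - Suc i) + i" by auto
    show "norm (y ^ (k - Suc i) * x ^ i) \<le> t ^ (k - 1)"
      unfolding e power_add norm_mult norm_power using assms t by (intro mult_mono power_mono) auto
  qed
  also have "(\<Sum>i<k. t ^ (k - 1)) = real k * t ^ (k - 1)" by simp
  finally show ?thesis by (simp only: mult.commute)
qed

lemma summable_Lipschitz_constant: "summable (\<lambda>j. real (j + m) * (1 / 2) ^ j)"
proof -
  have "summable (\<lambda>j. of_nat (Suc j) * (1 / 2 :: real) ^ j)"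
    by (rule sums_summable[OF geometric_deriv_sums]) simp
  moreover have "summable (\<lambda>j. (real m - 1) * (1 / 2 :: real) ^ j)"
    by (intro summable_mult summable_geometric) simp
  ultimately have "summable (\<lambda>j. of_nat (Suc j) * (1 / 2) ^ j + (real m - 1) * (1 / 2) ^ j)"
    by (rule summable_add)
  then show ?thesis by (simp add: algebra_simps)
qed

text \<open>A zero of order m at the origin makes the derivative of size t^(m-1); the distance to
  the circle of radius \<open>\<delta>\<close> turns the series of derivatives into a fixed
  convergent one.\<close>

lemma power_series_Lipschitz:
  fixes a :: "nat \<Rightarrow> complex"
  assumes S: "(\<lambda>k. a k * x ^ k) sums S" and T: "(\<lambda>k. a k * y ^ k) sums T"
    and a0: "\<And>k. k < m \<Longrightarrow> a k = 0" and a: "\<And>k. norm (a k) \<le> B / \<delta> ^ k"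
    and m: "m \<ge> 1" and \<delta>: "\<delta> > 0" and t: "norm x \<le> t" "norm y \<le> t" "t \<le> \<delta> / 2"
  shows "norm (S - T) \<le> B / \<delta> ^ m * (\<Sum>j. real (j + m) * (1 / 2) ^ j) * t ^ (m - 1) * norm (x - y)"
proof -
  have t0: "0 \<le> t" using t(1) norm_ge_zero order_trans by blast
  have B: "B \<ge> 0" using order_trans[OF norm_ge_zero a[of 0]] by simp
  have "(\<lambda>k. a k * x ^ k - a k * y ^ k) sums (S - T)" by (rule sums_diff[OF S T])
  then have "(\<lambda>k. a k * (x ^ k - y ^ k)) sums (S - T)" by (simp add: right_diff_distrib)
  from sums_split_initial_segment[OF this, of m]
  have sums: "(\<lambda>j. a (j + m) * (x ^ (j + m) - y ^ (j + m))) sums (S - T)" by (simp add: a0)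
  let ?C = "B / \<delta> ^ m * t ^ (m - 1) * norm (x - y)"
  have le: "norm (a (j + m) * (x ^ (j + m) - y ^ (j + m))) \<le> ?C * (real (j + m) * (1 / 2) ^ j)" for j
  proof -
    have "norm (a (j + m) * (x ^ (j + m) - y ^ (j + m))) \<le> B / \<delta> ^ (j + m) * (real (j + m) * t ^ (j + m - 1) * norm (x - y))"
      unfolding norm_mult using B \<delta> t0 by (intro mult_mono a norm_power_diff_le t) auto
    also have "t ^ (j + m - 1) = t ^ j * t ^ (m - 1)" using m by (simp flip: power_add)
    also have "B / \<delta> ^ (j + m) * (real (j + m) * (t ^ j * t ^ (m - 1)) * norm (x - y)) = ?C * (real (j + m) * (t / \<delta>) ^ j)"
      by (simp add: power_add power_divide mult_ac)
    also have "\<dots> \<le> ?C * (real (j + m) * (1 / 2) ^ j)"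
      using B \<delta> t t0 by (intro mult_left_mono power_mono mult_nonneg_nonneg) (auto simp: field_simps)
    finally show ?thesis .
  qed
  have "norm (S - T) \<le> (\<Sum>j. ?C * (real (j + m) * (1 / 2) ^ j))"
    unfolding sums_unique[OF sums]
    by (intro norm_suminf_le le summable_mult summable_Lipschitz_constant)
  also have "\<dots> = ?C * (\<Sum>j. real (j + m) * (1 / 2) ^ j)"
    by (rule suminf_mult[OF summable_Lipschitz_constant])
  finally show ?thesis by (simp add: mult_ac)
qed

lemma norm_exp_diff_le:
  assumes "norm a \<le> 1" "norm b \<le> 1"
  shows "norm (exp a - exp b :: complex) \<le> 3 * norm (a - b)"
proof (rule field_differentiable_bound[of "cball 0 1" exp exp])
  show "(exp has_field_derivative exp z) (at z within cball 0 1)" for z :: complex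
    by (rule has_field_derivative_at_within[OF DERIV_exp])
  show "norm (exp z) \<le> 3" if "z \<in> cball 0 1" for z :: complex
  proof -
    have "norm (exp z) \<le> exp (norm z)" by (rule norm_exp)
    also have "\<dots> \<le> exp 1" using that by simp
    finally show ?thesis using exp_le by linarith
  qed
qed (use assms in auto)

fun leading_exponent :: "inner_case \<Rightarrow> nat \<Rightarrow> nat" where
  "leading_exponent Polynomial n = n"
| "leading_exponent Trigonometric n = n - 1"

text \<open>In both cases the right-hand side is a single power series in \<open>inner_arg\<close>,
  with a term -y^m at the leading exponent m, where \<open>G\<close> has no term of its own.\<close>

fun rhs_coeff :: "inner_case \<Rightarrow> nat \<Rightarrow> (nat \<Rightarrow> complex \<Rightarrow> complex) \<Rightarrow> nat \<Rightarrow> complex \<Rightarrow> complex" where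
  "rhs_coeff cs n Gk k \<mu> = (if k = leading_exponent cs n then -1 else Gk k \<mu>)"

lemma inner_expansion_sums:
  assumes "inner_expansion cs n \<rr> M G Gk" "\<mu> \<in> M" "norm (inner_arg cs \<phi>) < \<rr>"
  shows "(\<lambda>k. Gk k \<mu> * inner_arg cs \<phi> ^ k) sums G (inner_arg cs \<phi>, \<mu>)"
  using assms by (cases cs) (simp_all add: exp_of_nat_mult)

lemma inner_expansion_coeff_0:
  assumes "inner_expansion cs n \<rr> M G Gk" "\<mu> \<in> M" "k \<le> leading_exponent cs n" "n \<ge> 2"
  shows "Gk k \<mu> = 0"
  using assms by (cases cs) simp_all

lemma inner_rhs_sums:
  assumes "inner_expansion cs n \<rr> M G Gk" "\<mu> \<in> M" "norm (inner_arg cs \<phi>) < \<rr>" "n \<ge> 2"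
  shows "(\<lambda>k. rhs_coeff cs n Gk k \<mu> * inner_arg cs \<phi> ^ k) sums inner_rhs cs n G \<phi> \<mu>"
proof -
  let ?m = "leading_exponent cs n"
  have 1: "(\<lambda>k. if k = ?m then - (inner_arg cs \<phi> ^ k) else 0) sums (- (inner_arg cs \<phi> ^ ?m))"
    by (rule sums_single)
  have "(\<lambda>k. (if k = ?m then - (inner_arg cs \<phi> ^ k) else 0) + Gk k \<mu> * inner_arg cs \<phi> ^ k) sums
      (- (inner_arg cs \<phi> ^ ?m) + G (inner_arg cs \<phi>, \<mu>))"
    by (rule sums_add[OF 1 inner_expansion_sums[OF assms(1-3)]])
  moreover have "(\<lambda>k. (if k = ?m then - (inner_arg cs \<phi> ^ k) else 0) + Gk k \<mu> * inner_arg cs \<phi> ^ k) =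
      (\<lambda>k. rhs_coeff cs n Gk k \<mu> * inner_arg cs \<phi> ^ k)"
    using inner_expansion_coeff_0[OF assms(1,2) order_refl assms(4)] by auto
  moreover have "- (inner_arg cs \<phi> ^ ?m) + G (inner_arg cs \<phi>, \<mu>) = inner_rhs cs n G \<phi> \<mu>"
    by (cases cs) (simp_all add: exp_of_nat_mult)
  ultimately show ?thesis by (simp only:)
qed

text \<open>Cauchy's inequality on a circle where \<open>G\<close> is bounded uniformly in
  \<open>\<mu>\<close>. In the trigonometric case the expansion is available only at values of the
  exponential, that is, for y different from 0; at 0 summability is trivial.\<close>

lemma inner_expansion_coeff_bound:
  assumes "inner_expansion cs n \<rr> M G Gk" "\<rr> > 0" "n \<ge> 2"
    and "\<exists>\<delta>>0. bounded (G ` (ball 0 \<delta> \<times> M))"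
  shows "\<exists>\<delta> B. 0 < \<delta> \<and> \<delta> < \<rr> \<and> (\<forall>k. \<forall>\<mu>\<in>M. norm (Gk k \<mu>) \<le> B / \<delta> ^ k)"
proof -
  obtain \<delta>0 B where \<delta>0: "\<delta>0 > 0" "\<And>y \<mu>. norm y < \<delta>0 \<Longrightarrow> \<mu> \<in> M \<Longrightarrow> norm (G (y, \<mu>)) \<le> B"
  proof -
    obtain \<delta>0 where "\<delta>0 > 0" "bounded (G ` (ball 0 \<delta>0 \<times> M))" using assms(4) by blast
    moreover from this(2) obtain B where "\<forall>y\<in>G ` (ball 0 \<delta>0 \<times> M). norm y \<le> B" unfolding bounded_iff by blast
    ultimately show ?thesis using that[of \<delta>0 B] by simp
  qed
  define \<delta> where "\<delta> = min \<delta>0 \<rr> / 2"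
  have \<delta>: "0 < \<delta>" "\<delta> < \<delta>0" "\<delta> < \<rr>" using \<delta>0(1) assms(2) by (auto simp: \<delta>_def)
  have "norm (Gk k \<mu>) \<le> B / \<delta> ^ k" if \<mu>: "\<mu> \<in> M" for k \<mu>
  proof (rule power_series_Cauchy_bound[OF _ \<delta>(1,3)])
    have sums: "(\<lambda>k. Gk k \<mu> * y ^ k) sums G (y, \<mu>)" if "norm y < \<rr>" "y \<noteq> 0" for y
    proof -
      have "inner_arg cs (case cs of Polynomial \<Rightarrow> y | Trigonometric \<Rightarrow> Ln y) = y"
        using that(2) by (cases cs) simp_all
      then show ?thesis
        using inner_expansion_sums[OF assms(1) \<mu>, of "case cs of Polynomial \<Rightarrow> y | Trigonometric \<Rightarrow> Ln y"] that(1)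
        by simp
    qed
    show "summable (\<lambda>k. Gk k \<mu> * y ^ k)" if "norm y < \<rr>" for y
      using sums[OF that] by (cases "y = 0") (simp_all add: sums_iff)
    show "norm (\<Sum>k. Gk k \<mu> * y ^ k) \<le> B" if "norm y = \<delta>" for y
    proof -
      have "y \<noteq> 0" using that \<delta> by auto
      then show ?thesis using sums[of y] \<delta>0(2)[OF _ \<mu>, of y] that \<delta> by (simp add: sums_iff)
    qed
  qed
  with \<delta> show ?thesis by blast
qed

lemma formal_rhs_cutoff_nth:
  assumes u0: "fps_nth u 0 = 0" and "j < k" "n \<ge> 2"
  shows "fps_nth (formal_rhs cs n l0 g u) j = fps_nth (formal_rhs cs n l0 g (fps_cutoff k u)) j"
proof -
  have k: "k \<ge> 1" using assms by simp
  show ?thesis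
  proof (cases cs)
    case Polynomial
    show ?thesis unfolding Polynomial formal_rhs.simps fps_add_nth fps_neg_nth
      using fps_compose_cutoff_nth(1)[OF u0 k \<open>j < k\<close>] fps_power_cutoff_nth(1)[OF u0 k, of j n] assms by simp
  next
    case Trigonometric
    define v where "v = fps_cutoff k u"
    define A where "A = (Abs_fps (\<lambda>k. [: 1 / fact k :]) oo u :: complex poly fps)"
    define B where "B = (Abs_fps (\<lambda>k. [: 1 / fact k :]) oo v :: complex poly fps)"
    have AB: "A - B = fps_X ^ k * fps_shift k (A - B)"
    proof (rule fps_ext)
      show "fps_nth (A - B) j = fps_nth (fps_X ^ k * fps_shift k (A - B)) j" for j
        using fps_compose_cutoff_nth(1)[OF u0 k, of j] by (auto simp: fps_X_power_mult_nth A_def B_def v_def)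
    qed
    have A0: "fps_nth A 0 = 1" by (simp add: A_def fps_compose_nth one_pCons)
    have e: "fps_nth (formal_exp_phi n l0 u ^ i) j = fps_nth (formal_exp_phi n l0 v ^ i) j" for i
      unfolding formal_exp_phi_power_nth A_def[symmetric] B_def[symmetric]
      using fps_power_perturb_nth(1)[OF AB A0 k, of "j - i" i] assms(2) by simp
    show ?thesis
      unfolding Trigonometric formal_rhs.simps fps_add_nth fps_neg_nth fps_compose_nth v_def[symmetric] e ..
  qed
qed

subsection \<open>The inner equation\<close>

lemma bdd_fps_cutoff: "bdd_fps M f \<Longrightarrow> bdd_fps M (\<lambda>\<mu>. fps_cutoff k (f \<mu>))"
  unfolding bdd_fps_def
proof
  fix j assume "\<forall>k. bdd_poly M (\<lambda>\<mu>. fps_nth (f \<mu>) k)"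
  then show "bdd_poly M (\<lambda>\<mu>. fps_nth (fps_cutoff k (f \<mu>)) j)" by (cases "j < k") simp_all
qed

lemma open_Dom_s: "open (Dom_s \<gamma> \<rho>)"
  unfolding Dom_s_def by (intro open_Collect_less continuous_intros)

locale inner_problem = inner_asymptotics n \<gamma> M lg \<kappa>
  for n \<gamma> M lg \<kappa> +
  fixes cs :: inner_case and c0 l0 :: complex and \<rr> \<delta> B :: real
    and G :: "complex \<times> complex \<Rightarrow> complex" and Gk :: "nat \<Rightarrow> complex \<Rightarrow> complex"
    and c :: "nat \<Rightarrow> nat \<Rightarrow> complex \<Rightarrow> complex"
  assumes M_open: "open M"
    and c0_power: "c0 ^ (n - 1) = of_real (- rexp n * (rexp n + 1))"
    and G_hol: "holomorphic2_on G (ball 0 \<rr> \<times> M)"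
    and expansion: "inner_expansion cs n \<rr> M G Gk"
    and exp_l0: "exp l0 = of_real (- 2 / (real n - 1))"
    and formal: "formal_solution cs n c0 l0 M Gk c"
    and \<delta>: "0 < \<delta>" "\<delta> < \<rr>"
    and Gk_bound: "\<mu> \<in> M \<Longrightarrow> norm (Gk k \<mu>) \<le> B / \<delta> ^ k"
begin

abbreviation u :: "complex \<Rightarrow> complex poly fps" where "u \<equiv> formal_sum cs n c"
abbreviation ft :: "complex poly fps" where "ft \<equiv> formal_tilde_phi0 cs n l0"
abbreviation cut :: "nat \<Rightarrow> complex \<Rightarrow> complex poly fps" where "cut N \<mu> \<equiv> fps_cutoff (Suc N) (u \<mu>)"

definition phi :: "nat \<Rightarrow> complex \<times> complex \<Rightarrow> complex" where
  "phi N = ev N (\<lambda>\<mu>. ft + u \<mu>)"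

definition argN :: "nat \<Rightarrow> complex \<times> complex \<Rightarrow> complex" where
  "argN N x = inner_arg cs (phi N x)"

text \<open>In the trigonometric case the approximate solution starts with log z at order 0, where a
  power series cannot be substituted. Its exponential starts at order 1, and \<open>G\<close> is
  composed with that.\<close>

definition formal_arg :: "nat \<Rightarrow> complex \<Rightarrow> complex poly fps" where
  "formal_arg N \<mu> = (case cs of Polynomial \<Rightarrow> cut N \<mu> | Trigonometric \<Rightarrow> formal_exp_phi n l0 (cut N \<mu>))"

definition lead :: complex where
  "lead = (case cs of Polynomial \<Rightarrow> c0 | Trigonometric \<Rightarrow> exp (l0 / of_nat (n - 1)))"

lemma bounded_Gk: "bounded (Gk k ` M)"
  using Gk_bound unfolding bounded_iff by blast

lemma bdd_u: "bdd_fps M u"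
  by (rule bdd_formal_sum[OF n_ge c0_power exp_l0 formal expansion bounded_Gk])

lemma ft_nth: "k \<ge> 1 \<Longrightarrow> fps_nth ft k = 0"
  by (cases cs) simp_all

lemma poly_ft_0: "poly (fps_nth ft 0) (lg z) = tilde_phi0 cs n l0 lg z"
  by (cases cs) (simp_all add: diff_divide_distrib)

lemma ev_ft: "ev N (\<lambda>_. ft) x = tilde_phi0 cs n l0 lg (fst x)"
proof -
  have "ev N (\<lambda>_. ft) x = (\<Sum>k\<in>{0}. w (fst x) ^ k * poly (fps_nth ft k) (lg (fst x)))"
    unfolding ev_def by (rule sum.mono_neutral_right) (auto simp: ft_nth)
  then show ?thesis by (simp add: poly_ft_0)
qed

lemma phi_eq: "phi N x = tilde_phi0 cs n l0 lg (fst x) + ev N u x"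
  unfolding phi_def ev_add ev_ft ..

lemma ev_cut: "k \<le> N \<Longrightarrow> ev k (cut N) x = ev k u x"
  unfolding ev_def by (intro sum.cong) auto

lemma asy_u: "asy (ev N u) (cut N)"
proof -
  have "asy (ev N (cut N)) (cut N)"
    by (intro asy_finite bdd_fps_cutoff bdd_u) simp
  moreover have "ev N (cut N) = ev N u" by (rule ext) (rule ev_cut[OF order_refl])
  ultimately show ?thesis by simp
qed

lemma phi_eq_ev_cut: "phi N x = ev N (\<lambda>\<mu>. ft + cut N \<mu>) x"
  unfolding phi_eq ev_add ev_ft ev_cut[OF order_refl] ..

lemma asy_exp_u: "asy (\<lambda>x. exp (ev N u x)) (\<lambda>\<mu>. Abs_fps (\<lambda>k. [: 1 / fact k :]) oo cut N \<mu>)"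
proof (rule asy_compose[OF asy_u, where g = "\<lambda>k _. 1 / fact k" and \<delta> = 1 and B = 1])
  show "fps_nth (cut N \<mu>) 0 = 0" for \<mu> by (simp add: formal_sum_nth)
  show "norm (1 / fact k :: complex) \<le> 1 / 1 ^ k" for k
    using fact_ge_1[of k, where 'a = real] by (simp add: norm_divide)
  have "(\<lambda>k. 1 / fact k * y ^ k) sums exp y" for y :: complex
    using exp_converges[of y] by (simp add: scaleR_conv_of_real divide_inverse)
  then show "\<forall>\<^sub>F x in Fl. (\<lambda>k. 1 / fact k * ev N u x ^ k) sums exp (ev N u x)" by simp
qed simp

lemma exp_tilde:
  assumes "cs = Trigonometric"
  shows "exp (tilde_phi0 cs n l0 lg z) = exp (l0 / of_nat (n - 1)) * w z"
proof -
  have "complex_of_real r = 2 / of_nat (n - 1)" using n_ge by (simp add: rexp_def of_nat_diff)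
  then have "tilde_phi0 cs n l0 lg z = l0 / of_nat (n - 1) + - (of_real r * lg z)"
    by (simp add: assms diff_divide_distrib)
  then show ?thesis unfolding w_def by (simp only: exp_add)
qed

lemma asy_argN: "asy (argN N) (formal_arg N)"
proof (cases cs)
  case Polynomial
  have "argN N = ev N u" unfolding argN_def phi_eq by (rule ext) (simp add: Polynomial)
  moreover have "formal_arg N = cut N" unfolding formal_arg_def by (rule ext) (simp add: Polynomial)
  ultimately show ?thesis using asy_u[of N] by (simp only:)
next
  case Trigonometric
  have "bounded ((\<lambda>_. exp (l0 / of_nat (n - 1))) ` M)" by (simp add: image_constant_conv)
  note * = asy_mult[OF asy_mult[OF asy_const_fun[OF this] asy_w] asy_exp_u[of N]]
  have "formal_arg N = (\<lambda>\<mu>. fps_const [:exp (l0 / of_nat (n - 1)):] * fps_X * (Abs_fps (\<lambda>k. [: 1 / fact k :]) oo cut N \<mu>))"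
    unfolding formal_arg_def formal_exp_phi_def by (rule ext) (simp only: Trigonometric inner_case.case)
  moreover have "argN N = (\<lambda>x. (exp (l0 / of_nat (n - 1)) * w (fst x)) * exp (ev N u x))"
    unfolding argN_def phi_eq exp_tilde[OF Trigonometric, symmetric]
    by (rule ext) (simp only: Trigonometric inner_arg.simps exp_add)
  ultimately show ?thesis using * by (simp only:)
qed

lemma formal_arg_0: "fps_nth (formal_arg N \<mu>) 0 = 0"
  unfolding formal_arg_def
  using formal_exp_phi_power_nth[of n l0 "cut N \<mu>" 1 0]
  by (cases cs) (simp_all add: formal_sum_nth)

lemma formal_arg_1:
  assumes "\<mu> \<in> M" "N \<ge> 1"
  shows "fps_nth (formal_arg N \<mu>) 1 = [:lead:]"
proof (cases cs)
  case Polynomial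
  have "c 0 0 \<mu> = c0" using formal Polynomial assms(1) by (simp add: formal_solution_def)
  then show ?thesis unfolding formal_arg_def lead_def using assms(2) Polynomial by (simp add: formal_sum_def monom_0)
next
  case Trigonometric
  then show ?thesis unfolding formal_arg_def lead_def using formal_exp_phi_power_nth[of n l0 "cut N \<mu>" 1 1]
    by (simp add: fps_compose_nth)
qed

lemma eventually_norm_argN_le: "e > 0 \<Longrightarrow> \<forall>\<^sub>F x in Fl. norm (argN N x) \<le> e"
  by (rule eventually_norm_le[OF asy_power2_Ow[OF asy_argN formal_arg_0]])

text \<open>The expansion alone would lose a power of \<open>w\<close> to logarithms. After removal
  of the leading term the square vanishes through order 3, so the difference is
  \<open>O(|w|^(3/2))\<close>, eventually below |w|. The constant depends on \<open>lead\<close>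
  only and not on N, so the Lipschitz constant is known before N is chosen.\<close>

lemma eventually_norm_argN_le_w:
  assumes "N \<ge> 1"
  shows "\<forall>\<^sub>F x in Fl. norm (argN N x) \<le> (norm lead + 1) * norm (w (fst x))"
proof -
  have "asy (\<lambda>x. argN N x - lead * w (fst x)) (\<lambda>\<mu>. formal_arg N \<mu> - fps_const [:lead:] * fps_X)"
    using asy_const_fun[of "\<lambda>_. lead"] by (intro asy_diff asy_argN asy_mult asy_w) (simp add: image_constant_conv)
  then have "(\<lambda>x. (argN N x - lead * w (fst x)) ^ 2) \<in> Ow 3"
  proof (rule asy_imp_Ow[OF asy_power])
    fix \<mu> k assume \<mu>: "\<mu> \<in> M" and k: "k \<le> (3 :: nat)"
    define h where "h = formal_arg N \<mu> - fps_const [:lead:] * fps_X"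
    have h: "fps_nth h i = 0" if "i < 2" for i
      using that formal_arg_0[of N \<mu>] formal_arg_1[OF \<mu> assms] by (cases i) (auto simp: h_def)
    have "fps_nth h i * fps_nth h (k - i) = 0" for i
      using h[of i] h[of "k - i"] k by (cases "i < 2") auto
    then show "fps_nth ((formal_arg N \<mu> - fps_const [:lead:] * fps_X) ^ 2) k = 0"
      unfolding h_def[symmetric] power2_eq_square fps_mult_nth by (simp only: sum.neutral_const)
  qed
  then obtain C where C: "C > 0" "\<forall>\<^sub>F x in Fl. norm ((argN N x - lead * w (fst x)) ^ 2) \<le> C * norm (w (fst x) ^ 3)"
    by (rule landau_o.bigE)
  have "\<forall>\<^sub>F x in Fl. dist (w (fst x)) 0 < 1 / C" using tendsto_w by (rule tendstoD) (use C in simp)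
  with C(2) show ?thesis
  proof eventually_elim
    case (elim x)
    have "C * norm (w (fst x)) \<le> 1" using elim(2) C(1) by (simp add: field_simps)
    then have "C * norm (w (fst x)) * norm (w (fst x)) ^ 2 \<le> 1 * norm (w (fst x)) ^ 2"
      by (rule mult_right_mono) simp
    moreover have "C * norm (w (fst x)) * norm (w (fst x)) ^ 2 = C * norm (w (fst x)) ^ 3"
      by (simp add: power2_eq_square power3_eq_cube)
    moreover have "norm (argN N x - lead * w (fst x)) ^ 2 \<le> C * norm (w (fst x)) ^ 3"
      using elim(1) by (simp only: norm_power)
    ultimately have "norm (argN N x - lead * w (fst x)) ^ 2 \<le> norm (w (fst x)) ^ 2"
      by linarith
    then have "norm (argN N x - lead * w (fst x)) \<le> norm (w (fst x))"
      by (rule power2_le_imp_le) simp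
    then show ?case
      using norm_triangle_sub[of "argN N x" "lead * w (fst x)"] by (simp add: norm_mult algebra_simps)
  qed
qed

lemma inner_rhs_eq: "inner_rhs cs n G \<phi> \<mu> = - (inner_arg cs \<phi> ^ leading_exponent cs n) + G (inner_arg cs \<phi>, \<mu>)"
  by (cases cs) (simp_all add: exp_of_nat_mult)

lemma formal_rhs_eq:
  "formal_rhs cs n l0 g (cut N \<mu>) = - (formal_arg N \<mu> ^ leading_exponent cs n) + (Abs_fps (\<lambda>k. [: g k :]) oo formal_arg N \<mu>)"
  unfolding formal_arg_def by (cases cs) simp_all

lemma asy_rhs: "asy (\<lambda>x. inner_rhs cs n G (phi N x) (snd x)) (\<lambda>\<mu>. formal_rhs cs n l0 (\<lambda>k. Gk k \<mu>) (cut N \<mu>))"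
  unfolding inner_rhs_eq formal_rhs_eq argN_def[symmetric]
proof (intro asy_add asy_uminus asy_power asy_argN)
  show "asy (\<lambda>x. G (argN N x, snd x)) (\<lambda>\<mu>. Abs_fps (\<lambda>k. [:Gk k \<mu>:]) oo formal_arg N \<mu>)"
  proof (rule asy_compose[OF asy_argN formal_arg_0 \<delta>(1) Gk_bound])
    show "\<forall>\<^sub>F x in Fl. (\<lambda>k. Gk k (snd x) * argN N x ^ k) sums G (argN N x, snd x)"
      using eventually_norm_argN_le[OF \<delta>(1), of N] eventually_mem[of 1]
    proof eventually_elim
      case (elim x)
      then show ?case
        unfolding argN_def using \<delta>(2) by (intro inner_expansion_sums[OF expansion]) auto
    qed
  qed
qed

text \<open>Orders up to N on both sides depend only on coefficients up to N, where the truncation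
  agrees with the formal solution.\<close>

lemma residual_Ow:
  "(\<lambda>x. Delta2 (\<lambda>z. phi N (z, snd x)) (fst x) - inner_rhs cs n G (phi N x) (snd x)) \<in> Ow N"
proof -
  have D: "asy (\<lambda>x. Delta2 (\<lambda>z. phi N (z, snd x)) (fst x)) (\<lambda>\<mu>. formal_Delta2 n (ft + cut N \<mu>))"
    unfolding phi_eq_ev_cut
    by (intro asy_Delta2 bdd_fps_add bdd_fps_const bdd_fps_cutoff bdd_u) (simp add: ft_nth)
  show ?thesis
  proof (rule asy_imp_Ow[OF asy_diff[OF D asy_rhs]])
    fix \<mu> k assume \<mu>: "\<mu> \<in> M" and k: "k \<le> N"
    have "fps_nth (formal_Delta2 n (ft + cut N \<mu>)) k = fps_nth (formal_Delta2 n (ft + u \<mu>)) k"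
      unfolding formal_Delta2_def fps_nth_Abs_fps
    proof (rule sum.cong[OF refl])
      fix l
      have "fps_nth ((formal_d2 n ^^ l) (ft + cut N \<mu>)) k = fps_nth ((formal_d2 n ^^ l) (ft + u \<mu>)) k"
        by (rule formal_d2_funpow_cong[of "Suc N"]) (use k in auto)
      then show "smult (2 / fact (2 * l)) (fps_nth ((formal_d2 n ^^ l) (ft + cut N \<mu>)) k) =
          smult (2 / fact (2 * l)) (fps_nth ((formal_d2 n ^^ l) (ft + u \<mu>)) k)" by simp
    qed
    also have "formal_Delta2 n (ft + u \<mu>) = formal_rhs cs n l0 (\<lambda>k. Gk k \<mu>) (u \<mu>)"
      using formal \<mu> by (simp add: formal_solution_def)
    also have "fps_nth \<dots> k = fps_nth (formal_rhs cs n l0 (\<lambda>k. Gk k \<mu>) (cut N \<mu>)) k"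
      by (rule formal_rhs_cutoff_nth) (use k n_ge in \<open>simp_all add: formal_sum_nth\<close>)
    finally show "fps_nth (formal_Delta2 n (ft + cut N \<mu>) - formal_rhs cs n l0 (\<lambda>k. Gk k \<mu>) (cut N \<mu>)) k = 0"
      by simp
  qed
qed

lemma phi_holomorphic2:
  assumes "\<rho> > 0"
  shows "holomorphic2_on (phi N) (Dom_s \<gamma> \<rho> \<times> M)"
proof -
  have lg: "lg holomorphic_on Dom_s \<gamma> \<rho>"
    unfolding holomorphic_on_open[OF open_Dom_s]
    using lg_has_derivative Dom_s_not_nonpos assms by blast
  have w: "w holomorphic_on Dom_s \<gamma> \<rho>"
    unfolding w_def[abs_def] by (intro holomorphic_intros lg)
  have tl: "tilde_phi0 cs n l0 lg holomorphic_on Dom_s \<gamma> \<rho>"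
  proof (cases cs)
    case Polynomial
    then have "tilde_phi0 cs n l0 lg = (\<lambda>_. 0)" by (simp add: fun_eq_iff)
    then show ?thesis by simp
  next
    case Trigonometric
    then have "tilde_phi0 cs n l0 lg = (\<lambda>z. (l0 - 2 * lg z) / of_nat (n - 1))" by (simp add: fun_eq_iff)
    then show ?thesis using lg n_ge by (auto intro!: holomorphic_intros)
  qed
  have "holomorphic2_on (\<lambda>x. tilde_phi0 cs n l0 lg (fst x) +
     (\<Sum>k\<le>N. w (fst x) ^ k * (if k = 0 then 0 else \<Sum>j\<le>log_deg cs n k. c (k - 1) j (snd x) * lg (fst x) ^ j))) (Dom_s \<gamma> \<rho> \<times> M)"
  proof (intro holomorphic2_on_add holomorphic2_on_sum holomorphic2_on_mult holomorphic2_on_power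
      holomorphic2_on_of_fst tl w open_Dom_s)
    fix k
    show "holomorphic2_on (\<lambda>x. if k = 0 then 0 else \<Sum>j\<le>log_deg cs n k. c (k - 1) j (snd x) * lg (fst x) ^ j) (Dom_s \<gamma> \<rho> \<times> M)"
    proof (cases "k = 0")
      case False
      have "holomorphic2_on (\<lambda>x. c (k - 1) j (snd x)) (Dom_s \<gamma> \<rho> \<times> M)" if "j \<in> {..log_deg cs n k}" for j
      proof (rule holomorphic2_on_of_snd[OF _ M_open])
        have "k - 1 + 1 = k" using False by simp
        then show "c (k - 1) j holomorphic_on M"
          using formal that unfolding formal_solution_def by (metis atMost_iff)
      qed
      then have "holomorphic2_on (\<lambda>x. \<Sum>j\<le>log_deg cs n k. c (k - 1) j (snd x) * lg (fst x) ^ j) (Dom_s \<gamma> \<rho> \<times> M)"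
        by (intro holomorphic2_on_sum holomorphic2_on_mult holomorphic2_on_power holomorphic2_on_of_fst[OF lg open_Dom_s])
      with False show ?thesis by simp
    qed (simp add: holomorphic2_on_const)
  qed
  moreover have "phi N x = tilde_phi0 cs n l0 lg (fst x) +
     (\<Sum>k\<le>N. w (fst x) ^ k * (if k = 0 then 0 else \<Sum>j\<le>log_deg cs n k. c (k - 1) j (snd x) * lg (fst x) ^ j))" for x
    unfolding phi_eq ev_def formal_sum_def by (simp add: poly_sum poly_monom if_distrib[of "\<lambda>p. poly p _"] cong: if_cong)
  then have "phi N = (\<lambda>x. tilde_phi0 cs n l0 lg (fst x) +
     (\<Sum>k\<le>N. w (fst x) ^ k * (if k = 0 then 0 else \<Sum>j\<le>log_deg cs n k. c (k - 1) j (snd x) * lg (fst x) ^ j)))" ..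
  ultimately show ?thesis by (simp only:)
qed

lemma phi0_eq: "phi0 cs n l0 c lg z \<mu> = phi n (z, \<mu>)"
proof -
  have w: "branch_power lg z (- (real k * r)) = w z ^ k" for k
    unfolding branch_power_def w_def by (simp add: algebra_simps flip: exp_of_nat_mult)
  have "ev n u (z, \<mu>) = (\<Sum>k\<in>{1..n}. w z ^ k * poly (fps_nth (u \<mu>) k) (lg z))"
    unfolding ev_def fst_conv snd_conv by (rule sum.mono_neutral_right) (auto simp: formal_sum_nth Suc_le_eq)
  also have "\<dots> = (\<Sum>k=1..n. branch_power lg z (- (real k * r)) * (\<Sum>j\<le>log_deg cs n k. c (k - 1) j \<mu> * lg z ^ j))"
    unfolding w by (intro sum.cong) (auto simp: formal_sum_def poly_sum poly_monom)
  finally show ?thesis unfolding phi0_def phi_eq by simp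
qed

end

section \<open>Lipschitz estimates and existence of the solution on \<open>Dom_s\<close>\<close>

context inner_problem
begin

definition Lip :: real where
  "Lip = (let m = leading_exponent cs n in (B + \<delta> ^ m) / \<delta> ^ m * (\<Sum>j. real (j + m) * (1 / 2) ^ j))"

lemma B_nonneg: "\<mu> \<in> M \<Longrightarrow> B \<ge> 0"
  using order_trans[OF norm_ge_zero Gk_bound[of \<mu> 0]] by simp

text \<open>The second summand of the numerator accounts for the coefficient -1 at the leading
  exponent.\<close>

lemma rhs_coeff_bound:
  assumes "\<mu> \<in> M"
  shows "norm (rhs_coeff cs n Gk k \<mu>) \<le> (B + \<delta> ^ leading_exponent cs n) / \<delta> ^ k"
proof (cases "k = leading_exponent cs n")
  case True
  have "0 \<le> B / \<delta> ^ k" using B_nonneg[OF assms] \<delta> by simp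
  then show ?thesis using True \<delta> by (simp add: add_divide_distrib)
next
  case False
  have "norm (Gk k \<mu>) \<le> B / \<delta> ^ k" by (rule Gk_bound[OF assms])
  also have "\<dots> \<le> (B + \<delta> ^ leading_exponent cs n) / \<delta> ^ k" using \<delta> by (intro divide_right_mono) auto
  finally show ?thesis using False by simp
qed

text \<open>The factor 3 bounds exp(1) in the trigonometric case and covers the sum of two terms in
  the polynomial one.\<close>

lemma inner_arg_perturbed:
  assumes s: "norm (inner_arg cs \<phi>) \<le> s" and a: "norm a \<le> 1" and as: "norm a \<le> s"
  shows "norm (inner_arg cs (\<phi> + a)) \<le> 3 * s"
proof -
  have s0: "s \<ge> 0" using s norm_ge_zero order_trans by blast
  show ?thesis
  proof (cases cs)
    case Polynomial
    then show ?thesis using norm_triangle_ineq[of \<phi> a] s as s0 by simp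
  next
    case Trigonometric
    have "norm (exp a) \<le> exp (norm a)" by (rule norm_exp)
    also have "\<dots> \<le> exp 1" using a by simp
    finally have "norm (exp a) \<le> 3" using exp_le by linarith
    then have "norm (exp \<phi>) * norm (exp a) \<le> s * 3" using s s0 Trigonometric by (intro mult_mono) auto
    then show ?thesis by (simp add: Trigonometric exp_add norm_mult)
  qed
qed

text \<open>Both cases lead to the exponent n - 1. For the polynomial equation it is the leading
  exponent minus one; for the trigonometric one the series gives n - 2, and differentiating the
  exponential supplies the missing factor. With |w|^(n-1) = |z|^-2 this is the size of the
  linearisation.\<close>

lemma rhs_Lipschitz:
  assumes \<mu>: "\<mu> \<in> M" and s: "norm (inner_arg cs \<phi>) \<le> s" "3 * s \<le> \<delta> / 2"
    and a: "norm a \<le> 1" "norm a \<le> s" and b: "norm b \<le> 1" "norm b \<le> s"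
  shows "norm (inner_rhs cs n G (\<phi> + a) \<mu> - inner_rhs cs n G (\<phi> + b) \<mu>) \<le> Lip * (3 * s) ^ (n - 1) * norm (a - b)"
proof -
  define m where "m = leading_exponent cs n"
  define L where "L = (B + \<delta> ^ m) / \<delta> ^ m * (\<Sum>j. real (j + m) * (1 / 2) ^ j)"
  have Lip: "Lip = L" by (simp add: Lip_def L_def m_def Let_def)
  have L0: "L \<ge> 0" unfolding L_def
    using B_nonneg[OF \<mu>] \<delta> by (intro mult_nonneg_nonneg suminf_nonneg summable_Lipschitz_constant) auto
  have s0: "s \<ge> 0" using s(1) norm_ge_zero order_trans by blast
  define x where "x = inner_arg cs (\<phi> + a)"
  define y where "y = inner_arg cs (\<phi> + b)"
  have x: "norm x \<le> 3 * s" unfolding x_def by (rule inner_arg_perturbed[OF s(1) a])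
  have y: "norm y \<le> 3 * s" unfolding y_def by (rule inner_arg_perturbed[OF s(1) b])
  have "3 * s < \<rr>" using s(2) \<delta> by linarith
  then have xr: "norm (inner_arg cs (\<phi> + a)) < \<rr>" and yr: "norm (inner_arg cs (\<phi> + b)) < \<rr>"
    using x y by (auto simp: x_def y_def)
  have m1: "m \<ge> 1" using n_ge by (cases cs) (auto simp: m_def)
  have "norm (inner_rhs cs n G (\<phi> + a) \<mu> - inner_rhs cs n G (\<phi> + b) \<mu>) \<le> L * (3 * s) ^ (m - 1) * norm (x - y)"
    unfolding L_def
  proof (rule power_series_Lipschitz[OF _ _ _ _ m1 \<delta>(1) x y s(2)])
    show "(\<lambda>k. rhs_coeff cs n Gk k \<mu> * x ^ k) sums inner_rhs cs n G (\<phi> + a) \<mu>"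
      unfolding x_def by (rule inner_rhs_sums[OF expansion \<mu> xr n_ge])
    show "(\<lambda>k. rhs_coeff cs n Gk k \<mu> * y ^ k) sums inner_rhs cs n G (\<phi> + b) \<mu>"
      unfolding y_def by (rule inner_rhs_sums[OF expansion \<mu> yr n_ge])
    show "rhs_coeff cs n Gk k \<mu> = 0" if "k < m" for k
      using inner_expansion_coeff_0[OF expansion \<mu> _ n_ge, of k] that by (simp add: m_def)
    show "norm (rhs_coeff cs n Gk k \<mu>) \<le> (B + \<delta> ^ m) / \<delta> ^ k" for k
      unfolding m_def by (rule rhs_coeff_bound[OF \<mu>])
  qed
  also have "\<dots> \<le> L * (3 * s) ^ (n - 1) * norm (a - b)"
  proof (cases cs)
    case Polynomial
    then show ?thesis by (simp add: m_def x_def y_def)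
  next
    case Trigonometric
    have "norm (x - y) = norm (exp \<phi>) * norm (exp a - exp b)"
      unfolding norm_mult[symmetric] by (simp add: x_def y_def Trigonometric exp_add right_diff_distrib)
    also have "\<dots> \<le> s * (3 * norm (a - b))"
      using s(1) s0 norm_exp_diff_le[OF a(1) b(1)] Trigonometric by (intro mult_mono) auto
    finally have "(3 * s) ^ (m - 1) * norm (x - y) \<le> (3 * s) ^ (m - 1) * (s * (3 * norm (a - b)))"
      using s0 by (intro mult_left_mono) auto
    also have "\<dots> = (3 * s) ^ Suc (m - 1) * norm (a - b)" by simp
    also have "Suc (m - 1) = n - 1" using n_ge Trigonometric by (simp add: m_def)
    finally have "(3 * s) ^ (m - 1) * norm (x - y) \<le> (3 * s) ^ (n - 1) * norm (a - b)" .
    then show ?thesis using mult_left_mono[OF _ L0] by (simp only: mult.assoc)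
  qed
  finally show ?thesis unfolding Lip .
qed

lemma rhs_holomorphic2:
  assumes h: "holomorphic2_on h S" and S: "\<And>x. x \<in> S \<Longrightarrow> norm (inner_arg cs (h x)) < \<rr> \<and> snd x \<in> M"
  shows "holomorphic2_on (\<lambda>x. inner_rhs cs n G (h x) (snd x)) S"
proof -
  have "holomorphic2_on (\<lambda>x. inner_arg cs (h x)) S"
  proof (cases cs)
    case Trigonometric
    have "holomorphic2_on (\<lambda>x. exp (h x)) S"
      by (rule holomorphic2_on_compose[OF h]) (rule field_differentiable_within_exp)
    then show ?thesis by (simp add: Trigonometric)
  qed (use h in simp)
  then show ?thesis
    unfolding inner_rhs_eq
    using S by (intro holomorphic2_on_add holomorphic2_on_minus holomorphic2_on_power
        holomorphic2_on_compose_Pair[OF _ holomorphic2_on_snd G_hol]) auto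
qed

abbreviation q :: real where "q \<equiv> 1 + 2 / \<gamma>"

lemma q_pos: "q > 0"
  using \<gamma>_pos by (simp add: add_pos_pos)

lemma norm_ge_W: "W z / q \<le> norm z"
  using W_le_norm[of z] q_pos by (simp add: divide_le_eq mult.commute)

lemma norm_w_le_W:
  assumes "z \<notin> \<real>\<^sub>\<le>\<^sub>0" "W z \<ge> 1"
  shows "norm (w z) \<le> q powr r * W z powr (- r)"
proof -
  have "norm z powr (- r) \<le> (W z / q) powr (- r)"
    using norm_ge_W[of z] q_pos r_pos assms(2) by (intro powr_mono2') auto
  also have "\<dots> = q powr r * W z powr (- r)"
    using q_pos assms(2) by (simp add: powr_divide powr_minus field_simps)
  finally show ?thesis using norm_w[OF assms(1)] by simp
qed

text \<open>One more power than the contraction needs is demanded, so that the spare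
  1/\<open>W\<close> can absorb constants that depend on N.\<close>

lemma norm_w_power_le_W:
  assumes "z \<notin> \<real>\<^sub>\<le>\<^sub>0" "W z \<ge> 1" "real p + 3 \<le> r * real N"
  shows "norm (w z) ^ N \<le> (q powr r) ^ N / W z / W z ^ (p + 2)"
proof -
  have "norm (w z) ^ N \<le> (q powr r * W z powr (- r)) ^ N"
    by (intro power_mono norm_w_le_W assms) simp
  also have "\<dots> = (q powr r) ^ N * W z powr (- r * real N)"
    using assms(2) by (simp add: power_mult_distrib powr_powr flip: powr_realpow)
  also have "\<dots> \<le> (q powr r) ^ N * W z powr (- real (p + 3))"
    using assms by (intro mult_left_mono powr_mono) auto
  also have "W z powr (- real (p + 3)) = 1 / W z ^ (p + 3)"
    using assms(2) by (simp add: powr_minus powr_realpow divide_inverse del: of_nat_add)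
  finally show ?thesis using assms(2) by (simp add: power_add power3_eq_cube power2_eq_square mult_ac)
qed

text \<open>Keeps an admissible correction below the size of the argument itself, so that the
  perturbed argument stays in the disc of convergence. Here too a spare power of \<open>W\<close>
  absorbs the constant.\<close>

lemma inverse_W_power_le_w:
  assumes z: "z \<in> Dom_s \<gamma> \<rho>" "\<rho> > 0" and W: "W z \<ge> 1" "W z \<ge> (1 + \<gamma>) powr r" and p: "r + 1 \<le> real p"
  shows "1 / W z ^ p \<le> norm (w z)"
proof -
  have z0: "z \<notin> \<real>\<^sub>\<le>\<^sub>0" using z by (rule Dom_s_not_nonpos)
  have "W z powr (- real p) \<le> W z powr (- r - 1)" using W(1) p by (intro powr_mono) auto
  also have "\<dots> = W z powr (- r) / W z" using W(1) by (simp add: powr_diff)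
  also have "\<dots> \<le> W z powr (- r) / (1 + \<gamma>) powr r"
    using W \<gamma>_pos by (intro divide_left_mono mult_pos_pos) auto
  also have "\<dots> = ((1 + \<gamma>) * W z) powr (- r)"
    using W(1) \<gamma>_pos by (simp add: powr_mult powr_minus divide_inverse mult.commute)
  also have "\<dots> \<le> norm z powr (- r)"
    using norm_le_W[OF z] r_pos z0 by (intro powr_mono2') auto
  finally show ?thesis using norm_w[OF z0] W(1) by (simp add: powr_minus powr_realpow divide_inverse)
qed

lemma eventually_W_ge: "\<forall>\<^sub>F x in Fl. W (fst x) \<ge> C"
  unfolding eventually_Fl
proof (intro exI[of _ "max 1 (C * \<gamma>)"] conjI ballI)
  fix z \<mu> assume z: "z \<in> Dom_s \<gamma> (max 1 (C * \<gamma>))"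
  have "C \<le> (max 1 (C * \<gamma>) + \<bar>Im z\<bar>) / \<gamma>" using \<gamma>_pos by (simp add: le_divide_eq)
  then show "C \<le> W (fst (z, \<mu>))" using W_gt_Dom_s[OF z] by simp
qed simp

theorem solution_on_Dom_s:
  "\<exists>\<rho>0>0. \<forall>\<rho>\<ge>\<rho>0. \<exists>\<phi>. holomorphic2_on \<phi> (Dom_s \<gamma> \<rho> \<times> M) \<and>
     inner_solution cs n \<rr> G (Dom_s \<gamma> \<rho>) M \<phi> \<and>
     asymptotic_to n lg (phi0 cs n l0 c lg) (Dom_s \<gamma> \<rho>) M \<phi>"
proof -
  define \<Lambda> where "\<Lambda> = 3 * (norm lead + 1)"
  define K where "K = \<bar>Lip\<bar> * \<Lambda> ^ (n - 1) * q ^ 2"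
  have \<Lambda>: "\<Lambda> > 0" by (simp add: \<Lambda>_def add_nonneg_pos)
  have K0: "K \<ge> 0" using \<Lambda> by (simp add: K_def)
  \<comment> \<open>The first lower bound gives the contraction factor 1/2; the second makes the
    correction decay faster than z^(-r-2).\<close>
  obtain p :: nat where p: "max (2 * K) (r + 3) \<le> real p" using real_arch_simple by blast
  obtain N0 :: nat where N0: "(real p + 3) / r \<le> real N0" using real_arch_simple by blast
  define N where "N = max n N0"
  have "(real p + 3) / r \<le> real N" using N0 by (simp add: N_def)
  then have rN: "real p + 3 \<le> r * real N" using r_pos by (simp add: field_simps)
  have Nn: "n \<le> N" "1 \<le> N" using n_ge by (auto simp: N_def)
  have p0: "p > 0" "r + 1 \<le> real p" "r + 2 \<le> real p" "2 * K \<le> real p" "1 \<le> real p"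
    using p r_pos by (auto simp: max_def split: if_splits)
  obtain C1 where C1: "C1 > 0"
    "\<forall>\<^sub>F x in Fl. norm (Delta2 (\<lambda>z. phi N (z, snd x)) (fst x) - inner_rhs cs n G (phi N x) (snd x)) \<le> C1 * norm (w (fst x) ^ N)"
    using residual_Ow[of N] by (rule landau_o.bigE)
  \<comment> \<open>Passing from the truncation at N to the one in the claim costs
    \<open>O(w^n)\<close>, which is of size |z|^(-r-2).\<close>
  have "(\<lambda>x. ev N u x - ev n (cut N) x) \<in> Ow n" by (rule asyD(1)[OF asy_u])
  then have "(\<lambda>x. phi N x - phi n x) \<in> Ow n"
    unfolding phi_eq by (simp add: ev_cut[OF Nn(1)])
  then obtain C2 where C2: "C2 > 0" "\<forall>\<^sub>F x in Fl. norm (phi N x - phi n x) \<le> C2 * norm (w (fst x) ^ n)"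
    by (rule landau_o.bigE)
  have ev_small: "\<forall>\<^sub>F x in Fl. dist (w (fst x)) 0 < \<delta> / 2 / \<Lambda>"
    using tendsto_w by (rule tendstoD) (use \<delta> \<Lambda> in simp)
  \<comment> \<open>The second entry pushes the residual below 1/2 in the weighted norm, the third
    is the threshold of \<open>inverse_W_power_le_w\<close>.\<close>
  define W0 where "W0 = Max {1, 2 * (C1 * (q powr r) ^ N), (1 + \<gamma>) powr r}"
  have "\<forall>\<^sub>F x in Fl. fst x \<in> Dom_s \<gamma> 1 \<and> fst x \<notin> \<real>\<^sub>\<le>\<^sub>0 \<and> W (fst x) \<ge> W0 \<and>
      norm (Delta2 (\<lambda>z. phi N (z, snd x)) (fst x) - inner_rhs cs n G (phi N x) (snd x)) \<le> C1 * norm (w (fst x) ^ N) \<and>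
      norm (phi N x - phi n x) \<le> C2 * norm (w (fst x) ^ n) \<and>
      norm (argN N x) \<le> (norm lead + 1) * norm (w (fst x)) \<and> norm (w (fst x)) < \<delta> / 2 / \<Lambda>"
    using eventually_mem[of 1] eventually_W_ge[of W0] C1(2) C2(2) eventually_norm_argN_le_w[OF Nn(2)] ev_small
    by eventually_elim simp
  from eventually_Fl_uniform[OF this] obtain \<rho>0 where \<rho>0: "\<rho>0 > 0" and
    all: "\<And>\<rho> z \<mu>. \<rho> \<ge> \<rho>0 \<Longrightarrow> z \<in> Dom_s \<gamma> \<rho> \<Longrightarrow> \<mu> \<in> M \<Longrightarrow> z \<in> Dom_s \<gamma> 1 \<and> z \<notin> \<real>\<^sub>\<le>\<^sub>0 \<and> W z \<ge> W0 \<and>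
      norm (Delta2 (\<lambda>z. phi N (z, \<mu>)) z - inner_rhs cs n G (phi N (z, \<mu>)) \<mu>) \<le> C1 * norm (w z ^ N) \<and>
      norm (phi N (z, \<mu>) - phi n (z, \<mu>)) \<le> C2 * norm (w z ^ n) \<and>
      norm (argN N (z, \<mu>)) \<le> (norm lead + 1) * norm (w z) \<and> norm (w z) < \<delta> / 2 / \<Lambda>"
    by auto
  show ?thesis
  \<comment> \<open>Requiring \<open>\<rho>\<close> to be at least \<open>\<gamma>\<close> yields
    \<open>W z\<close> at least 1 from z alone. The other estimates hold only in the presence of a
    point of \<open>M\<close>.\<close>
  proof (intro exI[of _ "max \<rho>0 \<gamma>"] conjI allI impI)
    show "max \<rho>0 \<gamma> > 0" using \<rho>0 by simp
    fix \<rho> assume "\<rho> \<ge> max \<rho>0 \<gamma>"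
    then have \<rho>: "\<rho> \<ge> \<rho>0" "\<rho> > 0" "\<rho> \<ge> \<gamma>" using \<rho>0 by auto
    define D where "D = Dom_s \<gamma> \<rho>"
    note all = all[OF \<rho>(1), folded D_def]
    have W1: "W z \<ge> 1" if "z \<in> D" for z
    proof -
      have "1 \<le> (\<rho> + \<bar>Im z\<bar>) / \<gamma>" using \<gamma>_pos \<rho>(3) by (simp add: le_divide_eq)
      then show ?thesis using W_gt_Dom_s[of z \<rho>] that by (simp add: D_def)
    qed
    have WW: "2 * (C1 * (q powr r) ^ N) \<le> W z" "(1 + \<gamma>) powr r \<le> W z" if "z \<in> D" "\<mu> \<in> M" for z \<mu>
      using all[OF that] by (auto simp: W0_def)
    have wp: "1 / W z ^ p \<le> norm (w z)" "1 / W z ^ p \<le> 1" if "z \<in> D" "\<mu> \<in> M" for z \<mu>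
    proof -
      show "1 / W z ^ p \<le> norm (w z)"
        using that WW(2)[OF that] W1[OF that(1)] by (intro inverse_W_power_le_w[of z \<rho>] \<rho> p0) (auto simp: D_def)
      show "1 / W z ^ p \<le> 1" using one_le_power[OF W1[OF that(1)], of p] by simp
    qed
    have pre: "norm (inner_arg cs (phi N (z, \<mu>))) \<le> (norm lead + 1) * norm (w z)"
        "3 * ((norm lead + 1) * norm (w z)) \<le> \<delta> / 2" if "z \<in> D" "\<mu> \<in> M" for z \<mu>
    proof -
      show "norm (inner_arg cs (phi N (z, \<mu>))) \<le> (norm lead + 1) * norm (w z)"
        using all[OF that] by (simp add: argN_def)
      have "norm (w z) < \<delta> / 2 / \<Lambda>" using all[OF that] by blast
      then have "\<Lambda> * norm (w z) < \<delta> / 2" using \<Lambda> by (simp add: field_simps)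
      then show "3 * ((norm lead + 1) * norm (w z)) \<le> \<delta> / 2" unfolding \<Lambda>_def mult.assoc by linarith
    qed
    have small: "norm a \<le> 1" "norm a \<le> (norm lead + 1) * norm (w z)"
      if "z \<in> D" "\<mu> \<in> M" "norm a \<le> 1 / W z ^ p" for z \<mu> a
    proof -
      show "norm a \<le> 1" using wp(2)[OF that(1,2)] that(3) by linarith
      have "norm a \<le> 1 * norm (w z)" using wp(1)[OF that(1,2)] that(3) by linarith
      also have "\<dots> \<le> (norm lead + 1) * norm (w z)" by (intro mult_right_mono) auto
      finally show "norm a \<le> (norm lead + 1) * norm (w z)" .
    qed
    have arg_small: "norm (inner_arg cs (phi N (z, \<mu>) + a)) < \<rr>"
      if "z \<in> D" "\<mu> \<in> M" "norm a \<le> 1 / W z ^ p" for z \<mu> a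
      using inner_arg_perturbed[OF pre(1)[OF that(1,2)] small[OF that]] pre(2)[OF that(1,2)] \<delta> by linarith
    interpret P: perturbed_difference_equation D M W "phi N" "\<lambda>a \<mu>. inner_rhs cs n G a \<mu>" p K "1 / 2"
    proof
      show "open D" unfolding D_def by (rule open_Dom_s)
      show "open M" by (rule M_open)
      show "z + 1 \<in> D" if "z \<in> D" for z
        using that \<gamma>_pos by (simp add: D_def Dom_s_def algebra_simps)
      show "W (z + 1) = W z + 1" for z by (simp add: W_def)
      show "W z \<ge> 1" if "z \<in> D" for z by (rule W1[OF that])
      show "p > 0" "0 \<le> K" "2 * K \<le> real p" "0 \<le> (1 / 2 :: real)" "2 * (1 / 2) \<le> real p"
        using p0 K0 by auto
      show "holomorphic2_on (phi N) (D \<times> M)" unfolding D_def by (rule phi_holomorphic2[OF \<rho>(2)])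
    next
      fix z \<mu> assume z1: "z - 1 \<in> D" and \<mu>: "\<mu> \<in> M"
      have z: "z \<in> D" using z1 \<gamma>_pos by (simp add: D_def Dom_s_def algebra_simps)
      note A = all[OF z \<mu>]
      have "norm (Delta2 (\<lambda>x. phi N (x, \<mu>)) z - inner_rhs cs n G (phi N (z, \<mu>)) \<mu>) \<le> C1 * norm (w z) ^ N"
        using A by (simp add: norm_power)
      also have "\<dots> \<le> C1 * ((q powr r) ^ N / W z / W z ^ (p + 2))"
        using A C1(1) by (intro mult_left_mono norm_w_power_le_W W1[OF z] rN) auto
      also have "\<dots> = C1 * (q powr r) ^ N / W z / W z ^ (p + 2)" by simp
      also have "\<dots> \<le> (1 / 2) / W z ^ (p + 2)"
        using WW(1)[OF z \<mu>] W1[OF z] by (intro divide_right_mono) (auto simp: divide_le_eq)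
      finally show "norm (Delta2 (\<lambda>x. phi N (x, \<mu>)) z - inner_rhs cs n G (phi N (z, \<mu>)) \<mu>) \<le> (1 / 2) / W z ^ (p + 2)" .
    next
      fix z \<mu> a b :: complex assume z: "z \<in> D" and \<mu>: "\<mu> \<in> M" and a: "norm a \<le> 1 / W z ^ p" and b: "norm b \<le> 1 / W z ^ p"
      have z0: "z \<notin> \<real>\<^sub>\<le>\<^sub>0" using all[OF z \<mu>] by blast
      have "norm (inner_rhs cs n G (phi N (z, \<mu>) + a) \<mu> - inner_rhs cs n G (phi N (z, \<mu>) + b) \<mu>)
          \<le> Lip * (3 * ((norm lead + 1) * norm (w z))) ^ (n - 1) * norm (a - b)"
        by (rule rhs_Lipschitz[OF \<mu> pre[OF z \<mu>] small[OF z \<mu> a] small[OF z \<mu> b]])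
      also have "\<dots> \<le> \<bar>Lip\<bar> * (3 * ((norm lead + 1) * norm (w z))) ^ (n - 1) * norm (a - b)"
        by (intro mult_right_mono) auto
      also have "(3 * ((norm lead + 1) * norm (w z))) ^ (n - 1) = \<Lambda> ^ (n - 1) * norm (w z) ^ (n - 1)"
        unfolding \<Lambda>_def power_mult_distrib mult.assoc ..
      also have "norm (w z) ^ (n - 1) = 1 / norm z ^ 2"
        using w_power_eq[OF z0] by (simp add: norm_divide flip: norm_power)
      also have "\<bar>Lip\<bar> * (\<Lambda> ^ (n - 1) * (1 / norm z ^ 2)) * norm (a - b) \<le> \<bar>Lip\<bar> * (\<Lambda> ^ (n - 1) * (q ^ 2 / W z ^ 2)) * norm (a - b)"
      proof (intro mult_right_mono mult_left_mono)
        have "0 < W z / q" using q_pos W1[OF z] by simp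
        then have "1 / norm z ^ 2 \<le> 1 / (W z / q) ^ 2"
          using norm_ge_W[of z] by (intro divide_left_mono power_mono mult_pos_pos zero_less_power) auto
        then show "1 / norm z ^ 2 \<le> q ^ 2 / W z ^ 2" by (simp add: power_divide)
      qed (use \<Lambda> in auto)
      also have "\<dots> = K / W z ^ 2 * norm (a - b)" by (simp add: K_def)
      finally show "norm (inner_rhs cs n G (phi N (z, \<mu>) + a) \<mu> - inner_rhs cs n G (phi N (z, \<mu>) + b) \<mu>) \<le> K / W z ^ 2 * norm (a - b)" .
    next
      fix \<psi> assume \<psi>: "holomorphic2_on \<psi> (D \<times> M)" "\<And>z \<mu>. z \<in> D \<Longrightarrow> \<mu> \<in> M \<Longrightarrow> norm (\<psi> (z, \<mu>)) \<le> 1 / W z ^ p"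
      show "holomorphic2_on (\<lambda>x. inner_rhs cs n G (phi N x + \<psi> x) (snd x)) (D \<times> M)"
      proof (rule rhs_holomorphic2)
        show "holomorphic2_on (\<lambda>x. phi N x + \<psi> x) (D \<times> M)"
          using phi_holomorphic2[OF \<rho>(2), of N] \<psi>(1) unfolding D_def by (rule holomorphic2_on_add)
        show "norm (inner_arg cs (phi N x + \<psi> x)) < \<rr> \<and> snd x \<in> M" if "x \<in> D \<times> M" for x
          using arg_small \<psi>(2) that by (cases x) auto
      qed
    qed
    obtain \<psi> where \<psi>: "holomorphic2_on \<psi> (D \<times> M)"
      and \<psi>_bd: "\<And>z \<mu>. z \<in> D \<Longrightarrow> \<mu> \<in> M \<Longrightarrow> norm (\<psi> (z, \<mu>)) \<le> 1 / W z ^ p"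
      and \<psi>_eq: "\<And>z \<mu>. z - 1 \<in> D \<Longrightarrow> \<mu> \<in> M \<Longrightarrow>
        Delta2 (\<lambda>x. phi N (x, \<mu>) + \<psi> (x, \<mu>)) z = inner_rhs cs n G (phi N (z, \<mu>) + \<psi> (z, \<mu>)) \<mu>"
      using P.solution_exists by blast
    define \<phi> where "\<phi> = (\<lambda>x. phi N x + \<psi> x)"
    show "\<exists>\<phi>. holomorphic2_on \<phi> (Dom_s \<gamma> \<rho> \<times> M) \<and>
       inner_solution cs n \<rr> G (Dom_s \<gamma> \<rho>) M \<phi> \<and>
       asymptotic_to n lg (phi0 cs n l0 c lg) (Dom_s \<gamma> \<rho>) M \<phi>"
      unfolding D_def[symmetric]
    proof (intro exI[of _ \<phi>] conjI)
      show "holomorphic2_on \<phi> (D \<times> M)"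
        unfolding \<phi>_def using phi_holomorphic2[OF \<rho>(2), of N] \<psi> unfolding D_def by (rule holomorphic2_on_add)
      show "inner_solution cs n \<rr> G D M \<phi>"
        unfolding inner_solution_def \<phi>_def using \<psi>_eq arg_small \<psi>_bd by blast
      show "asymptotic_to n lg (phi0 cs n l0 c lg) D M \<phi>"
        unfolding asymptotic_to_def
      proof (intro exI[of _ "\<lambda>x. \<phi> x - phi n x"] conjI ballI)
        show "\<phi> (z, \<mu>) = phi0 cs n l0 c lg z \<mu> + (\<phi> (z, \<mu>) - phi n (z, \<mu>))" for z \<mu>
          by (simp add: phi0_eq)
        have "norm (branch_power lg z (r + 2) * (\<phi> (z, \<mu>) - phi n (z, \<mu>))) \<le> C2 + (1 + \<gamma>) powr (r + 2)"
          if z: "z \<in> D" and \<mu>: "\<mu> \<in> M" for z \<mu>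
        proof -
          note A = all[OF z \<mu>]
          have z0: "z \<notin> \<real>\<^sub>\<le>\<^sub>0" "z \<noteq> 0" using A by auto
          have bp: "norm (branch_power lg z (r + 2)) = norm z powr (r + 2)"
            using z0 lg_eq[OF z0(1)] Re_\<kappa> by (simp add: branch_power_def powr_def)
          have "norm (phi N (z, \<mu>) - phi n (z, \<mu>)) \<le> C2 * norm (w z) ^ n" using A by (simp add: norm_power)
          also have "norm (w z) ^ n = norm z powr (- (r + 2))"
          proof -
            have "norm (w z) ^ n = norm z powr (- r * real n)"
              unfolding norm_w[OF z0(1)] using z0 by (simp add: powr_powr flip: powr_realpow)
            also have "- r * real n = - (r + 2)" using rexp_mult_n[OF n_ge] by (simp add: mult.commute)
            finally show ?thesis .
          qed
          finally have 1: "norm (phi N (z, \<mu>) - phi n (z, \<mu>)) \<le> C2 * norm z powr (- (r + 2))" .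
          have 2: "norm z powr (r + 2) * norm (\<psi> (z, \<mu>)) \<le> (1 + \<gamma>) powr (r + 2)"
          proof -
            have "norm z powr (r + 2) * norm (\<psi> (z, \<mu>)) \<le> ((1 + \<gamma>) * W z) powr (r + 2) * (1 / W z ^ p)"
              using norm_le_W[of z \<rho>] z \<rho>(2) r_pos \<psi>_bd[OF z \<mu>] by (intro mult_mono powr_mono2) (auto simp: D_def)
            also have "\<dots> = (1 + \<gamma>) powr (r + 2) * (W z powr (r + 2) / W z powr real p)"
              using W1[OF z] \<gamma>_pos by (simp add: powr_mult powr_realpow)
            also have "\<dots> \<le> (1 + \<gamma>) powr (r + 2) * 1"
              using W1[OF z] p0(3) by (intro mult_left_mono) (auto simp: divide_le_eq_1 intro!: powr_mono)
            finally show ?thesis by simp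
          qed
          have "norm (branch_power lg z (r + 2) * (\<phi> (z, \<mu>) - phi n (z, \<mu>)))
              = norm z powr (r + 2) * norm ((phi N (z, \<mu>) - phi n (z, \<mu>)) + \<psi> (z, \<mu>))"
            unfolding norm_mult bp \<phi>_def by (simp add: algebra_simps)
          also have "\<dots> \<le> norm z powr (r + 2) * (C2 * norm z powr (- (r + 2)) + norm (\<psi> (z, \<mu>)))"
            using 1 by (intro mult_left_mono order_trans[OF norm_triangle_ineq] add_right_mono) auto
          also have "\<dots> = C2 + norm z powr (r + 2) * norm (\<psi> (z, \<mu>))"
          proof -
            have "norm z powr (r + 2) * norm z powr (- (r + 2)) = 1"
              using z0 unfolding powr_add[symmetric] by simp
            then show ?thesis by (simp only: distrib_left mult.left_commute[of _ C2] mult_1_right)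
          qed
          finally show ?thesis using 2 by linarith
        qed
        then show "bdd_above ((\<lambda>(z, \<mu>). norm (branch_power lg z (r + 2) * (\<phi> (z, \<mu>) - phi n (z, \<mu>)))) ` (D \<times> M))"
          by (intro bdd_aboveI[of _ "C2 + (1 + \<gamma>) powr (r + 2)"]) auto
      qed
    qed
  qed
qed

end


section \<open>Branches of the logarithm and the reflection of the domain\<close>

text \<open>The difference to \<open>Ln\<close> has derivative 0 on the connected slit plane. The
  value \<open>\<sigma> = -1\<close> admits logarithms of -z, and evaluation at 1 gives
  exp(\<open>\<kappa>\<close>) = \<open>\<sigma>\<close>.\<close>

lemma branch_eq_Ln_plus_const:
  assumes hol: "lg holomorphic_on - \<real>\<^sub>\<le>\<^sub>0" and exp: "\<And>z. z \<notin> \<real>\<^sub>\<le>\<^sub>0 \<Longrightarrow> exp (lg z) = \<sigma> * z" and \<sigma>: "\<sigma> ^ 2 = 1"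
  shows "\<exists>\<kappa>. (\<forall>z. z \<notin> \<real>\<^sub>\<le>\<^sub>0 \<longrightarrow> lg z = Ln z + \<kappa>) \<and> exp (2 * \<kappa>) = 1"
proof -
  let ?S = "- \<real>\<^sub>\<le>\<^sub>0 :: complex set"
  have op: "open ?S" by (simp add: open_Compl)
  have "?S = - (complex_of_real ` {..0})" by (auto simp: nonpos_Reals_def)
  then have con: "connected ?S"
    using starlike_imp_connected[OF starlike_slotted_complex_plane_left, of 0] by simp
  have der: "((\<lambda>z. lg z - Ln z) has_field_derivative 0) (at z)" if z: "z \<in> ?S" for z
  proof -
    have z0: "z \<noteq> 0" and z': "z \<notin> \<real>\<^sub>\<le>\<^sub>0" using z by auto
    obtain l where l: "(lg has_field_derivative l) (at z)"
      using hol z unfolding holomorphic_on_open[OF op] by blast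
    have "((\<lambda>z. exp (lg z)) has_field_derivative exp (lg z) * l) (at z)"
      by (rule DERIV_chain2[OF DERIV_exp l])
    then have "((\<lambda>z. \<sigma> * z) has_field_derivative exp (lg z) * l) (at z)"
      using z by (rule has_field_derivative_transform_within_open[OF _ op]) (use exp in auto)
    moreover have "((\<lambda>z. \<sigma> * z) has_field_derivative \<sigma>) (at z)" by (auto intro!: derivative_eq_intros)
    ultimately have "exp (lg z) * l = \<sigma>" by (rule DERIV_unique)
    then have "l = inverse z" using exp[OF z'] \<sigma> z0 by (auto simp: field_simps)
    then show ?thesis using DERIV_diff[OF l has_field_derivative_Ln[OF z']] by simp
  qed
  have cont: "continuous_on ?S (\<lambda>z. lg z - Ln z)"
    by (rule continuous_at_imp_continuous_on, rule ballI, rule DERIV_isCont, rule der)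
  obtain \<kappa> where \<kappa>: "\<And>z. z \<in> ?S \<Longrightarrow> lg z - Ln z = \<kappa>"
    by (rule DERIV_zero_connected_constant[OF con op finite.emptyI cont]) (use der in auto)
  have eq: "lg z = Ln z + \<kappa>" if "z \<notin> \<real>\<^sub>\<le>\<^sub>0" for z using \<kappa>[of z] that by (simp add: algebra_simps)
  have "exp (2 * \<kappa>) = exp (lg 1) ^ 2" using eq[of 1] by (simp add: exp_double)
  also have "\<dots> = 1" using exp[of 1] \<sigma> by simp
  finally show ?thesis using eq by blast
qed

lemma solution_on_Dom_s_branch:
  fixes cs :: inner_case
  assumes "n \<ge> 2" and "c0 ^ (n - 1) = of_real (- rexp n * (rexp n + 1))" and "\<rr> > 0" and "open M"
    and "holomorphic2_on G (ball 0 \<rr> \<times> M)" and "\<exists>\<delta>>0. bounded (G ` (ball 0 \<delta> \<times> M))"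
    and "inner_expansion cs n \<rr> M G Gk" and "exp l0 = of_real (- 2 / (real n - 1))"
    and "formal_solution cs n c0 l0 M Gk c" and "\<gamma> > 0"
    and "lg holomorphic_on - \<real>\<^sub>\<le>\<^sub>0" and "\<And>z. z \<notin> \<real>\<^sub>\<le>\<^sub>0 \<Longrightarrow> exp (lg z) = \<sigma> * z" and "\<sigma> ^ 2 = 1"
  shows "\<exists>\<rho>0>0. \<forall>\<rho>\<ge>\<rho>0. \<exists>\<phi>. holomorphic2_on \<phi> (Dom_s \<gamma> \<rho> \<times> M) \<and>
     inner_solution cs n \<rr> G (Dom_s \<gamma> \<rho>) M \<phi> \<and>
     asymptotic_to n lg (phi0 cs n l0 c lg) (Dom_s \<gamma> \<rho>) M \<phi>"
proof -
  obtain \<kappa> where \<kappa>: "\<And>z. z \<notin> \<real>\<^sub>\<le>\<^sub>0 \<Longrightarrow> lg z = Ln z + \<kappa>" "exp (2 * \<kappa>) = 1"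
    using branch_eq_Ln_plus_const[OF assms(11-13)] by blast
  obtain \<delta> B where \<delta>: "0 < \<delta>" "\<delta> < \<rr>" "\<And>k \<mu>. \<mu> \<in> M \<Longrightarrow> norm (Gk k \<mu>) \<le> B / \<delta> ^ k"
    using inner_expansion_coeff_bound[OF assms(7,3,1,6)] by blast
  interpret inner_problem n \<gamma> M lg \<kappa> cs c0 l0 \<rr> \<delta> B G Gk c
    by unfold_locales (use assms \<kappa> \<delta> in simp_all)
  show ?thesis by (rule solution_on_Dom_s)
qed

lemma mem_Dom_u_iff: "z \<in> Dom_u \<gamma> \<rho> \<longleftrightarrow> - z \<in> Dom_s \<gamma> \<rho>"
  unfolding Dom_u_def by (metis (no_types, lifting) add.inverse_inverse image_iff)

text \<open>The truncated formal solution sees z only through the chosen logarithm.\<close>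

lemma phi0_reflect: "phi0 cs n l0 c (\<lambda>z. lg (- z)) (- z) \<mu> = phi0 cs n l0 c lg z \<mu>"
  by (cases cs) (simp_all add: phi0_def branch_power_def)

lemma holomorphic2_on_reflect:
  assumes "holomorphic2_on \<phi> (Dom_s \<gamma> \<rho> \<times> M)"
  shows "holomorphic2_on (\<lambda>x. \<phi> (- fst x, snd x)) (Dom_u \<gamma> \<rho> \<times> M)"
proof (rule holomorphic2_on_compose_Pair[OF _ _ assms])
  show "holomorphic2_on (\<lambda>x. - fst x) (Dom_u \<gamma> \<rho> \<times> M)"
    by (rule holomorphic2_on_minus[OF holomorphic2_on_fst])
  show "holomorphic2_on snd (Dom_u \<gamma> \<rho> \<times> M)" by (rule holomorphic2_on_snd)
qed (auto simp: mem_Dom_u_iff)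

lemma inner_solution_reflect:
  assumes "inner_solution cs n \<rr> G (Dom_s \<gamma> \<rho>) M \<phi>"
  shows "inner_solution cs n \<rr> G (Dom_u \<gamma> \<rho>) M (\<lambda>x. \<phi> (- fst x, snd x))"
  unfolding inner_solution_def
proof (intro allI impI, elim conjE)
  fix z \<mu> assume "z - 1 \<in> Dom_u \<gamma> \<rho>" "z \<in> Dom_u \<gamma> \<rho>" "z + 1 \<in> Dom_u \<gamma> \<rho>" "\<mu> \<in> M"
  then have "- z + 1 \<in> Dom_s \<gamma> \<rho>" "- z \<in> Dom_s \<gamma> \<rho>" "- z - 1 \<in> Dom_s \<gamma> \<rho>" "\<mu> \<in> M"
    by (simp_all add: mem_Dom_u_iff)
  then have "norm (inner_arg cs (\<phi> (- z, \<mu>))) < \<rr>"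
    and "Delta2 (\<lambda>x. \<phi> (x, \<mu>)) (- z) = inner_rhs cs n G (\<phi> (- z, \<mu>)) \<mu>"
    using assms unfolding inner_solution_def by blast+
  moreover have "Delta2 (\<lambda>x. \<phi> (- x, \<mu>)) z = Delta2 (\<lambda>x. \<phi> (x, \<mu>)) (- z)"
    by (simp add: Delta2_def minus_diff_commute)
  ultimately show "norm (inner_arg cs (\<phi> (- fst (z, \<mu>), snd (z, \<mu>)))) < \<rr> \<and>
      Delta2 (\<lambda>x. \<phi> (- fst (x, \<mu>), snd (x, \<mu>))) z = inner_rhs cs n G (\<phi> (- fst (z, \<mu>), snd (z, \<mu>))) \<mu>"
    by simp
qed

lemma asymptotic_to_reflect:
  assumes "asymptotic_to n (\<lambda>z. lg (- z)) (phi0 cs n l0 c (\<lambda>z. lg (- z))) (Dom_s \<gamma> \<rho>) M \<phi>"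
  shows "asymptotic_to n lg (phi0 cs n l0 c lg) (Dom_u \<gamma> \<rho>) M (\<lambda>x. \<phi> (- fst x, snd x))"
proof -
  obtain \<psi> C where \<psi>: "\<And>z \<mu>. z \<in> Dom_s \<gamma> \<rho> \<Longrightarrow> \<mu> \<in> M \<Longrightarrow> \<phi> (z, \<mu>) = phi0 cs n l0 c (\<lambda>z. lg (- z)) z \<mu> + \<psi> (z, \<mu>)"
    and C: "\<And>z \<mu>. z \<in> Dom_s \<gamma> \<rho> \<Longrightarrow> \<mu> \<in> M \<Longrightarrow> norm (branch_power (\<lambda>z. lg (- z)) z (rexp n + 2) * \<psi> (z, \<mu>)) \<le> C"
    using assms unfolding asymptotic_to_def bdd_above_def by fastforce
  show ?thesis
    unfolding asymptotic_to_def
  proof (intro exI[of _ "\<lambda>x. \<psi> (- fst x, snd x)"] conjI ballI)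
    fix z \<mu> assume "z \<in> Dom_u \<gamma> \<rho>" "\<mu> \<in> M"
    then show "\<phi> (- fst (z, \<mu>), snd (z, \<mu>)) = phi0 cs n l0 c lg z \<mu> + \<psi> (- fst (z, \<mu>), snd (z, \<mu>))"
      using \<psi>[of "- z" \<mu>] by (simp add: mem_Dom_u_iff phi0_reflect)
  next
    have "norm (branch_power lg z (rexp n + 2) * \<psi> (- z, \<mu>)) \<le> C" if "z \<in> Dom_u \<gamma> \<rho>" "\<mu> \<in> M" for z \<mu>
      using C[of "- z" \<mu>] that by (simp add: mem_Dom_u_iff branch_power_def)
    then show "bdd_above ((\<lambda>(z, \<mu>). norm (branch_power lg z (rexp n + 2) * \<psi> (- fst (z, \<mu>), snd (z, \<mu>)))) ` (Dom_u \<gamma> \<rho> \<times> M))"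
      by (intro bdd_aboveI[of _ C]) auto
  qed
qed

theorem theorem3p3:
  fixes cs :: inner_case and n :: nat and c0 l0 :: complex and \<gamma> \<mu>0 \<rr> :: real
    and G :: "complex \<times> complex \<Rightarrow> complex" and Gk :: "nat \<Rightarrow> complex \<Rightarrow> complex"
    and c :: "nat \<Rightarrow> nat \<Rightarrow> complex \<Rightarrow> complex" and lu ls :: "complex \<Rightarrow> complex"
  assumes "n \<ge> 2"
    and "c0 ^ (n - 1) = of_real (- rexp n * (rexp n + 1))"
    and "\<mu>0 > 0" and "\<rr> > 0"
    and "holomorphic2_on G (ball 0 \<rr> \<times> ball 0 \<mu>0)"
    and G_uniform: "\<exists>\<delta>>0. bounded (G ` (ball 0 \<delta> \<times> ball 0 \<mu>0))"
    and "inner_expansion cs n \<rr> (ball 0 \<mu>0) G Gk"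
    and "log_branches lu ls"
    and "exp l0 = of_real (- 2 / (real n - 1))"
    and "formal_solution cs n c0 l0 (ball 0 \<mu>0) Gk c"
    and "\<gamma> > 0"
  shows "\<exists>\<rho>0>0. \<forall>\<rho>\<ge>\<rho>0. \<exists>\<phi>u \<phi>s.
     holomorphic2_on \<phi>u (Dom_u \<gamma> \<rho> \<times> ball 0 \<mu>0) \<and>
     holomorphic2_on \<phi>s (Dom_s \<gamma> \<rho> \<times> ball 0 \<mu>0) \<and>
     inner_solution cs n \<rr> G (Dom_u \<gamma> \<rho>) (ball 0 \<mu>0) \<phi>u \<and>
     inner_solution cs n \<rr> G (Dom_s \<gamma> \<rho>) (ball 0 \<mu>0) \<phi>s \<and>
     asymptotic_to n lu (phi0 cs n l0 c lu) (Dom_u \<gamma> \<rho>) (ball 0 \<mu>0) \<phi>u \<and>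
     asymptotic_to n ls (phi0 cs n l0 c ls) (Dom_s \<gamma> \<rho>) (ball 0 \<mu>0) \<phi>s"
proof -
  have ls: "ls holomorphic_on - \<real>\<^sub>\<le>\<^sub>0" "\<And>z. z \<notin> \<real>\<^sub>\<le>\<^sub>0 \<Longrightarrow> exp (ls z) = 1 * z"
    and lu: "lu holomorphic_on - \<real>\<^sub>\<ge>\<^sub>0" "\<And>z. z \<notin> \<real>\<^sub>\<ge>\<^sub>0 \<Longrightarrow> exp (lu z) = z"
    using assms(8) by (auto simp: log_branches_def)
  have neg: "- z \<notin> \<real>\<^sub>\<ge>\<^sub>0" if "z \<notin> \<real>\<^sub>\<le>\<^sub>0" for z :: complex
    using that by (auto simp: complex_nonneg_Reals_iff complex_nonpos_Reals_iff)
  have "(lu \<circ> uminus) holomorphic_on - \<real>\<^sub>\<le>\<^sub>0"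
    by (rule holomorphic_on_compose_gen[OF _ lu(1)]) (use neg in \<open>auto intro: holomorphic_intros\<close>)
  then have lu': "(\<lambda>z. lu (- z)) holomorphic_on - \<real>\<^sub>\<le>\<^sub>0" by (simp add: comp_def)
  \<comment> \<open>The reflected branch is a logarithm of -z, so the result on \<open>Dom_s\<close>
    is applied with \<open>\<sigma> = -1\<close>.\<close>
  have lu'': "exp (lu (- z)) = (- 1) * z" if "z \<notin> \<real>\<^sub>\<le>\<^sub>0" for z using lu(2)[OF neg[OF that]] by simp
  note sol = solution_on_Dom_s_branch[OF assms(1,2,4) open_ball assms(5,6,7,9,10,11)]
  obtain \<rho>s where \<rho>s: "\<rho>s > 0" "\<And>\<rho>. \<rho> \<ge> \<rho>s \<Longrightarrow> \<exists>\<phi>. holomorphic2_on \<phi> (Dom_s \<gamma> \<rho> \<times> ball 0 \<mu>0) \<and>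
     inner_solution cs n \<rr> G (Dom_s \<gamma> \<rho>) (ball 0 \<mu>0) \<phi> \<and>
     asymptotic_to n ls (phi0 cs n l0 c ls) (Dom_s \<gamma> \<rho>) (ball 0 \<mu>0) \<phi>"
    using sol[OF ls] by auto
  obtain \<rho>u where \<rho>u: "\<rho>u > 0" "\<And>\<rho>. \<rho> \<ge> \<rho>u \<Longrightarrow> \<exists>\<phi>. holomorphic2_on \<phi> (Dom_s \<gamma> \<rho> \<times> ball 0 \<mu>0) \<and>
     inner_solution cs n \<rr> G (Dom_s \<gamma> \<rho>) (ball 0 \<mu>0) \<phi> \<and>
     asymptotic_to n (\<lambda>z. lu (- z)) (phi0 cs n l0 c (\<lambda>z. lu (- z))) (Dom_s \<gamma> \<rho>) (ball 0 \<mu>0) \<phi>"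
    using sol[OF lu' lu''] by auto
  show ?thesis
  proof (intro exI[of _ "max \<rho>s \<rho>u"] conjI allI impI)
    show "max \<rho>s \<rho>u > 0" using \<rho>s(1) by simp
    fix \<rho> assume "\<rho> \<ge> max \<rho>s \<rho>u"
    then have \<rho>: "\<rho> \<ge> \<rho>s" "\<rho> \<ge> \<rho>u" by auto
    obtain \<phi>s where s: "holomorphic2_on \<phi>s (Dom_s \<gamma> \<rho> \<times> ball 0 \<mu>0)"
      "inner_solution cs n \<rr> G (Dom_s \<gamma> \<rho>) (ball 0 \<mu>0) \<phi>s"
      "asymptotic_to n ls (phi0 cs n l0 c ls) (Dom_s \<gamma> \<rho>) (ball 0 \<mu>0) \<phi>s"
      using \<rho>s(2)[OF \<rho>(1)] by blast
    obtain \<phi>' where u: "holomorphic2_on \<phi>' (Dom_s \<gamma> \<rho> \<times> ball 0 \<mu>0)"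
      "inner_solution cs n \<rr> G (Dom_s \<gamma> \<rho>) (ball 0 \<mu>0) \<phi>'"
      "asymptotic_to n (\<lambda>z. lu (- z)) (phi0 cs n l0 c (\<lambda>z. lu (- z))) (Dom_s \<gamma> \<rho>) (ball 0 \<mu>0) \<phi>'"
      using \<rho>u(2)[OF \<rho>(2)] by blast
    show "\<exists>\<phi>u \<phi>s.
       holomorphic2_on \<phi>u (Dom_u \<gamma> \<rho> \<times> ball 0 \<mu>0) \<and>
       holomorphic2_on \<phi>s (Dom_s \<gamma> \<rho> \<times> ball 0 \<mu>0) \<and>
       inner_solution cs n \<rr> G (Dom_u \<gamma> \<rho>) (ball 0 \<mu>0) \<phi>u \<and>
       inner_solution cs n \<rr> G (Dom_s \<gamma> \<rho>) (ball 0 \<mu>0) \<phi>s \<and>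
       asymptotic_to n lu (phi0 cs n l0 c lu) (Dom_u \<gamma> \<rho>) (ball 0 \<mu>0) \<phi>u \<and>
       asymptotic_to n ls (phi0 cs n l0 c ls) (Dom_s \<gamma> \<rho>) (ball 0 \<mu>0) \<phi>s"
      by (intro exI[of _ \<phi>s] exI[of _ "\<lambda>x. \<phi>' (- fst x, snd x)"] conjI s
          holomorphic2_on_reflect[OF u(1)] inner_solution_reflect[OF u(2)] asymptotic_to_reflect[OF u(3)])
  qed
qed

end
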